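(* Let $K$ be a field, $q\in K$ a primitive $n$'th root of unity with $n\ge2$, and $\mathbb{A}=K[h][x;\sigma]$ with $\sigma(h)=qh$. Then: 1. $\mathrm{Spec}(\mathbb{A})=\{\{0\},(x),(h),(x,h)\}\sqcup\mathbb{X}\sqcup\mathbb{M}\sqcup\mathbb{H}\sqcup\mathcal{N}$, where $\mathbb{X}=\{(x,\mathfrak{q})\mid\mathfrak{q}\in\mathrm{Spec}\,K[h]\setminus\{0,(h)\}\}$, $\mathbb{M}=\{\mathbb{A}\mathfrak{m}\mid\mathfrak{m}\in\mathrm{Max}(Z(\mathbb{A})),\ s,t\notin\mathfrak{m}\}$, $\mathbb{H}=\{(h,\mathfrak{q}')\mid\mathfrak{q}'\in\mathrm{Spec}\,K[x]\setminus\{0,(x)\}\}$, $\mathcal{N}=\{\mathbb{A}\mathfrak{n}\mid\mathfrak{n}\in\mathrm{Spec}\,Z(\mathbb{A}),\ \mathrm{ht}(\mathfrak{n})=1,\ \mathfrak{n}\neq(t),(s)\}$, and $Z(\mathbb{A})=K[s,t]$ is a polynomial algebra in two variables $s=h^n$ and $t=x^n$. The containments between the prime ideals are given by a diagram with vertices $0$, $(x)$, $(h)$, $\mathcal{N}$, $\mathbb{X}$, $\{(x,h)\}$, $\mathbb{M}$, $\mathbb{H}$ and exactly the following lines. Solid lines (the lower ideal is strictly contained in the upper ideal, respectively in, or for, every element of the set at the other end): from $0$ up to $(x)$, to $(h)$ and to $\mathcal{N}$; from $(x)$ up to $\mathbb{X}$ and to $(x,h)$; from $(h)$ up to $\mathbb{H}$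 and to $(x,h)$. Dotted lines (the obvious possible inclusions between primes of the lower set and primes of the upper set): from $\mathcal{N}$ up to $\mathbb{X}$, to $\mathbb{M}$ and to $\mathbb{H}$. 2. Every nonzero ideal of the algebra $\mathbb{A}$ meets the centre $Z(\mathbb{A})$. 3. $\mathrm{Max}(\mathbb{A})=\mathbb{X}\sqcup\{(x,h)\}\sqcup\mathbb{M}\sqcup\mathbb{H}$.
   Context: $\mathbb{A}$ is the skew polynomial algebra: the $K$-algebra generated by $h,x$ with the defining relation $xh=qhx$. $\mathrm{Spec}$ and $\mathrm{Max}$ denote the sets of prime and maximal (two-sided) ideals, $Z(\cdot)$ the centre, $\mathrm{ht}$ the height of a prime ideal, and $(\ldots)$ the two-sided ideal generated by the listed elements/sets. "Meets the centre" means having nonzero intersection with it.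
   Formalization: The diagram as stated omits inclusions from 𝒩 to (x,h), yet A(s−t) lies in 𝒩 and is contained in (x,h); the formal statement adds one dotted line from 𝒩 up to (x,h) and keeps all other lines and exhaustiveness. *)

theory Defs
  imports
    "HOL-Algebra.Ideal_Product"
    "HOL-Algebra.Generated_Rings"
    "HOL-Computational_Algebra.Polynomial"
    "HOL-Algebra.Algebraic_Closure_Type"
    "HOL-Library.Extended_Nat"
begin

section \<open>Ideals of rings that need not be commutative\<close>

text \<open>The locale \<^locale>\<open>primeideal\<close> is restricted to commutative rings, so prime ideals are
  defined here through products of two-sided ideals; \<open>Spec_cring\<close> below shows that both notions
  agree on commutative rings.\<close>

definition Spec :: "('a, 'b) ring_scheme \<Rightarrow> 'a set set" where
  "Spec R = {P. ideal P R \<and> P \<noteq> carrier R \<and>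
     (\<forall>I J. ideal I R \<longrightarrow> ideal J R \<longrightarrow> ideal_prod R I J \<subseteq> P \<longrightarrow> I \<subseteq> P \<or> J \<subseteq> P)}"

definition Max_Spec :: "('a, 'b) ring_scheme \<Rightarrow> 'a set set" where
  "Max_Spec R = {P. maximalideal P R}"

definition ht :: "('a, 'b) ring_scheme \<Rightarrow> 'a set \<Rightarrow> enat" where
  "ht R P = Sup {enat l | l. \<exists>C. C l = P \<and> (\<forall>i\<le>l. C i \<in> Spec R) \<and> (\<forall>i<l. C i \<subset> C (Suc i))}"

definition centre :: "('a, 'b) ring_scheme \<Rightarrow> 'a set" where
  "centre R = {z \<in> carrier R. \<forall>a\<in>carrier R. z \<otimes>\<^bsub>R\<^esub> a = a \<otimes>\<^bsub>R\<^esub> z}"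

lemma Spec_cring:
  assumes "cring R"
  shows "Spec R = {P. primeideal P R}"
proof -
  interpret cring R by (rule assms)
  have "primeideal P R" if P: "P \<in> Spec R" for P
  proof -
    have id: "ideal P R" and ne: "carrier R \<noteq> P" using P by (auto simp: Spec_def)
    interpret P: ideal P R by (rule id)
    show ?thesis
    proof (rule primeidealI[OF id is_cring ne])
      fix a b assume a: "a \<in> carrier R" and b: "b \<in> carrier R" and ab: "a \<otimes>\<^bsub>R\<^esub> b \<in> P"
      have "c \<in> P" if "c \<in> ideal_prod R (PIdl\<^bsub>R\<^esub> a) (PIdl\<^bsub>R\<^esub> b)" for c
        using that
      proof induction
        case (prod i j)
        then obtain x y where xy: "x \<in> carrier R" "y \<in> carrier R" "i = x \<otimes>\<^bsub>R\<^esub> a" "j = y \<otimes>\<^bsub>R\<^esub> b"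
          by (auto simp: cgenideal_def)
        have "i \<otimes>\<^bsub>R\<^esub> j = (x \<otimes>\<^bsub>R\<^esub> y) \<otimes>\<^bsub>R\<^esub> (a \<otimes>\<^bsub>R\<^esub> b)"
          using xy a b by (simp add: m_assoc m_lcomm)
        then show ?case using xy ab by (simp add: P.I_l_closed)
      next
        case (sum s1 s2)
        then show ?case by (simp add: P.a_closed)
      qed
      then have "PIdl\<^bsub>R\<^esub> a \<subseteq> P \<or> PIdl\<^bsub>R\<^esub> b \<subseteq> P"
        using P cgenideal_ideal[OF a] cgenideal_ideal[OF b] unfolding Spec_def by blast
      then show "a \<in> P \<or> b \<in> P"
        using cgenideal_self[OF a] cgenideal_self[OF b] by blast
    qed
  qed
  moreover have "P \<in> Spec R" if P: "primeideal P R" for P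
  proof -
    interpret P: primeideal P R by (rule P)
    have "I \<subseteq> P \<or> J \<subseteq> P" if "ideal I R" "ideal J R" "ideal_prod R I J \<subseteq> P" for I J
    proof (rule ccontr)
      assume "\<not> (I \<subseteq> P \<or> J \<subseteq> P)"
      then obtain a b where ab: "a \<in> I" "a \<notin> P" "b \<in> J" "b \<notin> P" by blast
      then have "a \<otimes>\<^bsub>R\<^esub> b \<in> P" using that(3) ideal_prod.prod[of a I b J R] by blast
      moreover have "a \<in> carrier R" "b \<in> carrier R"
        using ab that(1,2) by (auto intro: ideal.Icarr)
      ultimately show False using P.I_prime ab by blast
    qed
    then show ?thesis using P.I_notcarr P.ideal_axioms by (auto simp: Spec_def)
  qed
  ultimately show ?thesis by blast
qed

definition is_disjoint_union :: "'a set \<Rightarrow> 'a set list \<Rightarrow> bool" where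
  "is_disjoint_union S Ys \<longleftrightarrow> S = \<Union>(set Ys) \<and> sorted_wrt disjnt Ys"


section \<open>Skew polynomial rings\<close>

text \<open>An element \<open>\<Sum>\<^sub>i a\<^sub>i x\<^sup>i\<close> of \<open>R[x; \<sigma>]\<close>, with coefficients on the left, is represented by the
  ordinary polynomial with coefficients \<open>a\<^sub>i\<close>; the multiplication is given by
  \<open>(a x\<^sup>i) (b x\<^sup>j) = a \<sigma>\<^sup>i(b) x\<^sup>i\<^sup>+\<^sup>j\<close>.\<close>

definition skew_mult :: "('r \<Rightarrow> 'r) \<Rightarrow> 'r poly \<Rightarrow> 'r poly \<Rightarrow> ('r::comm_ring_1) poly" where
  "skew_mult \<sigma> f g =
     (\<Sum>i\<le>degree f. \<Sum>j\<le>degree g. monom (coeff f i * (\<sigma> ^^ i) (coeff g j)) (i + j))"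

definition skew_poly_ring :: "('r \<Rightarrow> 'r) \<Rightarrow> ('r::comm_ring_1) poly ring" where
  "skew_poly_ring \<sigma> =
     \<lparr>carrier = UNIV, monoid.mult = skew_mult \<sigma>, one = 1, zero = 0, add = (+)\<rparr>"

lemma coeff_skew_mult:
  assumes "\<sigma> 0 = 0"
  shows "coeff (skew_mult \<sigma> f g) k = (\<Sum>i\<le>k. coeff f i * (\<sigma> ^^ i) (coeff g (k - i)))"
proof -
  have s0: "(\<sigma> ^^ i) 0 = 0" for i by (induction i) (simp_all add: assms)
  have inner: "(\<Sum>j\<le>degree g. coeff (monom (coeff f i * (\<sigma> ^^ i) (coeff g j)) (i + j)) k)
      = (if i \<le> k then coeff f i * (\<sigma> ^^ i) (coeff g (k - i)) else 0)" for i
  proof (cases "i \<le> k")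
    case True
    have "(\<Sum>j\<le>degree g. coeff (monom (coeff f i * (\<sigma> ^^ i) (coeff g j)) (i + j)) k)
        = (\<Sum>j\<le>degree g. if j = k - i then coeff f i * (\<sigma> ^^ i) (coeff g (k - i)) else 0)"
      by (rule sum.cong) (use True in \<open>auto simp: coeff_monom\<close>)
    also have "\<dots> = coeff f i * (\<sigma> ^^ i) (coeff g (k - i))"
      by (auto simp: coeff_eq_0 s0 not_le)
    finally show ?thesis using True by simp
  next
    case False
    then show ?thesis by (simp add: coeff_monom)
  qed
  have "coeff (skew_mult \<sigma> f g) k
      = (\<Sum>i\<le>degree f. if i \<le> k then coeff f i * (\<sigma> ^^ i) (coeff g (k - i)) else 0)"
    by (simp only: skew_mult_def coeff_sum inner)
  also have "\<dots> = (\<Sum>i\<in>{..degree f} \<inter> {..k}. coeff f i * (\<sigma> ^^ i) (coeff g (k - i)))"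
    by (subst sum.inter_restrict) simp_all
  also have "\<dots> = (\<Sum>i\<le>k. coeff f i * (\<sigma> ^^ i) (coeff g (k - i)))"
    by (rule sum.mono_neutral_left) (auto, metis coeff_eq_0 mult_zero_left not_le)
  finally show ?thesis .
qed

lemma ring_skew_poly_ring:
  fixes \<sigma> :: "'r::comm_ring_1 \<Rightarrow> 'r"
  assumes add: "\<And>a b. \<sigma> (a + b) = \<sigma> a + \<sigma> b"
    and mult: "\<And>a b. \<sigma> (a * b) = \<sigma> a * \<sigma> b" and one: "\<sigma> 1 = 1"
  shows "ring (skew_poly_ring \<sigma>)"
proof -
  have z: "\<sigma> 0 = 0" using add[of 0 0] by simp
  have pz: "(\<sigma> ^^ i) 0 = 0" and po: "(\<sigma> ^^ i) 1 = 1" for i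
    by (induction i) (simp_all add: z one)
  have pa: "(\<sigma> ^^ i) (a + b) = (\<sigma> ^^ i) a + (\<sigma> ^^ i) b"
    and pm: "(\<sigma> ^^ i) (a * b) = (\<sigma> ^^ i) a * (\<sigma> ^^ i) b" for i a b
    by (induction i) (simp_all add: add mult)
  have ps: "(\<sigma> ^^ i) (sum u S) = (\<Sum>x\<in>S. (\<sigma> ^^ i) (u x))" for i u and S :: "nat set"
    by (induction S rule: infinite_finite_induct) (simp_all add: pz pa)
  have tri: "(\<Sum>l\<le>m. \<Sum>i\<le>l. G i (l - i)) = (\<Sum>i\<le>m. \<Sum>j\<le>m - i. G i j)"
    for m :: nat and G :: "nat \<Rightarrow> nat \<Rightarrow> 'r"
  proof -
    have "{(i, j). i + j \<le> m} = (SIGMA i:{..m}. {..m - i})" by auto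
    then show ?thesis by (simp add: sum.triangle_reindex_eq[symmetric] sum.Sigma)
  qed
  note c = coeff_skew_mult[of \<sigma>, OF z]
  have assoc: "skew_mult \<sigma> (skew_mult \<sigma> f g) k = skew_mult \<sigma> f (skew_mult \<sigma> g k)" for f g k
  proof (rule poly_eqI)
    fix m
    have "coeff (skew_mult \<sigma> (skew_mult \<sigma> f g) k) m =
        (\<Sum>l\<le>m. \<Sum>i\<le>l. coeff f i * (\<sigma> ^^ i) (coeff g (l - i)) * (\<sigma> ^^ (i + (l - i))) (coeff k (m - i - (l - i))))"
      unfolding c sum_distrib_right by (intro sum.cong refl) auto
    also have "\<dots> = (\<Sum>i\<le>m. \<Sum>j\<le>m - i. coeff f i * (\<sigma> ^^ i) (coeff g j) * (\<sigma> ^^ (i + j)) (coeff k (m - i - j)))"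
      by (rule tri[of "\<lambda>i j. coeff f i * (\<sigma> ^^ i) (coeff g j) * (\<sigma> ^^ (i + j)) (coeff k (m - i - j))"])
    also have "\<dots> = coeff (skew_mult \<sigma> f (skew_mult \<sigma> g k)) m"
      unfolding c ps pm sum_distrib_left
      by (intro sum.cong refl) (simp add: funpow_add mult.assoc)
    finally show "coeff (skew_mult \<sigma> (skew_mult \<sigma> f g) k) m = coeff (skew_mult \<sigma> f (skew_mult \<sigma> g k)) m" .
  qed
  have l1: "skew_mult \<sigma> 1 f = f" for f
    by (simp add: skew_mult_def poly_as_sum_of_monoms)
  have r1: "skew_mult \<sigma> f 1 = f" for f
    by (simp add: skew_mult_def po poly_as_sum_of_monoms)
  show ?thesis
  proof (rule ringI)
    show "abelian_group (skew_poly_ring \<sigma>)"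
      by (rule abelian_groupI) (auto simp: skew_poly_ring_def algebra_simps intro: exI[of _ "- _"])
    show "Group.monoid (skew_poly_ring \<sigma>)"
      by (rule monoidI) (auto simp: skew_poly_ring_def assoc l1 r1)
  qed (auto simp: skew_poly_ring_def poly_eq_iff c pa algebra_simps sum.distrib)
qed


section \<open>The algebra generated by h and x with xh = qhx\<close>

text \<open>In \<^typ>\<open>'k poly poly\<close> the inner variable is \<open>h\<close> and the outer one is \<open>x\<close>. The twist is
  \<open>\<sigma>(p(h)) = p(q h)\<close>.\<close>

definition qplane :: "'k::field \<Rightarrow> 'k poly poly ring" where
  "qplane q = skew_poly_ring (\<lambda>p. pcompose p [:0, q:])"

definition scalar :: "'k::field \<Rightarrow> 'k poly poly" where
  "scalar c = [:[:c:]:]"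

definition gen_h :: "'k::field poly poly" where
  "gen_h = [:[:0, 1:]:]"

definition gen_x :: "'k::field poly poly" where
  "gen_x = [:0, 1:]"

lemma ring_qplane: "ring (qplane q)"
  unfolding qplane_def by (rule ring_skew_poly_ring) (simp_all add: pcompose_add pcompose_mult one_pCons pcompose_pCons)

lemma qplane_relation:
  "gen_x \<otimes>\<^bsub>qplane q\<^esub> gen_h = scalar q \<otimes>\<^bsub>qplane q\<^esub> (gen_h \<otimes>\<^bsub>qplane q\<^esub> gen_x)"
  by (simp add: qplane_def skew_poly_ring_def skew_mult_def gen_x_def gen_h_def scalar_def
      pcompose_pCons monom_altdef)

text \<open>The \<open>K\<close>-subalgebra generated by a set, as a ring.\<close>

definition subalg :: "'k::field \<Rightarrow> 'k poly poly set \<Rightarrow> 'k poly poly ring" where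
  "subalg q S = (qplane q)\<lparr>carrier := generate_ring (qplane q) (range scalar \<union> S)\<rparr>"

definition Z_ring :: "'k::field \<Rightarrow> 'k poly poly ring" where
  "Z_ring q = (qplane q)\<lparr>carrier := centre (qplane q)\<rparr>"

definition elt_s :: "'k::field \<Rightarrow> nat \<Rightarrow> 'k poly poly" where
  "elt_s q n = gen_h [^]\<^bsub>qplane q\<^esub> n"

definition elt_t :: "'k::field \<Rightarrow> nat \<Rightarrow> 'k poly poly" where
  "elt_t q n = gen_x [^]\<^bsub>qplane q\<^esub> n"

text \<open>The evaluation \<open>S \<mapsto> s\<close>, \<open>T \<mapsto> t\<close> on the commutative polynomial algebra \<open>K[S][T]\<close>.\<close>

definition eval_st :: "'k::field \<Rightarrow> nat \<Rightarrow> 'k poly poly \<Rightarrow> 'k poly poly" where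
  "eval_st q n f = (\<Sum>i\<le>degree f. \<Sum>j\<le>degree (coeff f i).
     scalar (coeff (coeff f i) j) \<otimes>\<^bsub>qplane q\<^esub>
       (elt_s q n [^]\<^bsub>qplane q\<^esub> j \<otimes>\<^bsub>qplane q\<^esub> elt_t q n [^]\<^bsub>qplane q\<^esub> i))"

definition ideal_x :: "'k::field \<Rightarrow> 'k poly poly set" where
  "ideal_x q = Idl\<^bsub>qplane q\<^esub> {gen_x}"

definition ideal_h :: "'k::field \<Rightarrow> 'k poly poly set" where
  "ideal_h q = Idl\<^bsub>qplane q\<^esub> {gen_h}"

definition ideal_xh :: "'k::field \<Rightarrow> 'k poly poly set" where
  "ideal_xh q = Idl\<^bsub>qplane q\<^esub> {gen_x, gen_h}"

definition set_X :: "'k::field \<Rightarrow> 'k poly poly set set" where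
  "set_X q = {Idl\<^bsub>qplane q\<^esub> ({gen_x} \<union> \<qq>) | \<qq>.
     \<qq> \<in> Spec (subalg q {gen_h}) - {{0}, Idl\<^bsub>subalg q {gen_h}\<^esub> {gen_h}}}"

definition set_H :: "'k::field \<Rightarrow> 'k poly poly set set" where
  "set_H q = {Idl\<^bsub>qplane q\<^esub> ({gen_h} \<union> \<qq>) | \<qq>.
     \<qq> \<in> Spec (subalg q {gen_x}) - {{0}, Idl\<^bsub>subalg q {gen_x}\<^esub> {gen_x}}}"

text \<open>Below, \<^const>\<open>ideal_prod\<close> applied to the carrier yields the extended ideals \<open>A m\<close> and \<open>A n\<close>,
  that is, finite sums of products \<open>a z\<close> with \<open>a\<close> in the algebra and \<open>z\<close> in the central ideal.\<close>

definition set_M :: "'k::field \<Rightarrow> nat \<Rightarrow> 'k poly poly set set" where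
  "set_M q n = {ideal_prod (qplane q) (carrier (qplane q)) \<mm> | \<mm>.
     \<mm> \<in> Max_Spec (Z_ring q) \<and> elt_s q n \<notin> \<mm> \<and> elt_t q n \<notin> \<mm>}"

definition set_N :: "'k::field \<Rightarrow> nat \<Rightarrow> 'k poly poly set set" where
  "set_N q n = {ideal_prod (qplane q) (carrier (qplane q)) \<nn> | \<nn>.
     \<nn> \<in> Spec (Z_ring q) \<and> ht (Z_ring q) \<nn> = 1 \<and>
     \<nn> \<noteq> Idl\<^bsub>Z_ring q\<^esub> {elt_t q n} \<and> \<nn> \<noteq> Idl\<^bsub>Z_ring q\<^esub> {elt_s q n}}"

end

theory Submission
  imports Defs
begin

text \<open>Write \<open>A\<close> for the algebra and \<open>Z = K[s, t]\<close> for its centre; \<open>A\<close> is free over \<open>Z\<close> with basis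
  \<open>h\<^sup>j x\<^sup>i\<close>, \<open>0 \<le> i, j < n\<close>. Conjugation by \<open>h\<close> and by \<open>x\<close> has these basis elements as eigenvectors with
  distinct pairs of eigenvalues. Hence an ideal \<open>I\<close> modulo which \<open>s\<close> and \<open>t\<close> are regular contains the
  components of each of its elements and is extended from \<open>I \<inter> Z\<close>. For a prime ideal containing
  neither \<open>h\<close> nor \<open>x\<close> this is the case because \<open>h\<close> and \<open>x\<close> are normal, so such primes correspond to the
  primes of \<open>Z\<close> avoiding \<open>s\<close> and \<open>t\<close>; applied to the saturation of a nonzero ideal it shows that the
  ideal meets the centre. The primes containing \<open>x\<close> or \<open>h\<close> come from \<open>A/(x) = K[h]\<close> and
  \<open>A/(h) = K[x]\<close>. What remains is that a nonzero prime of \<open>K[s, t]\<close> either has height one or is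
  maximal, but not both.\<close>

section \<open>Prime ideals of polynomial rings\<close>

text \<open>The skew algebra and the commutative ring \<open>K[h][x]\<close> share the type
  \<open>'k poly poly\<close>, and their products of monomials differ only by powers of
  \<open>q\<close>. The products agree as soon as one factor is central, so coordinates and
  cancellation are computed in the commutative product. Regularity of s and t compensates for
  \<open>h\<close> and \<open>x\<close> not being invertible: from b in I one only gets
  \<open>h\<close> times the conjugate of b in I, and a further \<open>h^(n-1)\<close> turns this
  \<open>h\<close> into the central s, which may be cancelled. The eigenvalues are then separated by
  a Vandermonde argument with nodes 1, q, ..., q^(n-1). The field is arbitrary, so primes of
  \<open>K[s, t]\<close> cannot be described by points over it. Their heights are controlled by
  contraction to the principal ideal domain \<open>K[s]\<close> and by pseudo-division, which stands
  in for division when leading coefficients are not units. The existence statements of the diagram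
  use the lines t = s + a with a among -1, 0, 1, which are available over every field.\<close>

definition is_ideal :: "'a::comm_ring_1 set \<Rightarrow> bool" where
  "is_ideal J \<longleftrightarrow> 0 \<in> J \<and> (\<forall>a\<in>J. \<forall>b\<in>J. a + b \<in> J) \<and> (\<forall>r. \<forall>a\<in>J. r * a \<in> J)"

definition is_prime_ideal :: "'a::comm_ring_1 set \<Rightarrow> bool" where
  "is_prime_ideal J \<longleftrightarrow> is_ideal J \<and> 1 \<notin> J \<and> (\<forall>a b. a * b \<in> J \<longrightarrow> a \<in> J \<or> b \<in> J)"

definition is_maximal_ideal :: "'a::comm_ring_1 set \<Rightarrow> bool" where
  "is_maximal_ideal J \<longleftrightarrow>
     is_ideal J \<and> 1 \<notin> J \<and> (\<forall>I. is_ideal I \<longrightarrow> J \<subseteq> I \<longrightarrow> 1 \<notin> I \<longrightarrow> I = J)"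

text \<open>In a domain this is height one, phrased without chain lengths; \<open>ht_image\<close>
  compares it with \<open>ht\<close>.\<close>

definition is_height_one :: "'a::comm_ring_1 set \<Rightarrow> bool" where
  "is_height_one J \<longleftrightarrow>
     is_prime_ideal J \<and> J \<noteq> {0} \<and> (\<forall>I. is_prime_ideal I \<longrightarrow> I \<noteq> {0} \<longrightarrow> I \<subseteq> J \<longrightarrow> I = J)"

lemma is_idealD:
  assumes "is_ideal J"
  shows "0 \<in> J" "a \<in> J \<Longrightarrow> b \<in> J \<Longrightarrow> a + b \<in> J" "a \<in> J \<Longrightarrow> r * a \<in> J" "a \<in> J \<Longrightarrow> a * r \<in> J"
    "a \<in> J \<Longrightarrow> - a \<in> J" "a \<in> J \<Longrightarrow> b \<in> J \<Longrightarrow> a - b \<in> J"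
proof -
  show 1: "0 \<in> J" "a \<in> J \<Longrightarrow> b \<in> J \<Longrightarrow> a + b \<in> J" and 2: "a \<in> J \<Longrightarrow> r * a \<in> J" for a b r
    using assms unfolding is_ideal_def by blast+
  show "a \<in> J \<Longrightarrow> a * r \<in> J" using 2[of a r] by (simp add: mult.commute)
  show 3: "a \<in> J \<Longrightarrow> - a \<in> J" for a using 2[of a "-1"] by simp
  show "a \<in> J \<Longrightarrow> b \<in> J \<Longrightarrow> a - b \<in> J" using 1(2)[of a "-b"] 3 by simp
qed

lemma is_ideal_sum:
  assumes "is_ideal J" "\<And>i. i \<in> A \<Longrightarrow> f i \<in> J"
  shows "sum f A \<in> J"
  using assms(2) by (induction A rule: infinite_finite_induct) (auto intro: is_idealD[OF assms(1)])

lemma is_prime_idealD: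
  assumes "is_prime_ideal J"
  shows "is_ideal J" "1 \<notin> J" "a * b \<in> J \<Longrightarrow> a \<in> J \<or> b \<in> J"
  using assms by (auto simp: is_prime_ideal_def)

lemma is_prime_ideal_power:
  assumes "is_prime_ideal J" "a ^ k \<in> J"
  shows "a \<in> J"
  using assms(2) by (induction k) (use is_prime_idealD[OF assms(1)] in auto)

lemma is_prime_ideal_zero: "is_prime_ideal {0 :: 'a::idom}"
  by (auto simp: is_prime_ideal_def is_ideal_def)

lemma is_ideal_principal: "is_ideal {r. g dvd r}"
  by (auto simp: is_ideal_def)

lemma is_prime_ideal_principal:
  assumes "prime_elem g"
  shows "is_prime_ideal {r. g dvd r}"
  using assms by (auto simp: is_prime_ideal_def is_ideal_principal prime_elem_def)

lemma is_ideal_extend: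
  assumes "is_ideal J"
  shows "is_ideal {y + r * a | y r. y \<in> J}"
  unfolding is_ideal_def
proof (intro conjI ballI allI)
  show "0 \<in> {y + r * a | y r. y \<in> J}"
    using is_idealD(1)[OF assms] by (intro CollectI exI[of _ 0]) simp
next
  fix u v assume "u \<in> {y + r * a | y r. y \<in> J}" "v \<in> {y + r * a | y r. y \<in> J}"
  then obtain y r z w where "u = y + r * a" "v = z + w * a" "y \<in> J" "z \<in> J" by blast
  then show "u + v \<in> {y + r * a | y r. y \<in> J}"
    by (intro CollectI exI[of _ "y + z"] exI[of _ "r + w"])
      (simp add: is_idealD[OF assms] algebra_simps)
next
  fix s u assume "u \<in> {y + r * a | y r. y \<in> J}"
  then obtain y r where "u = y + r * a" "y \<in> J" by blast
  then show "s * u \<in> {y + r * a | y r. y \<in> J}"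
    by (intro CollectI exI[of _ "s * y"] exI[of _ "s * r"])
      (simp add: is_idealD[OF assms] algebra_simps)
qed

text \<open>The ideal \<open>m + (a)\<close> exceeds \<open>m\<close>, so it contains 1. Inverses
  modulo \<open>m\<close> take the place of computing in the quotient field.\<close>

lemma is_maximal_ideal_inverse:
  assumes m: "is_maximal_ideal m" and a: "a \<notin> m"
  obtains r where "1 - r * a \<in> m"
proof -
  define J where "J = {y + r * a | y r. y \<in> m}"
  have id: "is_ideal m" using m by (simp add: is_maximal_ideal_def)
  have J: "is_ideal J" unfolding J_def by (rule is_ideal_extend[OF id])
  have sub: "m \<subseteq> J"
  proof
    fix y assume "y \<in> m"
    then show "y \<in> J" unfolding J_def by (intro CollectI exI[of _ y] exI[of _ 0]) simp
  qed
  have "a \<in> J" unfolding J_def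
    by (intro CollectI exI[of _ 0] exI[of _ 1]) (simp add: is_idealD(1)[OF id])
  then have "1 \<in> J" using m J sub a by (auto simp: is_maximal_ideal_def)
  then obtain y r where "1 = y + r * a" "y \<in> m" unfolding J_def by blast
  then have "1 - r * a = y" by (simp add: algebra_simps)
  then show ?thesis using that[of r] \<open>y \<in> m\<close> by simp
qed

lemma is_maximal_imp_prime:
  assumes m: "is_maximal_ideal m"
  shows "is_prime_ideal m"
  unfolding is_prime_ideal_def
proof (intro conjI allI impI)
  show id: "is_ideal m" and "1 \<notin> m" using m by (simp_all add: is_maximal_ideal_def)
  fix a b assume ab: "a * b \<in> m"
  show "a \<in> m \<or> b \<in> m"
  proof (rule disjCI)
    assume "b \<notin> m"
    then obtain r where "1 - r * b \<in> m" using is_maximal_ideal_inverse[OF m] by blast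
    then have "a * (1 - r * b) + r * (a * b) \<in> m"
      using ab is_idealD(2,3)[OF id] by blast
    then show "a \<in> m" by (simp add: algebra_simps)
  qed
qed

text \<open>Division with remainder by a nonzero element of least degree; the zero ideal gets the
  generator 0.\<close>

lemma is_ideal_field_poly:
  fixes J :: "'k::field poly set"
  assumes J: "is_ideal J"
  obtains g where "J = {r. g dvd r}"
proof (cases "J = {0}")
  case True
  then show ?thesis using that[of 0] by auto
next
  case False
  note D = is_idealD[OF J]
  obtain g0 where "g0 \<in> J \<and> g0 \<noteq> 0" using False D(1) by blast
  then obtain g where g: "g \<in> J" "g \<noteq> 0" and min: "\<And>r. r \<in> J \<Longrightarrow> r \<noteq> 0 \<Longrightarrow> degree g \<le> degree r"
    using ex_has_least_nat[of "\<lambda>g. g \<in> J \<and> g \<noteq> 0" g0 degree] by blast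
  have "g dvd r" if r: "r \<in> J" for r
  proof (rule ccontr)
    assume nd: "\<not> g dvd r"
    have "r mod g \<in> J"
      unfolding minus_div_mult_eq_mod[symmetric] using r g by (intro D)
    moreover have "r mod g \<noteq> 0" using nd by (simp add: dvd_eq_mod_eq_0)
    ultimately show False using min degree_mod_less_degree[OF g(2) nd] by fastforce
  qed
  then have "J = {r. g dvd r}" using D(4) g(1) by (auto elim: dvdE)
  then show ?thesis by (rule that)
qed

text \<open>If \<open>f\<close> generates \<open>Q\<close> and \<open>f = g * u\<close>, primality
  makes one factor a multiple of \<open>f\<close>, and then the other factor is a unit.\<close>

lemma is_prime_ideal_field_poly:
  fixes Q :: "'k::field poly set"
  assumes Q: "is_prime_ideal Q" and nz: "Q \<noteq> {0}"
  shows "is_maximal_ideal Q"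
  unfolding is_maximal_ideal_def
proof (intro conjI allI impI)
  note P = is_prime_idealD[OF Q]
  show "is_ideal Q" "1 \<notin> Q" using P by auto
  fix J assume J: "is_ideal J" "Q \<subseteq> J" "1 \<notin> J"
  obtain f where f: "Q = {r. f dvd r}" using is_ideal_field_poly[OF P(1)] .
  obtain g where g: "J = {r. g dvd r}" using is_ideal_field_poly[OF J(1)] .
  have f0: "f \<noteq> 0" using f nz by auto
  have "f \<in> J" using J(2) f by auto
  then obtain u where u: "f = g * u" using g by (auto elim: dvdE)
  then have "f dvd g \<or> f dvd u" using P(3)[of g u] f by auto
  then show "J = Q"
  proof
    assume "f dvd g"
    then show ?thesis using J(2) f g by (auto intro: dvd_trans)
  next
    assume "f dvd u"
    then obtain w where "u = f * w" by (elim dvdE)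
    then have "f * (g * w) = f * 1" using u by (simp add: algebra_simps)
    then have "g * w = 1" using f0 by (simp only: mult_cancel_left) simp
    then have "g dvd 1" by (metis dvd_triv_left)
    then show ?thesis using J(3) g by simp
  qed
qed

section \<open>Contraction to and extension from the coefficient ring\<close>

definition contraction :: "'a::comm_ring_1 poly set \<Rightarrow> 'a set" where
  "contraction J = {c. [:c:] \<in> J}"

text \<open>For an ideal \<open>c\<close> this is the kernel of reducing coefficients modulo
  \<open>c\<close>; the coefficientwise form suits degree arguments.\<close>

definition extension :: "'a::comm_ring_1 set \<Rightarrow> 'a poly set" where
  "extension c = {f. \<forall>i. coeff f i \<in> c}"

lemma is_ideal_contraction: "is_ideal J \<Longrightarrow> is_ideal (contraction J)"
proof -
  assume J: "is_ideal J"
  have "[:a + b:] \<in> J" if "[:a:] \<in> J" "[:b:] \<in> J" for a b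
    using is_idealD(2)[OF J that] by simp
  moreover have "[:r * a:] \<in> J" if "[:a:] \<in> J" for r a
    using is_idealD(3)[OF J that, of "[:r:]"] by (simp add: mult.commute)
  ultimately show ?thesis
    using is_idealD(1)[OF J] by (auto simp: is_ideal_def contraction_def)
qed

lemma is_prime_ideal_contraction: "is_prime_ideal J \<Longrightarrow> is_prime_ideal (contraction J)"
proof -
  assume J: "is_prime_ideal J"
  have "a \<in> contraction J \<or> b \<in> contraction J" if "a * b \<in> contraction J" for a b
    using is_prime_idealD(3)[OF J, of "[:a:]" "[:b:]"] that by (simp add: contraction_def mult.commute)
  then show ?thesis
    using is_prime_idealD(1,2)[OF J] is_ideal_contraction
    by (auto simp: is_prime_ideal_def) (simp add: contraction_def one_pCons)
qed

lemma extension_subset: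
  assumes J: "is_ideal J" and "c \<subseteq> contraction J"
  shows "extension c \<subseteq> J"
proof
  fix f assume "f \<in> extension c"
  then have "[:coeff f i:] \<in> J" for i using assms(2) by (auto simp: extension_def contraction_def)
  then have "[:coeff f i:] * monom 1 i \<in> J" for i by (rule is_idealD(4)[OF J])
  then have "(\<Sum>i\<le>degree f. monom (coeff f i) i) \<in> J"
    by (intro is_ideal_sum[OF J]) (simp add: smult_monom)
  then show "f \<in> J" by (simp add: poly_as_sum_of_monoms)
qed

lemma is_ideal_extension:
  assumes c: "is_ideal c"
  shows "is_ideal (extension c)"
proof -
  have "sum f A \<in> c" if "\<And>i. i \<in> A \<Longrightarrow> f i \<in> c" for f and A :: "nat set"
    using is_ideal_sum[OF c] that .
  then show ?thesis
    unfolding is_ideal_def[of "extension c"]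
    by (simp add: extension_def coeff_mult is_idealD[OF c])
qed

text \<open>Elements of minimal degree outside \<open>extension c\<close> have their leading coefficient outside \<open>c\<close>, so
  pseudo-division by them works modulo \<open>c\<close> as over a field.\<close>

lemma same_contraction:
  fixes P J :: "'a::idom poly set"
  assumes P: "is_prime_ideal P" and J: "is_ideal J" and PJ: "P \<subseteq> J"
    and cP: "contraction P = c" and cJ: "contraction J = c" and ne: "\<not> P \<subseteq> extension c"
  shows "J = P"
proof -
  have c: "is_prime_ideal c" using is_prime_ideal_contraction[OF P] cP by simp
  note Pr = is_prime_idealD[OF P] and Cr = is_prime_idealD[OF c]
  note PD = is_idealD[OF Pr(1)] and CD = is_idealD[OF Cr(1)] and JD = is_idealD[OF J]
  have eP: "extension c \<subseteq> P" using extension_subset[OF Pr(1)] cP by simp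
  have ex: "\<exists>f. f \<in> S \<and> f \<notin> extension c \<and> coeff f (degree f) \<notin> c \<and>
      (\<forall>r. r \<in> S \<longrightarrow> r \<notin> extension c \<longrightarrow> degree f \<le> degree r)"
    if S: "is_ideal S" "P \<subseteq> S" for S
  proof -
    obtain f0 where "f0 \<in> S \<and> f0 \<notin> extension c" using ne S by blast
    then obtain f where f: "f \<in> S" "f \<notin> extension c"
      and min: "\<And>r. r \<in> S \<Longrightarrow> r \<notin> extension c \<Longrightarrow> degree f \<le> degree r"
      using ex_has_least_nat[of "\<lambda>f. f \<in> S \<and> f \<notin> extension c" f0 degree] by blast
    have "coeff f (degree f) \<notin> c"
    proof
      \<comment> \<open>Removing the leading term would leave an element of \<open>S\<close> outside
        \<open>extension c\<close> of smaller degree.\<close>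
      assume lc: "coeff f (degree f) \<in> c"
      define m where "m = monom (coeff f (degree f)) (degree f)"
      have m: "m \<in> extension c" using lc CD(1) by (auto simp: m_def extension_def)
      then have "f - m \<in> S" using f S eP by (intro is_idealD[OF S(1)]) auto
      moreover have "f - m \<notin> extension c"
      proof
        assume "f - m \<in> extension c"
        then have "(f - m) + m \<in> extension c"
          using m is_ideal_extension[OF Cr(1)] is_idealD(2) by blast
        then show False using f by simp
      qed
      moreover have "f - m \<noteq> 0" using f m by auto
      moreover have "coeff (f - m) (degree f) = 0" by (simp add: m_def)
      moreover have "degree (f - m) \<le> degree f"
        by (rule degree_diff_le) (auto simp: m_def degree_monom_le)
      ultimately have "degree (f - m) < degree f"
        by (metis leading_coeff_0_iff le_neq_implies_less)
      then show False using min[OF \<open>f - m \<in> S\<close> \<open>f - m \<notin> extension c\<close>] by simp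
    qed
    then show ?thesis using f min by blast
  qed
  obtain f where f: "f \<in> P" "f \<notin> extension c" "coeff f (degree f) \<notin> c"
    and fmin: "\<And>r. r \<in> P \<Longrightarrow> r \<notin> extension c \<Longrightarrow> degree f \<le> degree r"
    using ex[OF Pr(1)] by blast
  obtain g where g: "g \<in> J" "g \<notin> extension c" "coeff g (degree g) \<notin> c"
    and gmin: "\<And>r. r \<in> J \<Longrightarrow> r \<notin> extension c \<Longrightarrow> degree g \<le> degree r"
    using ex[OF J PJ] by blast
  define b where "b = coeff g (degree g)"
  have g0: "g \<noteq> 0" using g CD(1) by auto
  \<comment> \<open>The pseudo-remainder lies in \<open>J\<close> and has smaller degree than
    \<open>g\<close>, so by minimality it is in \<open>extension c\<close>, hence already in
    \<open>P\<close>.\<close>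
  have div: "\<exists>k u r. smult (b ^ k) y = g * u + r \<and> r \<in> P \<and> (r = 0 \<or> degree r < degree g)"
    if y: "y \<in> J" for y
  proof -
    obtain u r where ur: "pseudo_divmod y g = (u, r)" by fastforce
    note pd = pseudo_divmod[OF g0 ur]
    obtain k where k: "smult (b ^ k) y = g * u + r" using pd(1) b_def by blast
    then have "r = [:b ^ k:] * y - g * u" by simp
    then have rJ: "r \<in> J" using y g by (metis JD(3,4,6))
    have "r \<in> P"
    proof (cases "r = 0")
      case False
      then show ?thesis using pd(2) gmin[OF rJ] eP by force
    qed (simp add: PD)
    then show ?thesis using k pd(2) by blast
  qed
  have bk: "b ^ k \<notin> c" for k using is_prime_ideal_power[OF c] g(3) b_def by blast
  obtain k u r where k: "smult (b ^ k) f = g * u + r" "r \<in> P" "r = 0 \<or> degree r < degree g"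
    using div PJ f by blast
  have "g * u = [:b ^ k:] * f - r" using k by simp
  then have "g * u \<in> P" using f k by (metis PD(3,6))
  \<comment> \<open>If \<open>g\<close> is in \<open>P\<close>, then each element of
    \<open>J\<close> times some power of \<open>b\<close> is in \<open>P\<close>, and powers of
    \<open>b\<close> are outside \<open>P\<close>. If \<open>u\<close> is in \<open>P\<close>,
    comparing degrees forces \<open>g\<close> to be a constant outside \<open>c\<close>, although
    \<open>contraction J = c\<close>.\<close>
  then consider "g \<in> P" | "u \<in> P" using Pr(3) by blast
  then show ?thesis
  proof cases
    case 1
    have "y \<in> P" if y: "y \<in> J" for y
    proof -
      obtain k u r where k: "smult (b ^ k) y = g * u + r" "r \<in> P" using div y by blast
      then have "[:b ^ k:] * y = g * u + r" by simp
      then have "[:b ^ k:] * y \<in> P" using 1 k(2) by (metis PD(2,4))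
      moreover have "[:b ^ k:] \<notin> P" using bk[of k] cP by (auto simp: contraction_def)
      ultimately show ?thesis using Pr(3) by blast
    qed
    then show ?thesis using PJ by blast
  next
    case 2
    have lf: "b ^ k * coeff f (degree f) \<notin> c" using Cr(3) bk f by blast
    have dg: "degree g \<le> degree f" using gmin f PJ by blast
    then have df: "coeff r (degree f) = 0" using k(3) coeff_eq_0 by fastforce
    have cu: "coeff (g * u) (degree f) \<notin> c"
    proof -
      have "coeff (smult (b ^ k) f) (degree f) = coeff (g * u) (degree f)"
        unfolding k(1) using df by simp
      then show ?thesis using lf by simp
    qed
    have "u \<notin> extension c"
    proof
      assume "u \<in> extension c"
      then have "g * u \<in> extension c" using is_ideal_extension[OF Cr(1)] is_idealD(3) by blast
      then show False using cu by (simp add: extension_def)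
    qed
    then have du: "degree f \<le> degree u" using fmin 2 by blast
    have u0: "u \<noteq> 0" using cu CD(1) by auto
    have "g * u = smult (b ^ k) f - r" using k(1) by simp
    also have "degree \<dots> \<le> degree f"
      by (intro degree_diff_le) (use k(3) dg degree_smult_le in auto)
    finally have "degree g = 0" using degree_mult_eq[OF g0 u0] du by simp
    then obtain a where "g = [:a:]" by (metis degree_eq_zeroE)
    then have False using g cJ by (auto simp: contraction_def)
    then show ?thesis ..
  qed
qed

text \<open>Otherwise the quotient by \<open>m\<close> would be a field containing
  \<open>K[S]\<close> and integral over \<open>K[S]\<close> with a leading coefficient
  \<open>a\<close> inverted. That localisation would then be a field itself, but
  \<open>1 + S * a\<close> is not invertible in it. The proof carries this out with
  polynomials.\<close>

lemma contraction_maximal_nonzero: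
  fixes m :: "'k::field poly poly set"
  assumes m: "is_maximal_ideal m"
  shows "contraction m \<noteq> {0}"
proof
  assume c0: "contraction m = {0}"
  have pm: "is_prime_ideal m" using is_maximal_imp_prime[OF m] .
  have id: "is_ideal m" using pm by (rule is_prime_idealD)
  note D = is_idealD[OF id]
  have "m \<noteq> {0}"
  proof
    assume "m = {0}"
    moreover have "[:0, 1:] \<notin> {0 :: 'k poly poly}" by simp
    ultimately obtain r where "1 - r * [:0, 1:] = (0 :: 'k poly poly)"
      using is_maximal_ideal_inverse[OF m, of "[:0, 1:]"] by auto
    then have "coeff (1 - r * [:0, 1:]) 0 = 0" by simp
    then show False by simp
  qed
  then obtain f0 where "f0 \<in> m \<and> f0 \<noteq> 0" using D(1) by blast
  then obtain f where f: "f \<in> m" "f \<noteq> 0"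
    and min: "\<And>r. r \<in> m \<Longrightarrow> r \<noteq> 0 \<Longrightarrow> degree f \<le> degree r"
    using ex_has_least_nat[of "\<lambda>f. f \<in> m \<and> f \<noteq> 0" f0 degree] by blast
  have df: "degree f > 0"
  proof (rule ccontr)
    assume "\<not> degree f > 0"
    then obtain a where "f = [:a:]" by (metis degree_eq_zeroE gr0I)
    then show False using f c0 by (auto simp: contraction_def)
  qed
  define a where "a = coeff f (degree f)"
  have a0: "a \<noteq> 0" using f a_def by simp
  \<comment> \<open>Coprime to \<open>a\<close> by construction; the factor \<open>[:0, 1:]\<close>
    keeps the degree positive even when \<open>a\<close> is constant, also over finite
    fields.\<close>
  define g where "g = 1 + [:0, 1:] * a"
  have dg: "degree g > 0"
  proof -
    have "degree ([:0, 1:] * a) = Suc (degree a)" using a0 by (subst degree_mult_eq) auto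
    then show ?thesis unfolding g_def by (subst degree_add_eq_right) auto
  qed
  have cop: "g dvd b" if "g dvd a * b" for b
  proof -
    have "g dvd g * b - [:0, 1:] * (a * b)" using that by (metis dvd_diff dvd_mult dvd_triv_left)
    also have "g * b - [:0, 1:] * (a * b) = b" by (simp add: g_def algebra_simps)
    finally show ?thesis .
  qed
  have "g \<noteq> 0" using dg by auto
  then have "[:g:] \<notin> m" using c0 by (auto simp: contraction_def)
  then obtain u where u: "1 - u * [:g:] \<in> m" using is_maximal_ideal_inverse[OF m] by blast
  obtain v r where vr: "pseudo_divmod (1 - u * [:g:]) f = (v, r)" by fastforce
  note pd = pseudo_divmod[OF f(2) vr]
  obtain k where k: "smult (a ^ k) (1 - u * [:g:]) = f * v + r" using pd(1) a_def by blast
  have "r = [:a ^ k:] * (1 - u * [:g:]) - f * v" using k by simp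
  then have "r \<in> m" using u f by (metis D(3,4,6))
  then have "r = 0" using pd(2) min by force
  then have "f * v - [:a ^ k:] = [:g:] * (- smult (a ^ k) u)"
    using k by (simp add: smult_diff_right algebra_simps)
  then have "[:g:] dvd f * v - [:a ^ k:]" by (metis dvd_triv_left)
  \<comment> \<open>Modulo \<open>g\<close> the leading coefficient \<open>a\<close> of
    \<open>f\<close> is cancellable and \<open>f\<close> has positive degree, so
    \<open>f * w\<close> can agree with a constant only if \<open>w\<close> vanishes modulo
    \<open>g\<close>. By the choice of \<open>w\<close> its top term, which turns out to be
    divisible by \<open>g\<close>, cannot be stripped off.\<close>
  then obtain w where w: "[:g:] dvd f * w - [:a ^ k:]"
    and wmin: "\<And>y. [:g:] dvd f * y - [:a ^ k:] \<Longrightarrow> degree w \<le> degree y"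
    using ex_has_least_nat[of "\<lambda>v. [:g:] dvd f * v - [:a ^ k:]" v degree] by blast
  have wl: "w = 0 \<or> degree w = 0 \<and> g dvd coeff w 0"
  proof -
    define l where "l = coeff w (degree w)"
    have "g dvd coeff (f * w - [:a ^ k:]) (degree f + degree w)"
      using w by (simp add: const_poly_dvd_iff)
    also have "coeff (f * w - [:a ^ k:]) (degree f + degree w) = a * l"
      using df by (simp add: coeff_mult_degree_sum a_def l_def coeff_pCons split: nat.split)
    finally have gl: "g dvd l" by (rule cop)
    have "[:g:] dvd monom l (degree w)" using gl by (auto simp: const_poly_dvd_iff)
    then have "[:g:] dvd (f * w - [:a ^ k:]) - f * monom l (degree w)"
      using w by (metis dvd_diff dvd_mult)
    also have "\<dots> = f * (w - monom l (degree w)) - [:a ^ k:]" by (simp add: algebra_simps)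
    finally have le: "degree w \<le> degree (w - monom l (degree w))" by (rule wmin)
    have "degree w = 0"
    proof (rule ccontr)
      assume w0: "degree w \<noteq> 0"
      have "degree (w - monom l (degree w)) \<le> degree w"
        by (rule degree_diff_le) (auto simp: degree_monom_le)
      then have "degree (w - monom l (degree w)) = degree w" using le by simp
      moreover have "coeff (w - monom l (degree w)) (degree w) = 0" by (simp add: l_def)
      ultimately have "w - monom l (degree w) = 0" by (metis leading_coeff_0_iff)
      then show False using le w0 by simp
    qed
    then show ?thesis using gl l_def by simp
  qed
  have "g dvd coeff (f * w - [:a ^ k:]) 0" using w by (simp only: const_poly_dvd_iff)
  then have "g dvd coeff f 0 * coeff w 0 - a ^ k" by (simp add: coeff_mult)
  moreover have "g dvd coeff f 0 * coeff w 0" using wl by auto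
  ultimately have "g dvd a ^ k" using dvd_diff_right_iff by blast
  then have "g dvd 1" by (induction k) (auto dest: cop)
  then show False using dg by (metis degree_1 dvd_imp_degree_le one_neq_zero leD)
qed

section \<open>Height-one primes and maximal ideals in two variables\<close>

lemma prime_elem_field_poly:
  fixes g :: "'k::field poly"
  assumes "is_prime_ideal {r. g dvd r}" "g \<noteq> 0"
  shows "prime_elem g"
  using is_prime_idealD[OF assms(1)] assms(2) by (auto simp: prime_elem_def)

text \<open>Inside a prime \<open>p\<close> that meets \<open>K[S]\<close> nontrivially sits the
  principal prime generated by its contraction; primality of \<open>[:g:]\<close> is Gauss's lemma.
  This is the prime with which \<open>p\<close> is compared in the height arguments.\<close>

lemma contraction_principal:
  fixes p :: "'k::field poly poly set"
  assumes p: "is_prime_ideal p" and nz: "contraction p \<noteq> {0}"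
  obtains g where "prime_elem g" "contraction p = {r. g dvd r}"
    "is_prime_ideal (extension (contraction p))" "extension (contraction p) \<noteq> {0}"
    "extension (contraction p) \<subseteq> p"
    "extension (contraction p) = {r. [:g:] dvd r}"
proof -
  have c: "is_prime_ideal (contraction p)" by (rule is_prime_ideal_contraction[OF p])
  obtain g where g: "contraction p = {r. g dvd r}"
    using is_ideal_field_poly[OF is_prime_idealD(1)[OF c]] .
  have g0: "g \<noteq> 0" using g nz by auto
  have pg: "prime_elem g" using prime_elem_field_poly c g g0 by metis
  have e: "extension (contraction p) = {r. [:g:] dvd r}"
    by (auto simp: g extension_def const_poly_dvd_iff)
  show ?thesis
  proof (rule that[OF pg g])
    have "prime_elem [:g:]" using pg by (simp add: prime_elem_const_poly_iff)
    then show "is_prime_ideal (extension (contraction p))"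
      unfolding e by (rule is_prime_ideal_principal)
    have "[:g:] \<in> extension (contraction p)" unfolding e by simp
    then show "extension (contraction p) \<noteq> {0}" using g0 by auto
    show "extension (contraction p) \<subseteq> p"
      by (rule extension_subset[OF is_prime_idealD(1)[OF p] order_refl])
  qed (rule e)
qed

text \<open>A nonzero prime ideal strictly inside \<open>(g)\<close> would be stable under division by \<open>g\<close>.\<close>

lemma is_height_one_principal:
  fixes g :: "'a::idom"
  assumes g: "prime_elem g" and fin: "\<And>r. r \<noteq> 0 \<Longrightarrow> \<exists>k. \<not> g ^ k dvd r"
  shows "is_height_one {r. g dvd r}"
  unfolding is_height_one_def
proof (intro conjI allI impI)
  show "is_prime_ideal {r. g dvd r}" by (rule is_prime_ideal_principal[OF g])
  have "g \<in> {r. g dvd r}" "g \<noteq> 0" using g by auto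
  then show "{r. g dvd r} \<noteq> {0}" by blast
  fix I assume I: "is_prime_ideal I" "I \<noteq> {0}" "I \<subseteq> {r. g dvd r}"
  note id = is_prime_idealD(1)[OF I(1)]
  show "I = {r. g dvd r}"
  proof (rule ccontr)
    assume ne: "I \<noteq> {r. g dvd r}"
    have gI: "g \<notin> I"
    proof
      assume "g \<in> I"
      then have "{r. g dvd r} \<subseteq> I" using is_idealD(4)[OF id] by (auto elim: dvdE)
      then show False using ne I(3) by blast
    qed
    obtain r where r: "r \<in> I" "r \<noteq> 0" using I(2) is_idealD(1)[OF id] by blast
    have "\<exists>u\<in>I. r = g ^ k * u" for k
    proof (induction k)
      case 0
      then show ?case using r by auto
    next
      case (Suc k)
      then obtain u where u: "u \<in> I" "r = g ^ k * u" by blast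
      then obtain v where "u = g * v" using I(3) by (auto elim: dvdE)
      then show ?case using u gI is_prime_idealD(3)[OF I(1), of g v] by (auto simp: mult_ac)
    qed
    then show False using fin[OF r(2)] by (metis dvd_triv_left)
  qed
qed

text \<open>If \<open>[:g:] ^ k\<close> divides \<open>r\<close>, then \<open>g ^ k\<close> divides
  the leading coefficient of \<open>r\<close>, whose degree bounds \<open>k\<close> because
  \<open>g\<close> has positive degree.\<close>

lemma is_height_one_const:
  fixes g :: "'k::field poly"
  assumes g: "prime_elem g"
  shows "is_height_one {r. [:g:] dvd r}"
proof (rule is_height_one_principal)
  show "prime_elem [:g:]" using g by (simp add: prime_elem_const_poly_iff)
  fix r :: "'k poly poly" assume r: "r \<noteq> 0"
  have g0: "g \<noteq> 0" "\<not> is_unit g" using g by auto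
  then have dg: "degree g > 0" by (simp add: is_unit_iff_degree)
  define l where "l = coeff r (degree r)"
  have "\<not> [:g:] ^ Suc (degree l) dvd r"
  proof
    assume "[:g:] ^ Suc (degree l) dvd r"
    then have "g ^ Suc (degree l) dvd l"
      unfolding poly_const_pow const_poly_dvd_iff l_def by blast
    moreover have "l \<noteq> 0" using r l_def by simp
    ultimately have "degree (g ^ Suc (degree l)) \<le> degree l" by (rule dvd_imp_degree_le)
    then have "Suc (degree l) * degree g \<le> degree l" by (simp add: degree_power_eq g0 del: power_Suc)
    moreover have "Suc (degree l) * 1 \<le> Suc (degree l) * degree g"
      using dg by (intro mult_le_mono2) simp
    ultimately show False by simp
  qed
  then show "\<exists>k. \<not> [:g:] ^ k dvd r" by blast
qed

text \<open>Divisibility by this monic polynomial is vanishing at \<open>- c\<close>, which gives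
  primality over a domain. Over \<open>K[S]\<close> it yields \<open>(T)\<close> and the lines t = s
  + a.\<close>

lemma is_height_one_linear:
  fixes c :: "'a::idom"
  shows "is_height_one {r. [:c, 1:] dvd r}"
proof (rule is_height_one_principal)
  show "prime_elem [:c, 1:]"
    by (auto simp: prime_elem_def poly_eq_0_iff_dvd[of _ "- c", simplified, symmetric])
  fix r :: "'a poly" assume r: "r \<noteq> 0"
  have "\<not> [:c, 1:] ^ Suc (degree r) dvd r"
  proof
    assume "[:c, 1:] ^ Suc (degree r) dvd r"
    then have "degree ([:c, 1:] ^ Suc (degree r)) \<le> degree r" using r by (rule dvd_imp_degree_le)
    then show False by (simp add: degree_linear_power del: power_Suc)
  qed
  then show "\<exists>k. \<not> [:c, 1:] ^ k dvd r" by blast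
qed

text \<open>The contraction is nonzero, so height one would make \<open>m\<close> equal to
  \<open>(g)\<close> with \<open>g\<close> in \<open>K[S]\<close>; but \<open>T\<close> is not
  invertible modulo \<open>(g)\<close>, as the constant coefficient of \<open>1 - r * T\<close> is
  1.\<close>

lemma is_maximal_imp_not_height_one:
  fixes m :: "'k::field poly poly set"
  assumes m: "is_maximal_ideal m"
  shows "\<not> is_height_one m"
proof
  assume h: "is_height_one m"
  have p: "is_prime_ideal m" by (rule is_maximal_imp_prime[OF m])
  obtain g where g: "prime_elem g" "is_prime_ideal (extension (contraction m))"
    "extension (contraction m) \<noteq> {0}" "extension (contraction m) \<subseteq> m"
    "extension (contraction m) = {r. [:g:] dvd r}"
    using contraction_principal[OF p contraction_maximal_nonzero[OF m]] by metis
  have "extension (contraction m) = m"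
    using h g(2-4) unfolding is_height_one_def by (elim conjE allE[of _ "extension (contraction m)"]) simp
  then have eq: "m = {r. [:g:] dvd r}" using g(5) by simp
  have "\<not> g dvd coeff [:0, 1:] 1" using g(1) by auto
  then have "\<not> [:g:] dvd [:0, 1:]" unfolding const_poly_dvd_iff by blast
  then have "[:0, 1:] \<notin> m" by (simp add: eq)
  then obtain r where "1 - r * [:0, 1:] \<in> m" using is_maximal_ideal_inverse[OF m] by blast
  then have "g dvd coeff (1 - r * [:0, 1:]) 0" unfolding eq by (simp only: const_poly_dvd_iff mem_Collect_eq)
  then show False using g(1) by auto
qed

text \<open>The contraction is maximal in \<open>K[S]\<close>, so a larger proper ideal has the same
  contraction and \<open>same_contraction\<close> applies.\<close>

lemma is_maximal_ideal_if_contains: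
  fixes p :: "'k::field poly poly set"
  assumes p: "is_prime_ideal p" and nz: "contraction p \<noteq> {0}"
    and ne: "\<not> p \<subseteq> extension (contraction p)"
  shows "is_maximal_ideal p"
  unfolding is_maximal_ideal_def
proof (intro conjI allI impI)
  show "is_ideal p" "1 \<notin> p" using is_prime_idealD[OF p] by auto
  fix J assume J: "is_ideal J" "p \<subseteq> J" "1 \<notin> J"
  have "is_maximal_ideal (contraction p)"
    using is_prime_ideal_field_poly[OF is_prime_ideal_contraction[OF p] nz] .
  moreover have "contraction p \<subseteq> contraction J" using J(2) by (auto simp: contraction_def)
  moreover have "1 \<notin> contraction J" using J(3) by (simp add: contraction_def one_pCons)
  ultimately have "contraction J = contraction p"
    using is_ideal_contraction[OF J(1)] by (simp add: is_maximal_ideal_def)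
  then show "J = p" using same_contraction[OF p J(1,2) refl] ne by simp
qed

text \<open>Krull dimension two enters here. The upper prime meets \<open>K[S]\<close>, since
  otherwise both primes contract to zero and coincide; and it exceeds the extension of its
  contraction, which has height one.\<close>

lemma is_maximal_ideal_if_height_two:
  fixes p P :: "'k::field poly poly set"
  assumes p: "is_prime_ideal p" "p \<noteq> {0}" and P: "is_prime_ideal P" and pP: "p \<subset> P"
  shows "is_maximal_ideal P"
proof -
  have e0: "extension {0 :: 'k poly} = {0}" by (auto simp: extension_def poly_eq_iff)
  have nz: "contraction P \<noteq> {0}"
  proof
    assume c: "contraction P = {0}"
    have "contraction p \<subseteq> contraction P" using pP by (auto simp: contraction_def)
    then have "contraction p = {0}"
      using c is_idealD(1)[OF is_ideal_contraction[OF is_prime_idealD(1)[OF p(1)]]] by auto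
    moreover have "\<not> p \<subseteq> extension {0}"
      using e0 p is_idealD(1)[OF is_prime_idealD(1)[OF p(1)]] by auto
    ultimately have "P = p"
      using same_contraction[OF p(1) is_prime_idealD(1)[OF P] _ _ c] pP by auto
    then show False using pP by simp
  qed
  obtain g where g: "prime_elem g" "extension (contraction P) = {r. [:g:] dvd r}"
    "extension (contraction P) \<subseteq> P"
    using contraction_principal[OF P nz] by metis
  have "\<not> P \<subseteq> extension (contraction P)"
  proof
    assume "P \<subseteq> extension (contraction P)"
    then have "P = {r. [:g:] dvd r}" using g by auto
    then have "is_height_one P" using is_height_one_const[OF g(1)] by simp
    then show False using p pP unfolding is_height_one_def by blast
  qed
  then show ?thesis by (rule is_maximal_ideal_if_contains[OF P nz])
qed

section \<open>Prime and maximal ideals of rings\<close>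

lemma (in ring) ideal_iff:
  "ideal J R \<longleftrightarrow> J \<subseteq> carrier R \<and> \<zero> \<in> J \<and> (\<forall>a\<in>J. \<forall>b\<in>J. a \<oplus> b \<in> J) \<and>
     (\<forall>r\<in>carrier R. \<forall>a\<in>J. r \<otimes> a \<in> J \<and> a \<otimes> r \<in> J)"
  (is "_ \<longleftrightarrow> ?C")
proof
  assume "ideal J R"
  then interpret J: ideal J R .
  show ?C using J.Icarr J.a_closed J.I_l_closed J.I_r_closed J.zero_closed by auto
next
  assume C: ?C
  have "\<ominus> a \<in> J" if "a \<in> J" for a
  proof -
    have "\<ominus> \<one> \<otimes> a \<in> J" using C that by (metis a_inv_closed one_closed)
    moreover have "a \<in> carrier R" using C that by blast
    ultimately show ?thesis by (simp add: l_minus)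
  qed
  then have "subgroup J (add_monoid R)"
    using C by (intro group.subgroupI[OF a_group]) (auto simp: a_inv_def)
  then show "ideal J R" using C by (intro idealI ring_axioms) auto
qed

text \<open>With ideals of this form, primeness can be tested on elements without describing the ideal
  generated by an element.\<close>

lemma (in ring) ideal_transporter:
  assumes P: "ideal P R" and b: "b \<in> carrier R"
  shows "ideal {a \<in> carrier R. \<forall>r\<in>carrier R. a \<otimes> r \<otimes> b \<in> P} R"
proof -
  interpret P: ideal P R by (rule P)
  have l: "(s \<otimes> a) \<otimes> r \<otimes> b = s \<otimes> (a \<otimes> r \<otimes> b)"
    and r: "(a \<otimes> s) \<otimes> r \<otimes> b = a \<otimes> (s \<otimes> r) \<otimes> b"
    if "a \<in> carrier R" "s \<in> carrier R" "r \<in> carrier R" for a s r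
    using that b by (simp_all add: m_assoc)
  show ?thesis
    unfolding ideal_iff using b
    by (auto simp: l_distr P.zero_closed P.a_closed)
      (metis l P.I_l_closed, metis r m_closed)
qed

lemma (in ring) Spec_iff:
  "P \<in> Spec R \<longleftrightarrow> ideal P R \<and> \<one> \<notin> P \<and>
    (\<forall>a\<in>carrier R. \<forall>b\<in>carrier R. (\<forall>r\<in>carrier R. a \<otimes> r \<otimes> b \<in> P) \<longrightarrow> a \<in> P \<or> b \<in> P)"
  (is "_ \<longleftrightarrow> ?C")
proof
  assume S: "P \<in> Spec R"
  then have P: "ideal P R" and ne: "P \<noteq> carrier R"
    and pr: "\<And>I J. ideal I R \<Longrightarrow> ideal J R \<Longrightarrow> ideal_prod R I J \<subseteq> P \<Longrightarrow> I \<subseteq> P \<or> J \<subseteq> P"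
    by (auto simp: Spec_def)
  interpret P: ideal P R by (rule P)
  have "a \<in> P \<or> b \<in> P"
    if a: "a \<in> carrier R" and b: "b \<in> carrier R" and ab: "\<forall>r\<in>carrier R. a \<otimes> r \<otimes> b \<in> P" for a b
  proof -
    define I where "I = {a \<in> carrier R. \<forall>r\<in>carrier R. a \<otimes> r \<otimes> b \<in> P}"
    \<comment> \<open>\<open>I\<close> times \<open>J\<close> lies in \<open>P\<close> by
      construction, so these two annihilators modulo \<open>P\<close> replace the ideals generated
      by \<open>a\<close> and \<open>b\<close>.\<close>
    define J where "J = {c \<in> carrier R. \<forall>i\<in>I. i \<otimes> c \<in> P}"
    have I: "ideal I R" unfolding I_def by (rule ideal_transporter[OF P b])
    interpret I: ideal I R by (rule I)
    have "i \<otimes> (r \<otimes> c) = (i \<otimes> r) \<otimes> c" "i \<otimes> (c \<otimes> r) = (i \<otimes> c) \<otimes> r"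
      if "i \<in> I" "r \<in> carrier R" "c \<in> carrier R" for i r c
      using that I.Icarr by (simp_all add: m_assoc)
    then have J: "ideal J R"
      unfolding ideal_iff J_def using I.Icarr I.I_r_closed
      by (auto simp: r_distr P.zero_closed P.a_closed P.I_r_closed)
    have "c \<in> P" if "c \<in> ideal_prod R I J" for c
      using that by induction (auto simp: J_def P.a_closed)
    then have "I \<subseteq> P \<or> J \<subseteq> P" using pr[OF I J] by blast
    moreover have "a \<in> I" using a ab unfolding I_def by blast
    moreover have "i \<otimes> b \<in> P" if "i \<in> I" for i
    proof -
      have "i \<in> carrier R" "i \<otimes> \<one> \<otimes> b \<in> P" using that unfolding I_def by blast+
      then show ?thesis by simp
    qed
    then have "b \<in> J" using b unfolding J_def by blast
    ultimately show ?thesis by blast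
  qed
  moreover have "\<one> \<notin> P" using ne P.one_imp_carrier by blast
  ultimately show ?C using P by blast
next
  assume C: ?C
  then interpret P: ideal P R by simp
  have "I \<subseteq> P \<or> J \<subseteq> P" if I: "ideal I R" and J: "ideal J R" and IJ: "ideal_prod R I J \<subseteq> P" for I J
  proof (rule ccontr)
    assume "\<not> (I \<subseteq> P \<or> J \<subseteq> P)"
    then obtain a b where ab: "a \<in> I" "a \<notin> P" "b \<in> J" "b \<notin> P" by blast
    then have car: "a \<in> carrier R" "b \<in> carrier R" using I J by (auto intro: ideal.Icarr)
    then obtain r where r: "r \<in> carrier R" "a \<otimes> r \<otimes> b \<notin> P" using C ab by blast
    have "a \<otimes> r \<in> I" using ideal.I_r_closed[OF I] ab r by blast
    then show False using ideal_prod.prod[of "a \<otimes> r" I b J R] ab IJ r by blast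
  qed
  moreover have "P \<noteq> carrier R" using C by blast
  ultimately show "P \<in> Spec R" unfolding Spec_def using P.ideal_axioms by blast
qed

lemma (in ring) ideal_carrier_subset: "ideal J R \<Longrightarrow> J \<subseteq> carrier R"
  by (simp add: additive_subgroup.a_subset ideal.axioms(1))

lemma (in ring) maximalideal_iff:
  "maximalideal P R \<longleftrightarrow>
    ideal P R \<and> \<one> \<notin> P \<and> (\<forall>J. ideal J R \<longrightarrow> P \<subseteq> J \<longrightarrow> \<one> \<notin> J \<longrightarrow> J = P)"
  (is "_ \<longleftrightarrow> ?C")
proof
  assume "maximalideal P R"
  then interpret maximalideal P R .
  have "J = P" if J: "ideal J R" "P \<subseteq> J" "\<one> \<notin> J" for J
    using I_maximal[OF J(1,2) ideal_carrier_subset[OF J(1)]] J(3) by auto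
  then show ?C using I_notcarr is_ideal one_imp_carrier by auto
next
  assume C: ?C
  then show "maximalideal P R"
    by (intro maximalidealI) (blast, blast, metis ideal.one_imp_carrier)
qed

text \<open>For \<open>b\<close> outside a maximal \<open>P\<close>, the transporter of
  \<open>b\<close> into \<open>P\<close> contains \<open>P\<close> but not 1, hence equals
  \<open>P\<close>; this is primeness in the form of \<open>Spec_iff\<close>.\<close>

lemma (in ring) Max_Spec_subset_Spec: "Max_Spec R \<subseteq> Spec R"
proof
  fix P assume "P \<in> Max_Spec R"
  then have P: "ideal P R" "\<one> \<notin> P" and mx: "\<And>J. ideal J R \<Longrightarrow> P \<subseteq> J \<Longrightarrow> \<one> \<notin> J \<Longrightarrow> J = P"
    by (auto simp: Max_Spec_def maximalideal_iff)
  interpret P: ideal P R by (rule P)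
  have "a \<in> P"
    if a: "a \<in> carrier R" and b: "b \<in> carrier R" "b \<notin> P" and ab: "\<forall>r\<in>carrier R. a \<otimes> r \<otimes> b \<in> P"
    for a b
  proof -
    define I where "I = {a \<in> carrier R. \<forall>r\<in>carrier R. a \<otimes> r \<otimes> b \<in> P}"
    have "ideal I R" unfolding I_def by (rule ideal_transporter[OF P(1) b(1)])
    moreover have "P \<subseteq> I" unfolding I_def using b(1) P.Icarr P.I_r_closed by auto
    moreover have "\<one> \<notin> I" unfolding I_def using b by (auto intro!: bexI[of _ \<one>])
    ultimately have "I = P" by (rule mx)
    then show ?thesis using a ab I_def by blast
  qed
  then show "P \<in> Spec R" unfolding Spec_iff using P by blast
qed

text \<open>The lengths of chains ending at \<open>P\<close> form a downward closed set
  \<open>L\<close>, so the supremum is 1 exactly when \<open>L\<close> contains 1 but not 2.\<close>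

lemma ht_eq_one_iff:
  assumes P: "P \<in> Spec R"
  shows "ht R P = 1 \<longleftrightarrow>
    (\<exists>Q\<in>Spec R. Q \<subset> P) \<and> \<not> (\<exists>Q\<in>Spec R. \<exists>Q'\<in>Spec R. Q \<subset> Q' \<and> Q' \<subset> P)"
proof -
  define L where "L = {l. \<exists>C. C l = P \<and> (\<forall>i\<le>l. C i \<in> Spec R) \<and> (\<forall>i<l. C i \<subset> C (Suc i))}"
  have ht: "ht R P = Sup (enat ` L)"
    unfolding ht_def L_def by (rule arg_cong[where f = Sup]) auto
  have L0: "0 \<in> L" unfolding L_def using P by (auto intro: exI[of _ "\<lambda>_. P"])
  have down: "k \<in> L" if l: "l \<in> L" "k \<le> l" for k l
  proof -
    obtain C where C: "C l = P" "\<forall>i\<le>l. C i \<in> Spec R" "\<forall>i<l. C i \<subset> C (Suc i)"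
      using l(1) unfolding L_def by blast
    \<comment> \<open>Dropping the lowest \<open>l - k\<close> members keeps \<open>P\<close> at the
      top.\<close>
    show ?thesis unfolding L_def using C l(2)
      by (intro CollectI exI[of _ "\<lambda>i. C (i + (l - k))"]) auto
  qed
  have L1: "1 \<in> L \<longleftrightarrow> (\<exists>Q\<in>Spec R. Q \<subset> P)"
  proof
    assume "1 \<in> L"
    then obtain C where "C 1 = P" "\<forall>i\<le>(1::nat). C i \<in> Spec R" "\<forall>i<(1::nat). C i \<subset> C (Suc i)"
      unfolding L_def by blast
    then show "\<exists>Q\<in>Spec R. Q \<subset> P" by (intro bexI[of _ "C 0"]) auto
  next
    assume "\<exists>Q\<in>Spec R. Q \<subset> P"
    then obtain Q where "Q \<in> Spec R" "Q \<subset> P" by blast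
    then show "1 \<in> L" unfolding L_def using P
      by (intro CollectI exI[of _ "\<lambda>i. if i = 0 then Q else P"]) auto
  qed
  have L2: "2 \<in> L \<longleftrightarrow> (\<exists>Q\<in>Spec R. \<exists>Q'\<in>Spec R. Q \<subset> Q' \<and> Q' \<subset> P)"
  proof
    assume "2 \<in> L"
    then obtain C where C: "C 2 = P" "\<forall>i\<le>(2::nat). C i \<in> Spec R" "\<forall>i<(2::nat). C i \<subset> C (Suc i)"
      unfolding L_def by blast
    have "C 0 \<subset> C 1" "C 1 \<subset> P" using C(3) C(1) by (auto dest: spec[of _ 0] spec[of _ 1] simp: numeral_2_eq_2)
    then show "\<exists>Q\<in>Spec R. \<exists>Q'\<in>Spec R. Q \<subset> Q' \<and> Q' \<subset> P"
      using C(2) by (intro bexI[of _ "C 0"] bexI[of _ "C 1"]) auto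
  next
    assume "\<exists>Q\<in>Spec R. \<exists>Q'\<in>Spec R. Q \<subset> Q' \<and> Q' \<subset> P"
    then obtain Q Q' where "Q \<in> Spec R" "Q' \<in> Spec R" "Q \<subset> Q'" "Q' \<subset> P" by blast
    then show "2 \<in> L" unfolding L_def using P
      by (intro CollectI exI[of _ "\<lambda>i. if i = 0 then Q else if i = 1 then Q' else P"])
        (auto simp: less_Suc_eq numeral_2_eq_2)
  qed
  have "ht R P = 1 \<longleftrightarrow> 1 \<in> L \<and> 2 \<notin> L"
  proof
    assume h: "ht R P = 1"
    have "2 \<notin> L"
    proof
      assume "2 \<in> L"
      then have "enat 2 \<le> ht R P" unfolding ht by (intro Sup_upper imageI)
      then show False using h by (simp add: one_enat_def)
    qed
    moreover have "1 \<in> L"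
    proof (rule ccontr)
      assume "1 \<notin> L"
      then have "L = {0}" using L0 down[of _ 1] by (auto simp: Suc_le_eq)
      then show False using h unfolding ht by (simp add: one_enat_def)
    qed
    ultimately show "1 \<in> L \<and> 2 \<notin> L" by simp
  next
    assume A: "1 \<in> L \<and> 2 \<notin> L"
    have "l \<le> 1" if "l \<in> L" for l
      using A down[OF that, of 2] by (cases "l \<le> 1") auto
    then have "ht R P \<le> 1" unfolding ht
      by (intro Sup_least) (auto simp: one_enat_def)
    moreover have "1 \<le> ht R P" unfolding ht one_enat_def using A by (intro Sup_upper imageI) simp
    ultimately show "ht R P = 1" by simp
  qed
  then show ?thesis using L1 L2 by simp
qed

text \<open>Bridge between a commutative ring given by a type and a ring with carrier: the ideal
  theory above lives on types and is transported along \<open>f\<close> to the centre and to the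
  subalgebras generated by \<open>h\<close> and by \<open>x\<close>.\<close>

locale type_ring_iso = ring R for R (structure) +
  fixes f :: "'r::comm_ring_1 \<Rightarrow> 'a"
  assumes iso: "f \<in> ring_iso ring_of_type_algebra R"
begin

lemma bij: "bij_betw f UNIV (carrier R)"
  using iso by (simp add: ring_iso_def ring_of_type_algebra_def)

lemma inj: "inj f" and range_f: "range f = carrier R"
  using bij by (auto simp: bij_betw_def)

lemma f_mem [simp]: "f a \<in> f ` J \<longleftrightarrow> a \<in> J"
  using inj by (simp add: inj_image_mem_iff)

lemma f_closed [simp]: "f a \<in> carrier R"
  using range_f by blast

lemma hom: "f \<in> ring_hom ring_of_type_algebra R"
  using iso by (simp add: ring_iso_def)

lemma f_mult: "f (a * b) = f a \<otimes> f b" and f_add: "f (a + b) = f a \<oplus> f b" and f_one: "f 1 = \<one>"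
  using ring_hom_mult[OF hom, of a b] ring_hom_add[OF hom, of a b] ring_hom_one[OF hom]
  by (simp_all add: ring_of_type_algebra_def)

lemma f_zero: "f 0 = \<zero>"
  using f_add[of 0 0] by simp

lemma carrier_ball: "(\<forall>r\<in>carrier R. P r) \<longleftrightarrow> (\<forall>r. P (f r))"
  using range_f by (metis f_closed imageE)

lemma ideal_image_iff: "ideal (f ` J) R \<longleftrightarrow> is_ideal J"
proof -
  have "f ` J \<subseteq> carrier R" by auto
  then show ?thesis
    unfolding ideal_iff is_ideal_def carrier_ball
    by (simp add: f_mult[symmetric] f_add[symmetric] f_zero[symmetric] mult.commute)
qed

lemma ex_image:
  assumes "ideal I R"
  obtains J where "I = f ` J"
proof -
  have "I \<subseteq> range f" using assms range_f additive_subgroup.a_subset ideal.axioms(1) by blast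
  then show ?thesis using that[of "f -` I"] by auto
qed

text \<open>By commutativity the test on all products \<open>a * r * b\<close> reduces to the case
  \<open>r = 1\<close>.\<close>

lemma Spec_image_iff: "f ` p \<in> Spec R \<longleftrightarrow> is_prime_ideal p"
proof -
  have "(\<forall>r. a * r * b \<in> p) \<longleftrightarrow> a * b \<in> p" if "is_ideal p" for a b
    using is_idealD(3)[OF that, of "a * b"] by (auto simp: algebra_simps dest: spec[of _ 1])
  then show ?thesis
    unfolding Spec_iff is_prime_ideal_def ideal_image_iff carrier_ball
    by (simp add: f_mult[symmetric] f_one[symmetric] cong: conj_cong)
qed

lemma maximalideal_image_iff: "maximalideal (f ` p) R \<longleftrightarrow> is_maximal_ideal p"
proof -
  have "(\<forall>J. ideal J R \<longrightarrow> Q J) \<longleftrightarrow> (\<forall>J. is_ideal J \<longrightarrow> Q (f ` J))" for Q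
    by (metis ex_image ideal_image_iff)
  then show ?thesis
    unfolding maximalideal_iff is_maximal_ideal_def ideal_image_iff
    by (simp add: f_one[symmetric] inj_image_subset_iff[OF inj] inj_image_eq_iff[OF inj])
qed

lemma Spec_eq: "Spec R = (`) f ` {p. is_prime_ideal p}"
proof -
  have "P \<in> (`) f ` {p. is_prime_ideal p}" if P: "P \<in> Spec R" for P
  proof -
    obtain p where "P = f ` p" using P ex_image unfolding Spec_iff by blast
    then show ?thesis using P Spec_image_iff by blast
  qed
  then show ?thesis using Spec_image_iff by blast
qed

lemma Max_Spec_eq: "Max_Spec R = (`) f ` {p. is_maximal_ideal p}"
proof -
  have "P \<in> (`) f ` {p. is_maximal_ideal p}" if P: "maximalideal P R" for P
  proof -
    obtain p where "P = f ` p" using P ex_image unfolding maximalideal_iff by blast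
    then show ?thesis using P maximalideal_image_iff by blast
  qed
  then show ?thesis using maximalideal_image_iff unfolding Max_Spec_def by blast
qed

lemma Idl_image: "Idl {f a} = f ` {r. a dvd r}"
proof
  show "Idl {f a} \<subseteq> f ` {r. a dvd r}"
    by (rule genideal_minimal) (simp_all add: ideal_image_iff is_ideal_principal)
  have "f r \<otimes> f a \<in> Idl {f a}" for r
    using genideal_ideal[of "{f a}"] genideal_self'[of "f a"] by (auto intro: ideal.I_l_closed)
  then show "f ` {r. a dvd r} \<subseteq> Idl {f a}"
    by (auto elim!: dvdE simp: f_mult[symmetric] mult.commute)
qed

end

text \<open>Since \<open>{0}\<close> is prime, a nonzero prime strictly inside \<open>p\<close>
  yields a chain of length two starting at \<open>{0}\<close>; conversely the middle member of such
  a chain is nonzero.\<close>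

lemma (in type_ring_iso) ht_image:
  assumes dom: "is_prime_ideal {0 :: 'r}" and p: "is_prime_ideal p"
  shows "ht R (f ` p) = 1 \<longleftrightarrow> is_height_one p"
proof -
  have sub: "f ` Q \<subset> f ` Q' \<longleftrightarrow> Q \<subset> Q'" for Q Q'
    using inj_image_subset_iff[OF inj] inj_image_eq_iff[OF inj] by (metis psubset_eq)
  have zero: "0 \<in> Q" if "is_prime_ideal Q" for Q :: "'r set"
    using that is_idealD(1) is_prime_idealD(1) by blast
  have "ht R (f ` p) = 1 \<longleftrightarrow> (\<exists>Q. is_prime_ideal Q \<and> Q \<subset> p) \<and>
      \<not> (\<exists>Q Q'. is_prime_ideal Q \<and> is_prime_ideal Q' \<and> Q \<subset> Q' \<and> Q' \<subset> p)"
    using ht_eq_one_iff[where R = R and P = "f ` p"] p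
    by (auto simp: Spec_eq sub)
  also have "\<dots> \<longleftrightarrow> is_height_one p"
  proof
    assume A: "(\<exists>Q. is_prime_ideal Q \<and> Q \<subset> p) \<and>
      \<not> (\<exists>Q Q'. is_prime_ideal Q \<and> is_prime_ideal Q' \<and> Q \<subset> Q' \<and> Q' \<subset> p)"
    then obtain Q where Q: "is_prime_ideal Q" "Q \<subset> p" by blast
    have "p \<noteq> {0}" using Q zero[OF Q(1)] by auto
    moreover have "I = p" if I: "is_prime_ideal I" "I \<noteq> {0}" "I \<subseteq> p" for I
    proof (rule ccontr)
      assume "I \<noteq> p"
      moreover have "{0} \<subset> I" using zero[OF I(1)] I(2) by auto
      ultimately show False using A dom I by blast
    qed
    ultimately show "is_height_one p" using p unfolding is_height_one_def by simp
  next
    assume A: "is_height_one p"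
    have "{0} \<subset> p" using zero[OF p] A unfolding is_height_one_def by auto
    moreover have "False" if "is_prime_ideal Q" "is_prime_ideal Q'" "Q \<subset> Q'" "Q' \<subset> p" for Q Q'
    proof -
      have "Q' \<noteq> {0}" using zero[OF that(1)] that(3) by auto
      then show False using A that(2,4) unfolding is_height_one_def by auto
    qed
    ultimately show "(\<exists>Q. is_prime_ideal Q \<and> Q \<subset> p) \<and>
      \<not> (\<exists>Q Q'. is_prime_ideal Q \<and> is_prime_ideal Q' \<and> Q \<subset> Q' \<and> Q' \<subset> p)"
      using dom by blast
  qed
  finally show ?thesis .
qed

section \<open>Polynomials decomposed by exponents modulo \<open>n\<close>\<close>

definition stretch :: "nat \<Rightarrow> 'a::comm_ring_1 poly \<Rightarrow> 'a poly" where
  "stretch n p = pcompose p (monom 1 n)"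

text \<open>The coordinates of \<open>p\<close> over polynomials in \<open>X^n\<close> for the basis
  1, X, ..., X^(n-1). For positive \<open>n\<close> the bound \<open>degree p\<close> is large
  enough, as \<open>coeff_residue_part\<close> confirms.\<close>

definition residue_part :: "nat \<Rightarrow> nat \<Rightarrow> 'a::comm_ring_1 poly \<Rightarrow> 'a poly" where
  "residue_part n i p = (\<Sum>k\<le>degree p. monom (coeff p (n * k + i)) k)"

lemma stretch_simps [simp]:
  "stretch n 0 = 0" "stretch n 1 = 1" "stretch n (p + p') = stretch n p + stretch n p'"
  "stretch n (p * p') = stretch n p * stretch n p'" "stretch n [:c:] = [:c:]"
  by (simp_all add: stretch_def pcompose_add pcompose_mult pcompose_1)

lemma stretch_pCons: "stretch n (pCons a p) = [:a:] + monom 1 n * stretch n p"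
  by (simp add: stretch_def pcompose_pCons)

context
  fixes n :: nat
  assumes n: "n > 0"
begin

lemma coeff_stretch: "coeff (stretch n p) k = (if n dvd k then coeff p (k div n) else 0)"
proof (induction p arbitrary: k)
  case (pCons a p)
  have "n dvd k \<longleftrightarrow> n dvd (k - n)" "k div n = Suc ((k - n) div n)" if "\<not> k < n"
    using that n by (auto simp: le_div_geq dvd_minus_self)
  moreover have "n dvd k \<longleftrightarrow> k = 0" "k div n = 0" if "k < n" using that by (auto dest: dvd_imp_le)
  ultimately show ?case using pCons.IH[of "k - n"] n
    by (cases "k < n") (auto simp: stretch_pCons coeff_monom_mult coeff_pCons split: nat.splits)
qed (simp add: stretch_def)

lemma coeff_residue_part: "coeff (residue_part n i p) k = coeff p (n * k + i)"
proof -
  have "coeff p (n * k + i) = 0" if "degree p < k"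
  proof (rule coeff_eq_0)
    have "k \<le> n * k" using n by simp
    then show "degree p < n * k + i" using that by linarith
  qed
  then show ?thesis by (auto simp: residue_part_def coeff_sum)
qed

lemma residue_part_0 [simp]: "residue_part n i 0 = 0"
  by (simp add: poly_eq_iff coeff_residue_part)

lemma residue_part_add: "residue_part n i (p + p') = residue_part n i p + residue_part n i p'"
  by (simp add: poly_eq_iff coeff_residue_part)

lemma residue_part_sum: "residue_part n i (sum f A) = (\<Sum>x\<in>A. residue_part n i (f x))"
  by (induction A rule: infinite_finite_induct) (simp_all add: residue_part_add)

lemma residue_part_stretch_mult:
  assumes i: "i < n"
  shows "residue_part n i (stretch n f * p) = f * residue_part n i p"
proof (induction f)
  case (pCons a f)
  have "residue_part n i (monom 1 n * r) = [:0, 1:] * residue_part n i r" for r :: "'a poly"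
    using i by (auto simp: poly_eq_iff coeff_residue_part coeff_monom_mult coeff_pCons
        split: nat.splits)
  moreover have "residue_part n i (smult a r) = smult a (residue_part n i r)" for r
    by (simp add: poly_eq_iff coeff_residue_part)
  ultimately show ?case using pCons.IH
    by (simp add: stretch_pCons residue_part_add distrib_right mult.assoc)
qed simp

lemma coeff_stretch_residue:
  assumes "i < n"
  shows "coeff (stretch n (residue_part n i p) * monom 1 i) k = (if k mod n = i then coeff p k else 0)"
proof (cases "k < i")
  case True
  then have "k mod n = k" using assms by simp
  then show ?thesis using True by (simp add: mult.commute[of _ "monom 1 i"] coeff_monom_mult)
next
  case False
  have iff: "n dvd k - i \<longleftrightarrow> k mod n = i"
    using False assms by (metis mod_eq_dvd_iff_nat mod_less not_less)
  have "n * ((k - i) div n) + i = k" if "n dvd k - i" using that False by simp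
  then show ?thesis using False iff
    by (simp add: mult.commute[of _ "monom 1 i"] coeff_monom_mult coeff_stretch coeff_residue_part)
qed

text \<open>Substitutes \<open>h^n\<close> and \<open>x^n\<close> for the two variables;
  \<open>centre_eq\<close> shows that this parametrises the centre.\<close>

definition stretch2 :: "'a::comm_ring_1 poly poly \<Rightarrow> 'a poly poly" where
  "stretch2 f = stretch n (map_poly (stretch n) f)"

text \<open>The coordinate at \<open>h^j x^i\<close>, returned as an element of
  \<open>K[S][T]\<close> rather than of its image: \<open>i\<close> is the residue of the exponent
  of \<open>x\<close>, \<open>j\<close> that of \<open>h\<close>.\<close>

definition component :: "nat \<Rightarrow> nat \<Rightarrow> 'a::comm_ring_1 poly poly \<Rightarrow> 'a poly poly" where
  "component i j a = map_poly (residue_part n j) (residue_part n i a)"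

lemma map_stretch:
  "map_poly (stretch n) (f + g) = map_poly (stretch n) f + map_poly (stretch n) g"
  "map_poly (stretch n) (f * g) = map_poly (stretch n) f * map_poly (stretch n) g"
proof -
  have sum: "stretch n (sum u A) = (\<Sum>x\<in>A. stretch n (u x))" for u :: "nat \<Rightarrow> 'a poly" and A
    by (induction A rule: infinite_finite_induct) simp_all
  show "map_poly (stretch n) (f + g) = map_poly (stretch n) f + map_poly (stretch n) g"
    "map_poly (stretch n) (f * g) = map_poly (stretch n) f * map_poly (stretch n) g"
    by (simp_all add: poly_eq_iff[of "map_poly _ _"] coeff_map_poly coeff_mult sum)
qed

lemma stretch2_simps [simp]:
  "stretch2 0 = 0" "stretch2 1 = 1" "stretch2 (f + g) = stretch2 f + stretch2 g"
  "stretch2 (f * g) = stretch2 f * stretch2 g"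
  by (simp_all add: stretch2_def map_stretch)

lemma coeff_stretch2:
  "coeff (coeff (stretch2 f) k) l =
    (if n dvd k \<and> n dvd l then coeff (coeff f (k div n)) (l div n) else 0)"
  by (simp add: stretch2_def coeff_stretch coeff_map_poly)

lemma coeff_component:
  "coeff (coeff (component i j a) k) l = coeff (coeff a (n * k + i)) (n * l + j)"
  by (simp add: component_def coeff_map_poly coeff_residue_part)

lemma component_0 [simp]: "component i j 0 = 0"
  by (simp add: poly_eq_iff coeff_component)

lemma component_add: "component i j (a + b) = component i j a + component i j b"
  by (simp add: poly_eq_iff coeff_component)

text \<open>Linearity over \<open>K[S][T]\<close>, acting through \<open>stretch2\<close>; it lets
  primality and regularity be checked coordinate by coordinate.\<close>

lemma component_stretch2_mult:
  assumes "i < n" "j < n"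
  shows "component i j (stretch2 f * a) = f * component i j a"
  unfolding component_def stretch2_def residue_part_stretch_mult[OF assms(1)]
  by (rule poly_eqI)
    (simp add: coeff_map_poly coeff_mult residue_part_sum residue_part_stretch_mult[OF assms(2)])

lemma component_stretch2 [simp]: "component 0 0 (stretch2 f) = f"
  by (simp add: poly_eq_iff coeff_component coeff_stretch2 n)

lemma inj_stretch2: "inj stretch2"
  by (rule inj_on_inverseI[of _ "component 0 0"]) simp

lemma coeff_component_monom:
  assumes "i < n" "j < n"
  shows "coeff (coeff (stretch2 (component i j a) * monom (monom 1 j) i) k) l =
    (if k mod n = i \<and> l mod n = j then coeff (coeff a k) l else 0)"
proof -
  let ?r = "residue_part n i a"
  have m: "monom (monom 1 j) i = [:monom 1 j:] * monom 1 i" by (simp add: smult_monom)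
  have "stretch2 (component i j a) * monom (monom 1 j) i =
      stretch n (map_poly (\<lambda>p. stretch n (residue_part n j p) * monom 1 j) ?r) * monom 1 i"
  proof -
    have "map_poly (\<lambda>p. stretch n (residue_part n j p) * monom 1 j) ?r =
        map_poly (stretch n) (component i j a) * [:monom 1 j:]"
      by (simp add: poly_eq_iff[of "map_poly _ _"] coeff_map_poly component_def mult.commute)
    then show ?thesis by (simp only: m stretch2_def stretch_simps mult.assoc)
  qed
  also have "coeff (coeff \<dots> k) l = (if k mod n = i \<and> l mod n = j then coeff (coeff a k) l else 0)"
  proof -
    have "map_poly (\<lambda>p. stretch n (residue_part n j p) * monom 1 j) ?r =
       residue_part n i (map_poly (\<lambda>p. stretch n (residue_part n j p) * monom 1 j) a)"
      by (rule poly_eqI) (simp add: coeff_map_poly coeff_residue_part)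
    then show ?thesis
      using assms by (simp add: coeff_stretch_residue coeff_map_poly)
  qed
  finally show ?thesis .
qed

text \<open>Every exponent pair has exactly one pair of residues modulo \<open>n\<close>, so each
  coefficient is picked up by exactly one summand.\<close>

lemma sum_components:
  "(\<Sum>i<n. \<Sum>j<n. stretch2 (component i j a) * monom (monom 1 j) i) = a"
proof (intro poly_eqI)
  fix k l
  have "coeff (coeff (\<Sum>i<n. \<Sum>j<n. stretch2 (component i j a) * monom (monom 1 j) i) k) l
      = (\<Sum>i<n. \<Sum>j<n. if j = l mod n then if i = k mod n then coeff (coeff a k) l else 0 else 0)"
    unfolding coeff_sum by (intro sum.cong refl) (auto simp: coeff_component_monom)
  also have "\<dots> = coeff (coeff a k) l" using n by (simp add: sum.delta)
  finally show "coeff (coeff (\<Sum>i<n. \<Sum>j<n. stretch2 (component i j a) * monom (monom 1 j) i) k) l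
      = coeff (coeff a k) l" .
qed

end

text \<open>Nodes are eliminated one at a time: the power sum for \<open>k + 1\<close> minus
  \<open>w m\<close> times the one for \<open>k\<close> is a power sum over the other nodes for the
  vectors \<open>scalar (w i - w m) * v i\<close>, whose scalar factors are units.\<close>

lemma vandermonde_isolate:
  fixes w :: "nat \<Rightarrow> 'k::field" and v :: "nat \<Rightarrow> 'k poly poly"
  assumes add: "\<And>a b. a \<in> I \<Longrightarrow> b \<in> I \<Longrightarrow> a + b \<in> I"
    and scal: "\<And>c a. a \<in> I \<Longrightarrow> scalar c * a \<in> I"
    and fin: "finite S" and inj: "inj_on w S"
    and sum: "\<And>k. (\<Sum>i\<in>S. scalar (w i ^ k) * v i) \<in> I"
    and i: "i \<in> S"
  shows "v i \<in> I"
  using fin inj sum i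
proof (induction S arbitrary: v i rule: finite_induct)
  case empty
  then show ?case by simp
next
  case (insert m S)
  have sm: "scalar (c * d) = scalar c * scalar d" "scalar (c + d) = scalar c + scalar d" for c d :: 'k
    by (simp_all add: scalar_def mult.commute)
  have v: "v j \<in> I" if j: "j \<in> S" for j
  proof -
    have "scalar (w j - w m) * v j \<in> I"
    proof (rule insert.IH)
      show "inj_on w S" using insert.prems(1) by simp
      show "j \<in> S" by (rule j)
      fix k
      have t: "scalar (w i ^ k) * (scalar (w i - w m) * v i) =
          scalar (w i ^ Suc k) * v i + scalar (- w m) * (scalar (w i ^ k) * v i)" for i
        unfolding mult.assoc[symmetric] sm[symmetric] distrib_right[symmetric]
        by (simp add: algebra_simps)
      have "(\<Sum>i\<in>S. scalar (w i ^ k) * (scalar (w i - w m) * v i))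
          = (\<Sum>i\<in>insert m S. scalar (w i ^ k) * (scalar (w i - w m) * v i))"
        using insert.hyps by (simp add: scalar_def)
      also have "\<dots> = (\<Sum>i\<in>insert m S. scalar (w i ^ Suc k) * v i)
            + scalar (- w m) * (\<Sum>i\<in>insert m S. scalar (w i ^ k) * v i)"
        unfolding t sum.distrib sum_distrib_left ..
      also have "\<dots> \<in> I" using insert.prems(2)[of "Suc k"] insert.prems(2)[of k] by (intro add scal)
      finally show "(\<Sum>i\<in>S. scalar (w i ^ k) * (scalar (w i - w m) * v i)) \<in> I" .
    qed
    then have "scalar (inverse (w j - w m)) * (scalar (w j - w m) * v j) \<in> I" by (rule scal)
    moreover have "w j \<noteq> w m" using insert.prems(1) insert.hyps j by (auto simp: inj_on_def)
    then have "scalar (inverse (w j - w m)) * scalar (w j - w m) = 1"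
      by (simp add: scalar_def one_pCons)
    ultimately show ?thesis by (simp add: mult.assoc[symmetric])
  qed
  show ?case
  proof (cases "i = m")
    case True
    \<comment> \<open>The sum for \<open>k = 0\<close> contains \<open>v m\<close> once; the other
      vectors are already in \<open>I\<close> and are subtracted.\<close>
    have total: "v m + sum v S \<in> I"
      using insert.prems(2)[of 0] insert.hyps by (simp add: scalar_def one_pCons[symmetric])
    have "0 \<in> I" using scal[OF total, of 0] by (simp add: scalar_def)
    then have "sum v S \<in> I" using v by (induction S rule: infinite_finite_induct) (auto intro: add)
    then have "(v m + sum v S) + scalar (-1) * sum v S \<in> I" by (intro add[OF total] scal)
    moreover have "scalar (-1) = (-1 :: 'k poly poly)" by (simp add: scalar_def one_pCons)
    ultimately show ?thesis using True by simp
  qed (use v insert.prems in auto)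
qed

section \<open>The quantum plane at a root of unity\<close>

lemma qplane_simps [simp]:
  "carrier (qplane q) = UNIV" "\<zero>\<^bsub>qplane q\<^esub> = 0" "\<one>\<^bsub>qplane q\<^esub> = 1" "a \<oplus>\<^bsub>qplane q\<^esub> b = a + b"
  by (simp_all add: qplane_def skew_poly_ring_def)

lemma twist_pow: "((\<lambda>p. pcompose p [:0, q:]) ^^ i) p = pcompose p [:0, q ^ i:]"
  for q :: "'k::field"
  by (induction i) (simp_all add: pcompose_assoc[symmetric] pcompose_pCons mult.commute)

lemma coeff_qmult:
  "coeff (a \<otimes>\<^bsub>qplane q\<^esub> b) k = (\<Sum>i\<le>k. coeff a i * pcompose (coeff b (k - i)) [:0, q ^ i:])"
  by (simp add: qplane_def skew_poly_ring_def coeff_skew_mult twist_pow)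

text \<open>Moving \<open>x^i\<close> past \<open>h^j\<close> contributes \<open>(q^i)^j\<close>,
  which is trivial for these exponents. With \<open>qmult_eq_mult_right\<close> this makes products
  with central elements commutative ones.\<close>

lemma qmult_eq_mult_left:
  assumes "\<And>i. coeff a i \<noteq> 0 \<Longrightarrow> q ^ i = 1"
  shows "a \<otimes>\<^bsub>qplane q\<^esub> b = a * b"
proof (rule poly_eqI)
  fix k
  have "coeff a i * pcompose (coeff b (k - i)) [:0, q ^ i:] = coeff a i * coeff b (k - i)" for i
    using assms[of i] by (cases "coeff a i = 0") simp_all
  then show "coeff (a \<otimes>\<^bsub>qplane q\<^esub> b) k = coeff (a * b) k"
    unfolding coeff_qmult coeff_mult by (rule sum.cong[OF refl])
qed

lemma qmult_eq_mult_right: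
  assumes b: "\<And>i. pcompose (coeff b i) [:0, q:] = coeff b i"
  shows "a \<otimes>\<^bsub>qplane q\<^esub> b = a * b"
proof -
  have "((\<lambda>p. pcompose p [:0, q:]) ^^ i) (coeff b j) = coeff b j" for i j
    by (induction i) (simp_all add: b)
  then show ?thesis by (auto simp: poly_eq_iff[of "_ \<otimes>\<^bsub>_\<^esub> _"] coeff_qmult coeff_mult twist_pow)
qed

lemma const_qmult [simp]: "[:c:] \<otimes>\<^bsub>qplane q\<^esub> b = [:c:] * b"
  by (rule qmult_eq_mult_left) (simp add: coeff_pCons split: nat.splits)

lemma qmult_monom [simp]: "a \<otimes>\<^bsub>qplane q\<^esub> monom 1 k = a * monom 1 k"
  by (rule qmult_eq_mult_right) (simp add: coeff_monom pcompose_1)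

lemma gen_x_monom: "gen_x = monom 1 1"
  by (simp add: gen_x_def monom_altdef)

lemma qmult_gen_x [simp]: "a \<otimes>\<^bsub>qplane q\<^esub> gen_x = a * gen_x"
  unfolding gen_x_monom by (rule qmult_monom)

lemma gen_h_qmult [simp]: "gen_h \<otimes>\<^bsub>qplane q\<^esub> b = gen_h * b"
  by (simp add: gen_h_def)

text \<open>Conjugation by \<open>h\<close> and by \<open>x\<close>.\<close>

definition twist_h :: "'k::field \<Rightarrow> 'k poly poly \<Rightarrow> 'k poly poly" where
  "twist_h q a = pcompose a [:0, [:q:]:]"

definition twist_x :: "'k::field \<Rightarrow> 'k poly poly \<Rightarrow> 'k poly poly" where
  "twist_x q a = map_poly (\<lambda>p. pcompose p [:0, q:]) a"

lemma coeff_twist_h: "coeff (twist_h q a) i = smult (q ^ i) (coeff a i)"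
proof -
  have "[:q:] ^ i = [:q ^ i:]" by (simp add: poly_const_pow)
  then show ?thesis by (simp add: twist_h_def coeff_pcompose_linear)
qed

lemma coeff_twist_x: "coeff (coeff (twist_x q a) i) j = q ^ j * coeff (coeff a i) j"
  by (simp add: twist_x_def coeff_map_poly coeff_pcompose_linear)

text \<open>Pulling \<open>h\<close> to the left past \<open>x^i\<close> costs \<open>q^i\<close>;
  \<open>gen_x_qmult\<close> is the counterpart for \<open>x\<close>.\<close>

lemma qmult_gen_h: "a \<otimes>\<^bsub>qplane q\<^esub> gen_h = gen_h * twist_h q a"
proof (rule poly_eqI)
  fix k
  have "coeff (a \<otimes>\<^bsub>qplane q\<^esub> gen_h) k =
      (\<Sum>i\<le>k. if i = k then coeff a k * [:0, q ^ k:] else 0)"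
    unfolding coeff_qmult
    by (rule sum.cong) (auto simp: gen_h_def coeff_pCons pcompose_pCons split: nat.splits)
  also have "\<dots> = coeff (gen_h * twist_h q a) k"
    by (simp add: gen_h_def coeff_twist_h mult.commute)
  finally show "coeff (a \<otimes>\<^bsub>qplane q\<^esub> gen_h) k = coeff (gen_h * twist_h q a) k" .
qed

lemma gen_x_qmult: "gen_x \<otimes>\<^bsub>qplane q\<^esub> a = twist_x q a * gen_x"
proof (rule poly_eqI)
  fix k
  show "coeff (gen_x \<otimes>\<^bsub>qplane q\<^esub> a) k = coeff (twist_x q a * gen_x) k"
  proof (cases k)
    case 0
    then show ?thesis by (simp add: coeff_qmult gen_x_def coeff_mult)
  next
    case (Suc j)
    have "coeff (gen_x \<otimes>\<^bsub>qplane q\<^esub> a) k =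
        (\<Sum>i\<le>k. if i = 1 then pcompose (coeff a j) [:0, q:] else 0)"
      unfolding coeff_qmult
      by (rule sum.cong) (auto simp: Suc gen_x_def coeff_pCons split: nat.splits)
    also have "\<dots> = coeff (twist_x q a * gen_x) k"
      by (simp add: Suc gen_x_monom mult.commute[of _ "monom 1 _"] coeff_monom_mult twist_x_def
          coeff_map_poly)
    finally show ?thesis .
  qed
qed

lemma gen_h_pow: "gen_h [^]\<^bsub>qplane q\<^esub> k = [:monom 1 k:]" for k :: nat
proof -
  interpret ring "qplane q" by (rule ring_qplane)
  show ?thesis by (induction k) (simp_all add: one_pCons gen_h_def monom_Suc)
qed

lemma gen_x_pow: "gen_x [^]\<^bsub>qplane q\<^esub> k = monom 1 k" for k :: nat
proof -
  interpret ring "qplane q" by (rule ring_qplane)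
  show ?thesis by (induction k) (simp_all add: gen_x_monom mult_monom)
qed

locale quantum_plane_at_root =
  fixes q :: "'k::field" and n :: nat
  assumes n2: "n \<ge> 2" and qn: "q ^ n = 1" and prim: "\<And>k. 0 < k \<Longrightarrow> k < n \<Longrightarrow> q ^ k \<noteq> 1"
begin

sublocale A: ring "qplane q"
  by (rule ring_qplane)

abbreviation qmult :: "'k poly poly \<Rightarrow> 'k poly poly \<Rightarrow> 'k poly poly" (infixl "\<star>" 70) where
  "a \<star> b \<equiv> a \<otimes>\<^bsub>qplane q\<^esub> b"

abbreviation E :: "'k poly poly \<Rightarrow> 'k poly poly" where
  "E \<equiv> stretch2 n"

lemma n0: "n > 0"
  using n2 by simp

lemma q0: "q \<noteq> 0"
  using qn n0 by (auto simp: power_0_left)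

lemma q_pow_eq_1_iff: "q ^ k = 1 \<longleftrightarrow> n dvd k"
proof -
  have "q ^ k = q ^ (n * (k div n) + k mod n)" by simp
  also have "\<dots> = q ^ (k mod n)" by (simp only: power_add power_mult qn) simp
  finally show ?thesis using prim[of "k mod n"] n0 by (auto simp: mod_eq_0_iff_dvd)
qed

lemma q_pow_mod: "q ^ k = q ^ (k mod n)"
proof -
  have "q ^ k = q ^ (n * (k div n) + k mod n)" by simp
  then show ?thesis by (simp only: power_add power_mult qn) simp
qed

text \<open>Primitivity provides the distinct nodes for \<open>vandermonde_isolate\<close>.\<close>

lemma inj_q_pow: "inj_on (\<lambda>i. q ^ i) {..<n}"
proof (rule linorder_inj_onI)
  fix i j :: nat assume ij: "i < j" "i \<in> {..<n}" "j \<in> {..<n}"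
  have "q ^ j = q ^ i * q ^ (j - i)" using ij by (simp add: power_add[symmetric])
  then show "q ^ i \<noteq> q ^ j" using prim[of "j - i"] ij q0 by auto
qed auto

lemma E_qmult [simp]: "E f \<star> b = E f * b"
proof (rule qmult_eq_mult_left)
  fix i assume "coeff (E f) i \<noteq> 0"
  then obtain l where "coeff (coeff (E f) i) l \<noteq> 0" by (metis leading_coeff_neq_0)
  then show "q ^ i = 1" by (auto simp: coeff_stretch2 n0 q_pow_eq_1_iff split: if_splits)
qed

lemma qmult_E [simp]: "b \<star> E f = b * E f"
  by (rule qmult_eq_mult_right)
    (auto simp: poly_eq_iff coeff_pcompose_linear coeff_stretch2 n0 q_pow_eq_1_iff)

lemma elt_s_eq: "elt_s q n = E [:[:0, 1:]:]" and elt_t_eq: "elt_t q n = E [:0, 1:]"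
  by (simp_all add: elt_s_def elt_t_def gen_h_pow gen_x_pow stretch2_def stretch_pCons map_poly_pCons n0)

text \<open>Commuting with \<open>h\<close> forces \<open>q^k = 1\<close> for the occurring
  exponents \<open>k\<close> of \<open>x\<close>, commuting with \<open>x\<close> does so for those
  of \<open>h\<close>; primitivity turns both into divisibility by \<open>n\<close>.\<close>

lemma centre_eq: "centre (qplane q) = range E"
proof
  show "range E \<subseteq> centre (qplane q)" by (auto simp: centre_def)
  show "centre (qplane q) \<subseteq> range E"
  proof
    fix a assume a: "a \<in> centre (qplane q)"
    then have "a \<star> b = b \<star> a" for b unfolding centre_def by auto
    from this[of gen_h] this[of gen_x] have "a \<star> gen_h = gen_h \<star> a" "a \<star> gen_x = gen_x \<star> a" .
    then have h: "gen_h * twist_h q a = gen_h * a" and x: "a * gen_x = twist_x q a * gen_x"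
      by (simp_all add: qmult_gen_h gen_x_qmult)
    \<comment> \<open>The commutative product has no zero divisors, so \<open>h\<close> and
      \<open>x\<close> cancel.\<close>
    have "gen_h \<noteq> (0 :: 'k poly poly)" "gen_x \<noteq> (0 :: 'k poly poly)" by (simp_all add: gen_h_def gen_x_def)
    then have h: "twist_h q a = a" and x: "twist_x q a = a" using h x by simp_all
    have "n dvd k \<and> n dvd l" if nz: "coeff (coeff a k) l \<noteq> 0" for k l
    proof -
      have "q ^ k * coeff (coeff a k) l = coeff (coeff a k) l"
        using arg_cong[OF h, of "\<lambda>a. coeff (coeff a k) l"] by (simp add: coeff_twist_h)
      moreover have "q ^ l * coeff (coeff a k) l = coeff (coeff a k) l"
        using arg_cong[OF x, of "\<lambda>a. coeff (coeff a k) l"] by (simp add: coeff_twist_x)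
      ultimately show ?thesis using nz by (simp add: q_pow_eq_1_iff)
    qed
    then have "a = E (component n 0 0 a)"
      by (intro poly_eqI) (auto simp: coeff_stretch2 n0 coeff_component)
    then show "a \<in> range E" by blast
  qed
qed

section \<open>Ideals modulo which s and t are regular\<close>

lemma ideal_iff':
  "ideal I (qplane q) \<longleftrightarrow> 0 \<in> I \<and> (\<forall>a\<in>I. \<forall>b\<in>I. a + b \<in> I) \<and> (\<forall>r. \<forall>a\<in>I. r \<star> a \<in> I \<and> a \<star> r \<in> I)"
  by (simp add: A.ideal_iff)

lemma idealD:
  assumes "ideal I (qplane q)"
  shows "0 \<in> I" "a \<in> I \<Longrightarrow> b \<in> I \<Longrightarrow> a + b \<in> I" "a \<in> I \<Longrightarrow> r \<star> a \<in> I" "a \<in> I \<Longrightarrow> a \<star> r \<in> I"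
    "a \<in> I \<Longrightarrow> E z * a \<in> I" "a \<in> I \<Longrightarrow> [:c:] * a \<in> I" "E z \<in> I \<Longrightarrow> E z * a \<in> I"
proof -
  show *: "0 \<in> I" "a \<in> I \<Longrightarrow> b \<in> I \<Longrightarrow> a + b \<in> I" "a \<in> I \<Longrightarrow> r \<star> a \<in> I" "a \<in> I \<Longrightarrow> a \<star> r \<in> I" for a b r
    using assms unfolding ideal_iff' by blast+
  show "a \<in> I \<Longrightarrow> E z * a \<in> I" "a \<in> I \<Longrightarrow> [:c:] * a \<in> I" "E z \<in> I \<Longrightarrow> E z * a \<in> I"
    using *(3)[of a "E z"] *(3)[of a "[:c:]"] *(4)[of "E z" a] by simp_all
qed

lemma ideal_sum: "ideal I (qplane q) \<Longrightarrow> (\<And>i. i \<in> S \<Longrightarrow> f i \<in> I) \<Longrightarrow> sum f S \<in> I"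
  by (induction S rule: infinite_finite_induct) (auto intro: idealD)

text \<open>\<open>row i\<close> and \<open>column j\<close> project to the eigenspaces of
  \<open>twist_h\<close> and \<open>twist_x\<close> for the eigenvalues \<open>q^i\<close> and
  \<open>q^j\<close>.\<close>

definition row :: "nat \<Rightarrow> 'k poly poly \<Rightarrow> 'k poly poly" where
  "row i a = stretch n (residue_part n i a) * monom 1 i"

definition column :: "nat \<Rightarrow> 'k poly poly \<Rightarrow> 'k poly poly" where
  "column j a = map_poly (\<lambda>p. stretch n (residue_part n j p) * monom 1 j) a"

lemma coeff_row: "i < n \<Longrightarrow> coeff (row i a) k = (if k mod n = i then coeff a k else 0)"
  by (simp add: row_def coeff_stretch_residue n0)

lemma coeff_column:
  "j < n \<Longrightarrow> coeff (coeff (column j a) k) l = (if l mod n = j then coeff (coeff a k) l else 0)"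
  by (simp add: column_def coeff_map_poly coeff_stretch_residue n0)

text \<open>Regularity makes \<open>I\<close> stable under both twists. Iterating them gives the
  power sums from which \<open>vandermonde_isolate\<close> extracts the part of \<open>a\<close>
  with prescribed exponents modulo \<open>n\<close>; this part is a central element times
  \<open>h^j x^i\<close>.\<close>

lemma regular_ideal_component:
  assumes I: "ideal I (qplane q)"
    and s: "\<And>a. E [:[:0, 1:]:] * a \<in> I \<Longrightarrow> a \<in> I" and t: "\<And>a. E [:0, 1:] * a \<in> I \<Longrightarrow> a \<in> I"
    and a: "a \<in> I" and ij: "i < n" "j < n"
  shows "E (component n i j a) \<in> I"
proof -
  have s_eq: "E [:[:0, 1:]:] = [:monom 1 n:]" and t_eq: "E [:0, 1:] = monom 1 n"
    by (simp_all add: stretch2_def stretch_pCons map_poly_pCons n0)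
  have th: "twist_h q b \<in> I" if b: "b \<in> I" for b
  proof (rule s)
    \<comment> \<open>As \<open>b\<close> times \<open>h\<close> is \<open>h\<close> times the twist
      of \<open>b\<close>, the factor \<open>h^(n-1)\<close> completes \<open>h\<close> to the
      central s.\<close>
    have "[:monom 1 (n - 1):] * (gen_h * twist_h q b) \<in> I"
      using idealD(4)[OF I b, of gen_h] by (intro idealD(6)[OF I]) (simp add: qmult_gen_h)
    also have "[:monom 1 (n - 1):] * (gen_h * twist_h q b) = E [:[:0, 1:]:] * twist_h q b"
    proof -
      have "[:monom 1 (n - 1):] * gen_h = [:monom 1 (n - 1) * monom 1 1 :: 'k poly:]"
        by (simp add: gen_h_def monom_altdef)
      also have "\<dots> = E [:[:0, 1:]:]" using n0 by (simp add: s_eq mult_monom)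
      finally have "[:monom 1 (n - 1):] * gen_h = E [:[:0, 1:]:]" .
      then show ?thesis by (simp only: mult.assoc[symmetric])
    qed
    finally show "E [:[:0, 1:]:] * twist_h q b \<in> I" .
  qed
  have tx: "twist_x q b \<in> I" if b: "b \<in> I" for b
  proof (rule t)
    have "(twist_x q b * gen_x) \<star> monom 1 (n - 1) \<in> I"
      using idealD(3)[OF I b, of gen_x] by (intro idealD(4)[OF I]) (simp add: gen_x_qmult)
    also have "(twist_x q b * gen_x) \<star> monom 1 (n - 1) = twist_x q b * (monom 1 1 * monom 1 (n - 1))"
      by (simp add: gen_x_monom mult.assoc)
    also have "\<dots> = E [:0, 1:] * twist_x q b" using n0 by (simp add: t_eq mult_monom mult.commute)
    finally show "E [:0, 1:] * twist_x q b \<in> I" .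
  qed
  have scal: "scalar c * b \<in> I" if "b \<in> I" for c b
    using idealD(6)[OF I that] by (simp add: scalar_def)
  have row: "row i b \<in> I" if b: "b \<in> I" for b
  proof (rule vandermonde_isolate[where S = "{..<n}" and w = "\<lambda>i. q ^ i" and v = "\<lambda>i. row i b"])
    fix k
    have "(twist_h q ^^ k) b \<in> I" by (induction k) (auto intro: b th)
    also have "(twist_h q ^^ k) b = (\<Sum>i<n. scalar ((q ^ i) ^ k) * row i b)"
    proof (rule poly_eqI)
      fix m
      have "coeff ((twist_h q ^^ k) b) m = smult ((q ^ m) ^ k) (coeff b m)"
        by (induction k) (simp_all add: coeff_twist_h)
      also have "\<dots> = (\<Sum>i<n. if i = m mod n then smult ((q ^ m) ^ k) (coeff b m) else 0)"
        using n0 by simp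
      also have "\<dots> = (\<Sum>i<n. coeff (scalar ((q ^ i) ^ k) * row i b) m)"
        by (rule sum.cong) (auto simp: scalar_def coeff_row simp flip: q_pow_mod)
      finally show "coeff ((twist_h q ^^ k) b) m = coeff (\<Sum>i<n. scalar ((q ^ i) ^ k) * row i b) m"
        by (simp add: coeff_sum)
    qed
    finally show "(\<Sum>i<n. scalar ((q ^ i) ^ k) * row i b) \<in> I" .
  qed (use inj_q_pow scal ij idealD(2)[OF I] in auto)
  have column: "column j b \<in> I" if b: "b \<in> I" for b
  proof (rule vandermonde_isolate[where S = "{..<n}" and w = "\<lambda>i. q ^ i" and v = "\<lambda>i. column i b"])
    fix k
    have "(twist_x q ^^ k) b \<in> I" by (induction k) (auto intro: b tx)
    also have "(twist_x q ^^ k) b = (\<Sum>i<n. scalar ((q ^ i) ^ k) * column i b)"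
    proof (intro poly_eqI)
      fix m l
      have "coeff (coeff ((twist_x q ^^ k) b) m) l = (q ^ l) ^ k * coeff (coeff b m) l"
        by (induction k) (simp_all add: coeff_twist_x)
      also have "\<dots> = (\<Sum>i<n. if i = l mod n then (q ^ l) ^ k * coeff (coeff b m) l else 0)"
        using n0 by simp
      also have "\<dots> = (\<Sum>i<n. coeff (coeff (scalar ((q ^ i) ^ k) * column i b) m) l)"
        by (rule sum.cong) (auto simp: scalar_def coeff_column simp flip: q_pow_mod)
      finally show "coeff (coeff ((twist_x q ^^ k) b) m) l =
          coeff (coeff (\<Sum>i<n. scalar ((q ^ i) ^ k) * column i b) m) l"
        by (simp add: coeff_sum)
    qed
    finally show "(\<Sum>i<n. scalar ((q ^ i) ^ k) * column i b) \<in> I" .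
  qed (use inj_q_pow scal ij idealD(2)[OF I] in auto)
  define z where "z = E (component n i j a)"
  have "column j (row i a) \<in> I" by (intro column row a)
  also have "column j (row i a) = z * monom (monom 1 j) i"
    unfolding z_def
    by (intro poly_eqI) (use ij in \<open>auto simp: coeff_component_monom n0 coeff_row coeff_column\<close>)
  \<comment> \<open>Multiplying by \<open>h^(n-j)\<close> and \<open>x^(n-i)\<close> completes
    \<open>h^j x^i\<close> to s t, and both central factors cancel.\<close>
  finally have "[:monom 1 (n - j):] * ((z * monom (monom 1 j) i) \<star> monom 1 (n - i)) \<in> I"
    by (intro idealD(6)[OF I] idealD(4)[OF I])
  also have "[:monom 1 (n - j):] * ((z * monom (monom 1 j) i) \<star> monom 1 (n - i)) =
      z * ([:monom 1 (n - j):] * (monom (monom 1 j) i * monom 1 (n - i)))"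
    by (simp add: mult_ac)
  also have "[:monom 1 (n - j):] * (monom (monom 1 j) i * monom 1 (n - i)) =
      [:monom 1 n:] * monom 1 n"
    using ij by (simp add: mult_monom smult_monom)
  also have "z * ([:monom 1 n:] * monom 1 n) = E [:[:0, 1:]:] * (E [:0, 1:] * z)"
    unfolding s_eq t_eq by (simp add: mult_ac)
  finally show ?thesis using s t z_def by blast
qed

text \<open>The extended ideal of \<open>p\<close>: by freeness over the centre, membership can be
  read off the coordinates. \<open>lift_ideal_eq_prod\<close> links it to the products in
  \<open>set_M\<close> and \<open>set_N\<close>.\<close>

definition lift_ideal :: "'k poly poly set \<Rightarrow> 'k poly poly set" where
  "lift_ideal p = {a. \<forall>i<n. \<forall>j<n. component n i j a \<in> p}"

lemma lift_ideal_eq_prod: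
  assumes p: "is_ideal p"
  shows "ideal_prod (qplane q) UNIV (E ` p) = lift_ideal p"
proof
  note D = is_idealD[OF p]
  show "ideal_prod (qplane q) UNIV (E ` p) \<subseteq> lift_ideal p"
  proof
    fix a assume "a \<in> ideal_prod (qplane q) UNIV (E ` p)"
    then show "a \<in> lift_ideal p"
    proof induction
      case (prod b z)
      then obtain f where f: "f \<in> p" "z = E f" by blast
      have "b \<star> z = E f * b" using f by (simp add: mult.commute)
      moreover have "component n i j (E f * b) \<in> p" if "i < n" "j < n" for i j
        unfolding component_stretch2_mult[OF n0 that] using f(1) by (rule D)
      ultimately show ?case by (simp add: lift_ideal_def)
    qed (simp add: lift_ideal_def component_add n0 D)
  qed
  show "lift_ideal p \<subseteq> ideal_prod (qplane q) UNIV (E ` p)"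
  proof
    fix a assume a: "a \<in> lift_ideal p"
    have "0 = 0 \<star> E 0" using E_qmult[of 0 0] by (simp add: n0)
    moreover have "E 0 \<in> E ` p" using D(1) by blast
    ultimately have zero: "0 \<in> ideal_prod (qplane q) UNIV (E ` p)"
      using ideal_prod.prod[of 0 UNIV "E 0" "E ` p" "qplane q"] by simp
    have sum: "sum f S \<in> ideal_prod (qplane q) UNIV (E ` p)"
      if "\<And>x. x \<in> S \<Longrightarrow> f x \<in> ideal_prod (qplane q) UNIV (E ` p)" for f and S :: "nat set"
      using that
    proof (induction S rule: infinite_finite_induct)
      case (insert x S)
      then show ?case using ideal_prod.sum[of "f x" "qplane q" UNIV "E ` p" "sum f S"] by simp
    qed (simp_all add: zero)
    have "monom (monom 1 j) i \<star> E (component n i j a) \<in> ideal_prod (qplane q) UNIV (E ` p)"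
      if "i < n" "j < n" for i j
      using a that by (intro ideal_prod.prod) (auto simp: lift_ideal_def)
    then have "(\<Sum>i<n. \<Sum>j<n. E (component n i j a) * monom (monom 1 j) i)
        \<in> ideal_prod (qplane q) UNIV (E ` p)"
      by (intro sum) (auto simp: mult.commute)
    then show "a \<in> ideal_prod (qplane q) UNIV (E ` p)" by (simp add: sum_components n0)
  qed
qed

lemma E_in_lift_ideal_iff:
  assumes p: "is_ideal p"
  shows "E f \<in> lift_ideal p \<longleftrightarrow> f \<in> p"
proof
  assume "E f \<in> lift_ideal p"
  then have "component n 0 0 (E f) \<in> p" using n0 unfolding lift_ideal_def by blast
  then show "f \<in> p" by (simp add: n0)
next
  assume f: "f \<in> p"
  have "component n i j (E f * 1) \<in> p" if "i < n" "j < n" for i j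
    unfolding component_stretch2_mult[OF n0 that] using f by (rule is_idealD(4)[OF p])
  then show "E f \<in> lift_ideal p" by (simp add: lift_ideal_def)
qed

lemma ideal_lift_ideal:
  assumes p: "is_ideal p"
  shows "ideal (lift_ideal p) (qplane q)"
  unfolding ideal_iff'
proof (intro conjI ballI allI)
  note D = is_idealD[OF p]
  show "0 \<in> lift_ideal p" by (simp add: lift_ideal_def n0 D)
  show add: "a + b \<in> lift_ideal p" if "a \<in> lift_ideal p" "b \<in> lift_ideal p" for a b
    using that by (simp add: lift_ideal_def n0 component_add D)
  fix r a assume a: "a \<in> lift_ideal p"
  show "r \<star> a \<in> lift_ideal p" "a \<star> r \<in> lift_ideal p"
    \<comment> \<open>In the product form absorption is visible, because the central factor
      \<open>z\<close> slides past \<open>r\<close>.\<close>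
    using a unfolding lift_ideal_eq_prod[OF p, symmetric]
  proof induction
    case (prod b z)
    then obtain f where f: "f \<in> p" "z = E f" by blast
    have "r \<star> (b \<star> z) = (r \<star> b) \<star> z" "(b \<star> z) \<star> r = (b \<star> r) \<star> z"
    proof -
      show "r \<star> (b \<star> z) = (r \<star> b) \<star> z" by (rule A.m_assoc[symmetric]) simp_all
      have "(b \<star> z) \<star> r = b \<star> (z \<star> r)" by (rule A.m_assoc) simp_all
      also have "z \<star> r = r \<star> z" by (simp add: f mult.commute)
      also have "b \<star> (r \<star> z) = (b \<star> r) \<star> z" by (rule A.m_assoc[symmetric]) simp_all
      finally show "(b \<star> z) \<star> r = (b \<star> r) \<star> z" .
    qed
    moreover have "c \<star> z \<in> ideal_prod (qplane q) UNIV (E ` p)" for c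
      using prod by (intro ideal_prod.prod) auto
    ultimately show "r \<star> (b \<star> z) \<in> ideal_prod (qplane q) UNIV (E ` p)"
      "(b \<star> z) \<star> r \<in> ideal_prod (qplane q) UNIV (E ` p)" by simp_all
  next
    case (sum a b)
    have "r \<star> (a \<oplus>\<^bsub>qplane q\<^esub> b) = r \<star> a \<oplus>\<^bsub>qplane q\<^esub> r \<star> b"
      "(a \<oplus>\<^bsub>qplane q\<^esub> b) \<star> r = a \<star> r \<oplus>\<^bsub>qplane q\<^esub> b \<star> r"
      by (rule A.r_distr A.l_distr; simp)+
    then show "r \<star> (a \<oplus>\<^bsub>qplane q\<^esub> b) \<in> ideal_prod (qplane q) UNIV (E ` p)"
      "(a \<oplus>\<^bsub>qplane q\<^esub> b) \<star> r \<in> ideal_prod (qplane q) UNIV (E ` p)"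
      using sum ideal_prod.sum by metis+
  qed
qed

text \<open>Each of 1, \<open>h\<close>, \<open>x\<close> has a coordinate equal to 1. For
  \<open>h\<close> and \<open>x\<close> it sits at residue 1, which is below \<open>n\<close>
  because \<open>n\<close> is at least 2.\<close>

lemma gens_notin_lift_ideal:
  assumes p: "is_ideal p" "1 \<notin> p"
  shows "1 \<notin> lift_ideal p" "gen_h \<notin> lift_ideal p" "gen_x \<notin> lift_ideal p"
proof -
  have "component n 0 0 1 = (1 :: 'k poly poly)" using component_stretch2[OF n0, of 1] by (simp add: n0)
  moreover have "component n 0 1 gen_h = (1 :: 'k poly poly)" "component n 1 0 gen_x = (1 :: 'k poly poly)"
    using n2 by (auto simp: poly_eq_iff coeff_component n0 gen_h_def gen_x_def coeff_pCons
      one_pCons split: nat.splits)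
  moreover have "component n i j a \<in> p" if "a \<in> lift_ideal p" "i < n" "j < n" for i j a
    using that unfolding lift_ideal_def by blast
  note this[of 1 0 0] this[of gen_h 0 1] this[of gen_x 1 0]
  ultimately show "1 \<notin> lift_ideal p" "gen_h \<notin> lift_ideal p" "gen_x \<notin> lift_ideal p"
    using p n2 by auto
qed

lemma lift_ideal_mono_iff:
  assumes "is_ideal p" "is_ideal p'"
  shows "lift_ideal p \<subseteq> lift_ideal p' \<longleftrightarrow> p \<subseteq> p'"
proof
  assume "lift_ideal p \<subseteq> lift_ideal p'"
  then show "p \<subseteq> p'" using assms E_in_lift_ideal_iff by blast
qed (auto simp: lift_ideal_def)

text \<open>Regularity puts the central coordinates of each element into \<open>I\<close>;
  conversely these coordinates times the basis elements rebuild the element inside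
  \<open>I\<close>.\<close>

lemma regular_ideal_eq_lift_ideal:
  assumes I: "ideal I (qplane q)"
    and s: "\<And>a. E [:[:0, 1:]:] * a \<in> I \<Longrightarrow> a \<in> I" and t: "\<And>a. E [:0, 1:] * a \<in> I \<Longrightarrow> a \<in> I"
  shows "I = lift_ideal (E -` I)" "is_ideal (E -` I)"
proof
  show id: "is_ideal (E -` I)"
    unfolding is_ideal_def using idealD(1,2,5)[OF I] by (simp add: n0)
  show "I \<subseteq> lift_ideal (E -` I)"
    using regular_ideal_component[OF I s t] by (auto simp: lift_ideal_def)
  show "lift_ideal (E -` I) \<subseteq> I"
  proof
    fix a assume "a \<in> lift_ideal (E -` I)"
    then have "E (component n i j a) * b \<in> I" if "i < n" "j < n" for i j b
      using that by (intro idealD(7)[OF I]) (simp add: lift_ideal_def)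
    then have "(\<Sum>i<n. \<Sum>j<n. E (component n i j a) * monom (monom 1 j) i) \<in> I"
      by (intro ideal_sum[OF I]) simp
    then show "a \<in> I" by (simp add: sum_components n0)
  qed
qed

section \<open>Primes containing neither h nor x\<close>

lemma Spec_iff':
  "P \<in> Spec (qplane q) \<longleftrightarrow> ideal P (qplane q) \<and> 1 \<notin> P \<and>
    (\<forall>a b. (\<forall>r. a \<star> r \<star> b \<in> P) \<longrightarrow> a \<in> P \<or> b \<in> P)"
  by (simp add: A.Spec_iff)

text \<open>Coordinates of a skew product are hard to relate to those of its factors. So
  \<open>regular_ideal_component\<close> is applied to the transporter \<open>I\<close> of
  \<open>b\<close>: it contains the central coordinates of \<open>a\<close>, and a central factor
  acts on \<open>b\<close> coordinatewise, where primality of \<open>p\<close> applies.\<close>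

lemma lift_ideal_in_Spec:
  assumes p: "is_prime_ideal p" and s: "[:[:0, 1:]:] \<notin> p" and t: "[:0, 1:] \<notin> p"
  shows "lift_ideal p \<in> Spec (qplane q)"
  unfolding Spec_iff'
proof (intro conjI allI impI)
  note pD = is_prime_idealD[OF p]
  show L: "ideal (lift_ideal p) (qplane q)" by (rule ideal_lift_ideal[OF pD(1)])
  show "1 \<notin> lift_ideal p" by (rule gens_notin_lift_ideal[OF pD(1,2)])
  have reg: "a \<in> lift_ideal p" if "E f * a \<in> lift_ideal p" "f \<notin> p" for a f
    using that pD(3) by (auto simp: lift_ideal_def n0 component_stretch2_mult)
  fix a b assume ab: "\<forall>r. a \<star> r \<star> b \<in> lift_ideal p"
  show "a \<in> lift_ideal p \<or> b \<in> lift_ideal p"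
  proof (rule disjCI)
    assume b: "b \<notin> lift_ideal p"
    then obtain k l where kl: "k < n" "l < n" "component n k l b \<notin> p" by (auto simp: lift_ideal_def)
    define I where "I = {a. \<forall>r. a \<star> r \<star> b \<in> lift_ideal p}"
    have I: "ideal I (qplane q)"
      using A.ideal_transporter[OF L, of b] by (simp add: I_def)
    \<comment> \<open>Elements outside \<open>p\<close> are regular modulo
      \<open>lift_ideal p\<close>, and the transporter inherits this.\<close>
    have I_reg: "a \<in> I" if "E f * a \<in> I" "f \<notin> p" for a f
    proof -
      have "E f * (a \<star> r \<star> b) = (E f * a) \<star> r \<star> b" for r
        using A.m_assoc[of "E f" a r] A.m_assoc[of "E f" "a \<star> r" b] by simp
      then have "E f * (a \<star> r \<star> b) \<in> lift_ideal p" for r using that(1) unfolding I_def by simp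
      then show ?thesis using reg that(2) unfolding I_def by blast
    qed
    have aI: "a \<in> I" unfolding I_def using ab by blast
    have "component n i j a \<in> p" if ij: "i < n" "j < n" for i j
    proof -
      have "E (component n i j a) \<in> I"
        by (rule regular_ideal_component[OF I I_reg[OF _ s] I_reg[OF _ t] aI ij])
      then have "E (component n i j a) \<star> 1 \<star> b \<in> lift_ideal p" unfolding I_def by blast
      then have "E (component n i j a) * b \<in> lift_ideal p" by (simp add: one_pCons[symmetric])
      then show ?thesis using reg b by blast
    qed
    then show "a \<in> lift_ideal p" by (simp add: lift_ideal_def)
  qed
qed

text \<open>The inverses are the twists by \<open>1 / q\<close>. Hence \<open>h A = A h\<close> and
  \<open>x A = A x\<close>.\<close>

lemma twist_surj: "\<exists>r'. r = twist_h q r'" "\<exists>r'. r = twist_x q r'"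
proof -
  have "r = twist_h q (twist_h (1 / q) r)"
    using q0 by (simp add: poly_eq_iff coeff_twist_h power_divide)
  then show "\<exists>r'. r = twist_h q r'" ..
  have "r = twist_x q (twist_x (1 / q) r)"
    using q0 by (simp add: poly_eq_iff coeff_twist_x power_divide)
  then show "\<exists>r'. r = twist_x q r'" ..
qed

text \<open>Since \<open>h A = A h\<close> and \<open>x A = A x\<close>, a prime ideal not containing \<open>h\<close> or \<open>x\<close> has that element
  regular modulo it.\<close>

lemma Spec_regular:
  assumes P: "P \<in> Spec (qplane q)"
  shows "gen_h \<notin> P \<Longrightarrow> E [:[:0, 1:]:] * a \<in> P \<Longrightarrow> a \<in> P"
    and "gen_x \<notin> P \<Longrightarrow> E [:0, 1:] * a \<in> P \<Longrightarrow> a \<in> P"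
proof -
  have s_eq: "E [:[:0, 1:]:] = [:monom 1 n:]" and t_eq: "E [:0, 1:] = monom 1 n"
    by (simp_all add: stretch2_def stretch_pCons map_poly_pCons n0)
  have I: "ideal P (qplane q)" using P Spec_iff' by blast
  have pr: "a \<in> P \<or> b \<in> P" if "\<And>r. a \<star> r \<star> b \<in> P" for a b
    using P that unfolding Spec_iff' by blast
  {
    assume h: "gen_h \<notin> P"
    have step: "b \<in> P" if b: "gen_h * b \<in> P" for b
    proof -
      have "gen_h \<star> r \<star> b \<in> P" for r
      proof -
        obtain r' where "r = twist_h q r'" using twist_surj by blast
        then have "gen_h \<star> r \<star> b = r' \<star> gen_h \<star> b" by (simp add: qmult_gen_h)
        also have "\<dots> = r' \<star> (gen_h * b)" using A.m_assoc[of r' gen_h b] by simp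
        finally show ?thesis using idealD(3)[OF I b] by simp
      qed
      then show ?thesis using pr h by blast
    qed
    have "[:monom 1 k:] * b \<in> P \<Longrightarrow> b \<in> P" for b k
    proof (induction k)
      case (Suc k)
      have "[:monom 1 (Suc k):] * b = gen_h * ([:monom 1 k:] * b)"
        by (simp add: gen_h_def monom_Suc)
      then show ?case using Suc step by metis
    qed (simp add: one_pCons[symmetric])
    then show "E [:[:0, 1:]:] * a \<in> P \<Longrightarrow> a \<in> P" unfolding s_eq by blast
  next
    assume x: "gen_x \<notin> P"
    have step: "b \<in> P" if b: "b * gen_x \<in> P" for b
    proof -
      have "b \<star> r \<star> gen_x \<in> P" for r
      proof -
        obtain r' where "r = twist_x q r'" using twist_surj by blast
        then have r: "r \<star> gen_x = gen_x \<star> r'" by (simp add: gen_x_qmult)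
        have "b \<star> r \<star> gen_x = b \<star> (gen_x \<star> r')" using A.m_assoc[of b r gen_x] r by simp
        also have "\<dots> = (b * gen_x) \<star> r'" using A.m_assoc[of b gen_x r'] by simp
        finally show ?thesis using idealD(4)[OF I b] by simp
      qed
      then show ?thesis using pr x by blast
    qed
    have "b * monom 1 k \<in> P \<Longrightarrow> b \<in> P" for b k
    proof (induction k)
      case (Suc k)
      have "b * monom 1 (Suc k) = (b * monom 1 k) * gen_x"
        by (simp add: gen_x_def monom_Suc)
      then show ?case using Suc step by metis
    qed simp
    then show "E [:0, 1:] * a \<in> P \<Longrightarrow> a \<in> P" unfolding t_eq by (simp add: mult.commute)
  }
qed

text \<open>The contraction to the centre stays prime because for central factors every test product
  is a multiple of \<open>E (f * g)\<close>.\<close>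

lemma Spec_eq_lift_ideal:
  assumes P: "P \<in> Spec (qplane q)" and h: "gen_h \<notin> P" and x: "gen_x \<notin> P"
  shows "P = lift_ideal (E -` P)" "is_prime_ideal (E -` P)" "[:[:0, 1:]:] \<notin> E -` P" "[:0, 1:] \<notin> E -` P"
proof -
  have I: "ideal P (qplane q)" and P1: "1 \<notin> P"
    and pr: "\<And>a b. (\<And>r. a \<star> r \<star> b \<in> P) \<Longrightarrow> a \<in> P \<or> b \<in> P"
    using P unfolding Spec_iff' by blast+
  note eq = regular_ideal_eq_lift_ideal[OF I Spec_regular(1)[OF P h] Spec_regular(2)[OF P x]]
  show "P = lift_ideal (E -` P)" by (rule eq)
  have "f \<in> E -` P \<or> g \<in> E -` P" if "f * g \<in> E -` P" for f g
  proof -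
    have fg: "E (f * g) \<in> P" using that by simp
    have "E f \<star> r \<star> E g = E f * E g * r" for r by (simp only: E_qmult qmult_E mult_ac)
    then have "E f \<star> r \<star> E g = E (f * g) * r" for r by (simp only: stretch2_simps[OF n0])
    then have "E f \<star> r \<star> E g \<in> P" for r by (metis idealD(7)[OF I fg])
    then show ?thesis using pr by blast
  qed
  then show "is_prime_ideal (E -` P)" using eq(2) P1 by (simp add: is_prime_ideal_def n0)
  show "[:[:0, 1:]:] \<notin> E -` P" "[:0, 1:] \<notin> E -` P"
    using Spec_regular(1)[OF P h, of 1] Spec_regular(2)[OF P x, of 1] P1 by auto
qed

lemma nonzero_ideal_meets_centre:
  assumes I: "ideal I (qplane q)" and nz: "I \<noteq> {0}"
  shows "I \<inter> centre (qplane q) \<noteq> {0}"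
proof -
  define st where "st = [:[:0, 1:]:] * [:0, 1 :: 'k poly:]"
  \<comment> \<open>Saturating by the product s t makes both factors regular with a single
    exponent.\<close>
  define J where "J = {a. \<exists>k. E (st ^ k) * a \<in> I}"
  have le: "E (st ^ (k + m)) * a \<in> I" if "E (st ^ k) * a \<in> I" for k m a
    using idealD(5)[OF I that, of "st ^ m"] by (simp add: power_add n0 mult_ac)
  have J: "ideal J (qplane q)"
    unfolding ideal_iff'
  proof (intro conjI ballI allI)
    show "0 \<in> J" unfolding J_def using idealD(1)[OF I] by simp
    fix a b assume "a \<in> J" "b \<in> J"
    then obtain k m where "E (st ^ k) * a \<in> I" "E (st ^ m) * b \<in> I" unfolding J_def by blast
    then have "E (st ^ (k + m)) * a \<in> I" "E (st ^ (k + m)) * b \<in> I"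
      using le[of k a m] le[of m b k] by (simp_all add: add.commute)
    then have "E (st ^ (k + m)) * (a + b) \<in> I" using idealD(2)[OF I] by (simp add: distrib_left)
    then show "a + b \<in> J" unfolding J_def by blast
  next
    fix r a assume "a \<in> J"
    then obtain k where k: "E (st ^ k) * a \<in> I" unfolding J_def by blast
    have "E (st ^ k) * (a \<star> r) = (E (st ^ k) * a) \<star> r"
      using A.m_assoc[of "E (st ^ k)" a r] by simp
    then show "a \<star> r \<in> J" unfolding J_def using idealD(4)[OF I k] by (metis (mono_tags) mem_Collect_eq)
    have "E (st ^ k) * (r \<star> a) = (E (st ^ k) \<star> r) \<star> a"
      using A.m_assoc[of "E (st ^ k)" r a] by simp
    also have "\<dots> = (r \<star> E (st ^ k)) \<star> a" by (simp add: mult.commute)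
    also have "\<dots> = r \<star> (E (st ^ k) * a)" using A.m_assoc[of r "E (st ^ k)" a] by simp
    finally show "r \<star> a \<in> J" unfolding J_def using idealD(3)[OF I k] by (metis (mono_tags) mem_Collect_eq)
  qed
  \<comment> \<open>Here \<open>f\<close> is one of s, t and \<open>g\<close> is the other, so
    \<open>E g\<close> raises the exponent by one.\<close>
  have reg: "a \<in> J" if a: "E f * a \<in> J" and fg: "g * f = st" for a f g
  proof -
    obtain k where k: "E (st ^ k) * (E f * a) \<in> I" using a unfolding J_def by blast
    have "E g * (E (st ^ k) * (E f * a)) \<in> I" by (rule idealD(5)[OF I k])
    also have "E g * (E (st ^ k) * (E f * a)) = E (st ^ Suc k) * a"
      by (simp add: fg[symmetric] n0 mult_ac)
    finally show ?thesis unfolding J_def by blast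
  qed
  have "a \<in> J" if "E [:[:0, 1:]:] * a \<in> J" for a
    using reg[OF that, of "[:0, 1:]"] by (simp add: st_def)
  moreover have "a \<in> J" if "E [:0, 1:] * a \<in> J" for a
    using reg[OF that, of "[:[:0, 1:]:]"] by (simp add: st_def)
  ultimately have Jeq: "J = lift_ideal (E -` J)" by (rule regular_ideal_eq_lift_ideal[OF J])
  have IJ: "I \<subseteq> J" unfolding J_def by (auto intro: exI[of _ 0] simp: n0)
  have "\<exists>f. E f \<in> J \<and> f \<noteq> 0"
  proof (rule ccontr)
    assume "\<nexists>f. E f \<in> J \<and> f \<noteq> 0"
    then have "E -` J = {0}" using idealD(1)[OF J] by (auto simp: n0)
    have "a = 0" if "a \<in> I" for a
    proof -
      have "a \<in> lift_ideal {0}" using that IJ Jeq \<open>E -` J = {0}\<close> by auto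
      then have "(\<Sum>i<n. \<Sum>j<n. E (component n i j a) * monom (monom 1 j) i) = 0"
        by (simp add: lift_ideal_def n0)
      then show ?thesis by (simp add: sum_components n0)
    qed
    then show False using nz idealD(1)[OF I] by auto
  qed
  then obtain f where f: "E f \<in> J" "f \<noteq> 0" by blast
  \<comment> \<open>A power of s t carries this element of the saturation back into
    \<open>I\<close>.\<close>
  then obtain k where k: "E (st ^ k) * E f \<in> I" unfolding J_def by blast
  then have "E (st ^ k * f) \<in> I" by (simp add: n0)
  moreover have "st ^ k * f \<noteq> 0" using f by (simp add: st_def)
  then have "E (st ^ k * f) \<noteq> 0" using inj_stretch2[OF n0] stretch2_simps(1)[OF n0] by (metis injD)
  ultimately show ?thesis unfolding centre_eq by auto
qed

end

context quantum_plane_at_root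
begin

section \<open>The centre and the subalgebras generated by \<open>h\<close> and by \<open>x\<close>\<close>

text \<open>The range of \<open>f\<close> is a subring that contains the generators and lies in the
  generated subring, so the two coincide.\<close>

lemma type_ring_iso_subalg:
  fixes f :: "'r::comm_ring_1 \<Rightarrow> 'k poly poly"
  assumes inj: "inj f" and add: "\<And>a b. f (a + b) = f a + f b"
    and mult: "\<And>a b. f (a * b) = f a \<star> f b" and one: "f 1 = 1"
    and gens: "range scalar \<union> S \<subseteq> range f"
    and generated: "range f \<subseteq> generate_ring (qplane q) (range scalar \<union> S)"
  shows "type_ring_iso (subalg q S) f" "carrier (subalg q S) = range f"
proof -
  have "a \<in> range f" if "a \<in> generate_ring (qplane q) (range scalar \<union> S)" for a
    using that
  proof induction
    case one
    then show ?case using assms(4) by (metis qplane_simps(3) rangeI)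
  next
    case (a_inv a)
    then obtain b where b: "a = f b" by blast
    have "f 0 = 0" using add[of 0 0] by (metis add.right_neutral add_left_cancel)
    then have "f (- b) + a = 0" using add[of "- b" b] b by simp
    then have "\<ominus>\<^bsub>qplane q\<^esub> a = f (- b)" by (intro A.minus_equality) simp_all
    then show ?case by simp
  next
    case (eng_add a b)
    then obtain c d where "a = f c" "b = f d" by blast
    then have "a \<oplus>\<^bsub>qplane q\<^esub> b = f (c + d)" by (simp add: add)
    then show ?case by blast
  next
    case (eng_mult a b)
    then obtain c d where "a = f c" "b = f d" by blast
    then have "a \<star> b = f (c * d)" by (simp add: mult)
    then show ?case by blast
  qed (use gens in blast)
  then show carrier: "carrier (subalg q S) = range f"
    using generated by (auto simp: subalg_def)
  have "ring (subalg q S)"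
    unfolding subalg_def by (rule A.generate_ring_is_ring) simp
  moreover have "f \<in> ring_iso ring_of_type_algebra (subalg q S)"
    unfolding ring_iso_def ring_hom_def carrier bij_betw_def
    using inj by (auto simp: ring_of_type_algebra_def subalg_def add mult one)
  ultimately show "type_ring_iso (subalg q S) f"
    by (intro type_ring_iso.intro type_ring_iso_axioms.intro)
qed

text \<open>With \<open>inj_stretch2\<close> this expresses that s and t are algebraically
  independent over \<open>K\<close>.\<close>

lemma eval_st_eq: "eval_st q n = E"
proof
  fix f
  have s: "elt_s q n [^]\<^bsub>qplane q\<^esub> j = E ([:[:0, 1:]:] ^ j)" for j :: nat
    by (induction j) (simp_all only: elt_s_eq A.nat_pow_0 A.nat_pow_Suc qmult_E qplane_simps power_0
      power_Suc2 stretch2_simps[OF n0])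
  have t: "elt_t q n [^]\<^bsub>qplane q\<^esub> j = E ([:0, 1:] ^ j)" for j :: nat
    by (induction j) (simp_all only: elt_t_eq A.nat_pow_0 A.nat_pow_Suc qmult_E qplane_simps power_0
      power_Suc2 stretch2_simps[OF n0])
  have E_sum: "E (sum g S) = (\<Sum>i\<in>S. E (g i))" for g and S :: "nat set"
    by (induction S rule: infinite_finite_induct) (simp_all add: n0)
  have sc: "scalar c = E (scalar c)" for c
    by (simp add: scalar_def stretch2_def map_poly_pCons n0)
  have mon: "scalar c * ([:[:0, 1:]:] ^ j * [:0, 1:] ^ i) = monom (monom c j) i" for c :: 'k and i j
    by (simp add: scalar_def monom_altdef poly_const_pow smult_monom mult_ac)
  have summand: "scalar c \<star> (E ([:[:0, 1:]:] ^ j) \<star> E ([:0, 1:] ^ i)) = E (monom (monom c j) i)"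
    for c i j
    by (subst sc) (simp only: E_qmult stretch2_simps(4)[OF n0, symmetric] mon)
  have "eval_st q n f = E (\<Sum>i\<le>degree f. \<Sum>j\<le>degree (coeff f i). monom (monom (coeff (coeff f i) j) j) i)"
    unfolding eval_st_def s t E_sum summand ..
  also have "(\<Sum>i\<le>degree f. \<Sum>j\<le>degree (coeff f i). monom (monom (coeff (coeff f i) j) j) i) = f"
    by (simp add: poly_as_sum_of_monoms flip: monom_sum)
  finally show "eval_st q n f = E f" .
qed

text \<open>Every central element is a value of \<open>eval_st\<close>, hence visibly a polynomial
  expression in the generators.\<close>

lemma centre_iso:
  "type_ring_iso (subalg q {elt_s q n, elt_t q n}) E" "Z_ring q = subalg q {elt_s q n, elt_t q n}"
proof -
  define G where "G = generate_ring (qplane q) (range scalar \<union> {elt_s q n, elt_t q n})"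
  have z: "0 \<in> G" using A.zero_in_generate by (simp add: G_def)
  have add: "a + b \<in> G" and mult: "a \<star> b \<in> G" if "a \<in> G" "b \<in> G" for a b
    using generate_ring.eng_add[OF that[unfolded G_def]] generate_ring.eng_mult[OF that[unfolded G_def]]
    by (simp_all add: G_def)
  have pow: "a [^]\<^bsub>qplane q\<^esub> k \<in> G" if "a \<in> G" for a and k :: nat
  proof (induction k)
    case 0
    show ?case unfolding A.nat_pow_0 G_def by (rule generate_ring.one)
  next
    case (Suc k)
    show ?case unfolding A.nat_pow_Suc by (rule mult[OF Suc that])
  qed
  have sum: "sum g S \<in> G" if "\<And>i. i \<in> S \<Longrightarrow> g i \<in> G" for g and S :: "nat set"
    using that by (induction S rule: infinite_finite_induct) (auto simp: z add)
  have gens: "scalar c \<in> G" "elt_s q n \<in> G" "elt_t q n \<in> G" for c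
    unfolding G_def by (auto intro: generate_ring.incl)
  have "eval_st q n f \<in> G" for f
    unfolding eval_st_def by (intro sum mult pow gens)
  then have gen: "range E \<subseteq> generate_ring (qplane q) (range scalar \<union> {elt_s q n, elt_t q n})"
    by (auto simp: eval_st_eq G_def)
  have "scalar c = E (scalar c)" for c
    by (simp add: scalar_def stretch2_def map_poly_pCons n0)
  then have "range scalar \<union> {elt_s q n, elt_t q n} \<subseteq> range E"
    by (auto simp: elt_s_eq elt_t_eq)
  note iso = type_ring_iso_subalg[OF inj_stretch2[OF n0] _ _ _ this gen]
  show "type_ring_iso (subalg q {elt_s q n, elt_t q n}) E"
    by (rule iso) (simp_all add: n0)
  have "carrier (subalg q {elt_s q n, elt_t q n}) = range E"
    by (rule iso) (simp_all add: n0)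
  then show "Z_ring q = subalg q {elt_s q n, elt_t q n}"
    by (simp add: Z_ring_def centre_eq subalg_def)
qed

sublocale Z: type_ring_iso "Z_ring q" E
  using centre_iso by simp

lemma subalg_h_iso: "type_ring_iso (subalg q {gen_h}) (\<lambda>p. [:p:])"
proof (rule type_ring_iso_subalg)
  let ?G = "generate_ring (qplane q) (range scalar \<union> {gen_h})"
  have "[:p:] \<in> ?G" for p
  proof (induction p)
    case 0
    then show ?case using A.zero_in_generate by simp
  next
    case (pCons a p)
    have "[:pCons a p:] = scalar a \<oplus>\<^bsub>qplane q\<^esub> (gen_h \<star> [:p:])" by (simp add: scalar_def gen_h_def)
    also have "\<dots> \<in> ?G" using pCons by (intro generate_ring.eng_add generate_ring.eng_mult)
        (auto intro: generate_ring.incl)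
    finally show ?case .
  qed
  then show "range (\<lambda>p. [:p:]) \<subseteq> ?G" by blast
qed (auto simp: inj_on_def scalar_def gen_h_def one_pCons mult.commute)

lemma const_coeffs_simps:
  "map_poly (\<lambda>c. [:c:]) (a + b) = map_poly (\<lambda>c. [:c:]) a + map_poly (\<lambda>c. [:c:]) (b :: 'k poly)"
  "map_poly (\<lambda>c. [:c:]) (a * b) = map_poly (\<lambda>c. [:c:]) a * map_poly (\<lambda>c. [:c:]) (b :: 'k poly)"
proof -
  have "(\<Sum>i\<in>S. [:u i:]) = [:sum u S:]" for u :: "nat \<Rightarrow> 'k" and S
    by (induction S rule: infinite_finite_induct) simp_all
  then show "map_poly (\<lambda>c. [:c:]) (a + b) = map_poly (\<lambda>c. [:c:]) a + map_poly (\<lambda>c. [:c:]) b"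
    "map_poly (\<lambda>c. [:c:]) (a * b) = map_poly (\<lambda>c. [:c:]) a * map_poly (\<lambda>c. [:c:]) b"
    by (simp_all add: poly_eq_iff[of "map_poly _ _"] coeff_map_poly coeff_mult mult.commute)
qed

lemma subalg_x_iso: "type_ring_iso (subalg q {gen_x}) (map_poly (\<lambda>c. [:c:]))"
proof (rule type_ring_iso_subalg)
  let ?G = "generate_ring (qplane q) (range scalar \<union> {gen_x})"
  have "map_poly (\<lambda>c. [:c:]) p \<in> ?G" for p
  proof (induction p)
    case 0
    then show ?case using A.zero_in_generate by simp
  next
    case (pCons a p)
    have "map_poly (\<lambda>c. [:c:]) (pCons a p) =
        scalar a \<oplus>\<^bsub>qplane q\<^esub> (map_poly (\<lambda>c. [:c:]) p \<star> gen_x)"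
      unfolding qmult_gen_x by (simp add: scalar_def gen_x_def map_poly_pCons)
    also have "\<dots> \<in> ?G" using pCons by (intro generate_ring.eng_add generate_ring.eng_mult)
        (auto intro: generate_ring.incl)
    finally show ?case .
  qed
  then show "range (map_poly (\<lambda>c. [:c:])) \<subseteq> ?G" by blast
  show "inj (map_poly (\<lambda>c. [:c:] :: 'k poly))"
  proof (rule injI, rule poly_eqI)
    fix a b :: "'k poly" and i
    assume "map_poly (\<lambda>c. [:c:]) a = map_poly (\<lambda>c. [:c:]) b"
    then have "coeff (coeff (map_poly (\<lambda>c. [:c:]) a) i) 0 = coeff (coeff (map_poly (\<lambda>c. [:c:]) b) i) 0"
      by simp
    then show "coeff a i = coeff b i" by (simp add: coeff_map_poly)
  qed
  have "scalar c = map_poly (\<lambda>c. [:c:]) [:c:]" for c :: 'k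
    by (simp add: scalar_def map_poly_pCons)
  moreover have "gen_x = map_poly (\<lambda>c. [:c:]) [:0, 1 :: 'k:]"
    by (simp add: gen_x_def map_poly_pCons one_pCons)
  ultimately show "range scalar \<union> {gen_x} \<subseteq> range (map_poly (\<lambda>c. [:c:] :: 'k poly))" by auto
  fix a b :: "'k poly"
  have "map_poly (\<lambda>c. [:c:]) a \<star> map_poly (\<lambda>c. [:c:]) b = map_poly (\<lambda>c. [:c:]) a * map_poly (\<lambda>c. [:c:]) b"
    by (rule qmult_eq_mult_right) (simp add: coeff_map_poly)
  then show "map_poly (\<lambda>c. [:c:]) (a * b) = map_poly (\<lambda>c. [:c:]) a \<star> map_poly (\<lambda>c. [:c:]) b"
    by (simp add: const_coeffs_simps)
qed (simp_all add: const_coeffs_simps one_pCons map_poly_pCons)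

end

section \<open>Prime ideals containing \<open>x\<close> or \<open>h\<close>\<close>

text \<open>Models the quotient by \<open>(g)\<close>, once for \<open>g = x\<close>,
  \<open>g' = h\<close> and once for \<open>g = h\<close>, \<open>g' = x\<close>: \<open>pr\<close>
  is the quotient map onto a polynomial ring in \<open>g'\<close>, and \<open>\<iota>\<close> splits
  it through the subalgebra generated by \<open>g'\<close>.\<close>

locale qplane_projection = quantum_plane_at_root +
  fixes pr :: "'a poly poly \<Rightarrow> 'a poly" and \<iota> :: "'a poly \<Rightarrow> 'a poly poly" and g g' :: "'a poly poly"
  assumes pr_add: "pr (a + b) = pr a + pr b" and pr_mult: "pr (a \<star> b) = pr a * pr b"
    and pr_iota: "pr (\<iota> p) = p" and pr_g: "pr g = 0"
    and kernel: "pr a = 0 \<Longrightarrow> a \<in> Idl\<^bsub>qplane q\<^esub> {g}"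
    and iota_iso: "type_ring_iso (subalg q {g'}) \<iota>" and iota_X: "\<iota> [:0, 1:] = g'"
begin

sublocale sub: type_ring_iso "subalg q {g'}" \<iota>
  by (rule iota_iso)

lemma pr_0: "pr 0 = 0"
  using pr_add[of 0 0] by (metis add.right_neutral add_left_cancel)

lemma pr_g': "pr g' = [:0, 1:]"
  using pr_iota iota_X by metis

lemma pr_1: "pr 1 = 1"
  using pr_iota[of 1] pr_mult[of "\<iota> 1" 1] A.r_one[of "\<iota> 1"] by simp

lemma ideal_vimage: "ideal (pr -` Q) (qplane q)" if "is_ideal Q" for Q
  using is_idealD(1-4)[OF that] by (simp add: ideal_iff' pr_0 pr_add pr_mult)

text \<open>The correspondence of ideals for a quotient; the splitting provides the ideal of the
  quotient as a preimage.\<close>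

lemma ideal_eq_vimage:
  assumes I: "ideal I (qplane q)" and g: "g \<in> I"
  shows "I = pr -` (\<iota> -` I)" "is_ideal (\<iota> -` I)"
proof -
  have sub: "Idl\<^bsub>qplane q\<^esub> {g} \<subseteq> I" using A.genideal_minimal[OF I] g by simp
  have minus: "b - c \<in> I" if "b \<in> I" "c \<in> I" for b c
    using idealD(2)[OF I that(1) idealD(6)[OF I that(2), of "-1"]] by simp
  \<comment> \<open>The kernel of \<open>pr\<close> lies in \<open>I\<close>, so membership depends
    only on the value of \<open>pr\<close>.\<close>
  have key: "a \<in> I \<longleftrightarrow> b \<in> I" if "pr a = pr b" for a b
  proof -
    have "pr (a - b) = 0" using pr_add[of "a - b" b] that by simp
    then have d: "a - b \<in> I" using kernel sub by blast
    show ?thesis using idealD(2)[OF I d, of b] minus[OF _ d, of a] by auto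
  qed
  show "I = pr -` (\<iota> -` I)" using key[of _ "\<iota> (pr _)"] by (auto simp: pr_iota)
  show "is_ideal (\<iota> -` I)"
    unfolding is_ideal_def
  proof (intro conjI ballI allI)
    show "0 \<in> \<iota> -` I" using key[of "\<iota> 0" 0] idealD(1)[OF I] by (simp add: pr_iota pr_0)
    show "a + b \<in> \<iota> -` I" if "a \<in> \<iota> -` I" "b \<in> \<iota> -` I" for a b
      using key[of "\<iota> (a + b)" "\<iota> a + \<iota> b"] idealD(2)[OF I] that by (simp add: pr_iota pr_add)
    show "r * a \<in> \<iota> -` I" if "a \<in> \<iota> -` I" for r a
      using key[of "\<iota> (r * a)" "\<iota> r \<star> \<iota> a"] idealD(3)[OF I] that by (simp add: pr_iota pr_mult)
  qed
qed

lemma vimage_subset_iff: "pr -` Q \<subseteq> pr -` Q' \<longleftrightarrow> Q \<subseteq> Q'"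
  using pr_iota by (metis subsetI subsetD vimageE vimageI2 vimage_mono)

lemma vimage_eq_iff: "pr -` Q = pr -` Q' \<longleftrightarrow> Q = Q'"
  using vimage_subset_iff[of Q Q'] vimage_subset_iff[of Q' Q] by auto

lemma vimage_in_Spec_iff: "pr -` Q \<in> Spec (qplane q) \<longleftrightarrow> is_prime_ideal Q" if Q: "is_ideal Q"
proof -
  have surj: "(\<forall>a. R (pr a)) \<longleftrightarrow> (\<forall>a. R a)" for R using pr_iota by metis
  have surj2: "(\<forall>a b. R (pr a) (pr b)) \<longleftrightarrow> (\<forall>a b. R a b)" for R using pr_iota by metis
  have "(\<forall>r. a * r * b \<in> Q) \<longleftrightarrow> a * b \<in> Q" for a b
    using is_idealD(3)[OF Q, of "a * b"] by (auto simp: algebra_simps dest: spec[of _ 1])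
  then have "(\<forall>r. pr (a \<star> r \<star> b) \<in> Q) \<longleftrightarrow> pr a * pr b \<in> Q" for a b
    unfolding pr_mult surj[of "\<lambda>r. pr a * r * pr b \<in> Q"] by simp
  then show ?thesis
    unfolding Spec_iff' is_prime_ideal_def using ideal_vimage[OF Q] Q
      surj2[of "\<lambda>a b. a * b \<in> Q \<longrightarrow> a \<in> Q \<or> b \<in> Q"]
    by (simp add: pr_1)
qed

lemma Spec_containing:
  assumes P: "P \<in> Spec (qplane q)" "g \<in> P"
  obtains Q where "is_prime_ideal Q" "P = pr -` Q"
proof -
  have "ideal P (qplane q)" using P(1) by (simp add: Spec_iff')
  note eq = ideal_eq_vimage[OF this P(2)]
  then have "is_prime_ideal (\<iota> -` P)" using vimage_in_Spec_iff[OF eq(2)] P(1) by simp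
  then show ?thesis using that eq(1) by blast
qed

lemma maximal_vimage:
  assumes Q: "is_maximal_ideal Q"
  shows "pr -` Q \<in> Max_Spec (qplane q)"
  unfolding Max_Spec_def mem_Collect_eq A.maximalideal_iff
proof (intro conjI allI impI)
  have id: "is_ideal Q" using Q by (simp add: is_maximal_ideal_def)
  show "ideal (pr -` Q) (qplane q)" by (rule ideal_vimage[OF id])
  show "\<one>\<^bsub>qplane q\<^esub> \<notin> pr -` Q" using Q by (simp add: is_maximal_ideal_def pr_1)
  fix J assume J: "ideal J (qplane q)" "pr -` Q \<subseteq> J" "\<one>\<^bsub>qplane q\<^esub> \<notin> J"
  have "g \<in> J" using J(2) is_idealD(1)[OF id] pr_g by auto
  note eq = ideal_eq_vimage[OF J(1) this]
  have "Q \<subseteq> \<iota> -` J" using J(2) by (subst (asm) eq(1)) (simp add: vimage_subset_iff)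
  moreover have "1 \<notin> \<iota> -` J"
  proof
    assume "1 \<in> \<iota> -` J"
    then have "1 \<in> pr -` (\<iota> -` J)" by (simp add: pr_1)
    then show False using eq(1) J(3) by simp
  qed
  ultimately have "\<iota> -` J = Q" using Q eq(2) by (simp add: is_maximal_ideal_def)
  then show "J = pr -` Q" using eq(1) by simp
qed

text \<open>An ideal containing \<open>g\<close> is determined by its image, so it suffices that the
  image of \<open>S\<close> generates \<open>Q\<close>; \<open>gen\<close> is the minimality half of
  that.\<close>

lemma Idl_eq_vimage:
  assumes Q: "is_ideal Q" and S: "g \<in> S" "S \<subseteq> pr -` Q"
    and gen: "\<And>J. is_ideal J \<Longrightarrow> pr ` S \<subseteq> J \<Longrightarrow> Q \<subseteq> J"
  shows "Idl\<^bsub>qplane q\<^esub> S = pr -` Q"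
proof
  show "Idl\<^bsub>qplane q\<^esub> S \<subseteq> pr -` Q" by (rule A.genideal_minimal[OF ideal_vimage[OF Q] S(2)])
  have I: "ideal (Idl\<^bsub>qplane q\<^esub> S) (qplane q)" by (rule A.genideal_ideal) simp
  have sub: "S \<subseteq> Idl\<^bsub>qplane q\<^esub> S" by (rule A.genideal_self) simp
  note eq = ideal_eq_vimage[OF I]
  have g: "g \<in> Idl\<^bsub>qplane q\<^esub> S" using S(1) sub by blast
  have "S \<subseteq> pr -` (\<iota> -` (Idl\<^bsub>qplane q\<^esub> S))" using sub eq(1)[OF g] by simp
  then have "Q \<subseteq> \<iota> -` (Idl\<^bsub>qplane q\<^esub> S)" by (intro gen eq(2)[OF g]) auto
  then show "pr -` Q \<subseteq> Idl\<^bsub>qplane q\<^esub> S" by (subst eq(1)[OF g]) (simp add: vimage_subset_iff)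
qed

lemma is_ideal_0: "is_ideal {0 :: 'a poly}"
  by (simp add: is_ideal_def)

lemma Idl_g: "Idl\<^bsub>qplane q\<^esub> {g} = pr -` {0}"
  by (rule Idl_eq_vimage) (auto simp: pr_g is_ideal_0 is_idealD)

lemma Idl_g_g': "Idl\<^bsub>qplane q\<^esub> {g, g'} = pr -` {r. [:0, 1:] dvd r}"
  by (rule Idl_eq_vimage) (auto simp: pr_g pr_g' is_ideal_principal elim!: dvdE intro: is_idealD)

lemma prime_X: "is_prime_ideal {r. [:0, 1 :: 'a:] dvd r}" "{r. [:0, 1 :: 'a:] dvd r} \<noteq> {0}"
  using is_height_one_linear[of "0 :: 'a"] unfolding is_height_one_def by simp_all

text \<open>Rewrites the shape of \<open>set_X\<close> and \<open>set_H\<close> as preimages under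
  \<open>pr\<close>, where inclusion and primality are those of polynomials in one variable.\<close>

lemma family_eq:
  "{Idl\<^bsub>qplane q\<^esub> ({g} \<union> \<qq>) | \<qq>. \<qq> \<in> Spec (subalg q {g'}) - {{0}, Idl\<^bsub>subalg q {g'}\<^esub> {g'}}} =
    {pr -` Q | Q. is_prime_ideal Q \<and> Q \<noteq> {0} \<and> Q \<noteq> {r. [:0, 1:] dvd r}}"
proof -
  have Idl: "Idl\<^bsub>qplane q\<^esub> ({g} \<union> \<iota> ` Q) = pr -` Q" if "is_ideal Q" for Q
    by (rule Idl_eq_vimage)
      (use that in \<open>auto simp: pr_g pr_iota is_idealD image_Un image_image\<close>)
  have "\<iota> 0 = 0" using sub.f_zero by (simp add: subalg_def)
  then have z: "\<iota> ` Q = {0} \<longleftrightarrow> Q = {0}" for Q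
    using inj_image_eq_iff[OF sub.inj, of Q "{0}"] by simp
  have X: "\<iota> ` Q = Idl\<^bsub>subalg q {g'}\<^esub> {g'} \<longleftrightarrow> Q = {r. [:0, 1:] dvd r}" for Q
    using sub.Idl_image[of "[:0, 1:]"] inj_image_eq_iff[OF sub.inj] by (simp add: iota_X)
  let ?T = "{Q. is_prime_ideal Q \<and> Q \<noteq> {0} \<and> Q \<noteq> {r. [:0, 1 :: 'a:] dvd r}}"
  have T: "Spec (subalg q {g'}) - {{0}, Idl\<^bsub>subalg q {g'}\<^esub> {g'}} = (`) \<iota> ` ?T"
  proof -
    have "((`) \<iota> ` {Q. is_prime_ideal Q}) - {a, b} = (`) \<iota> ` {Q. is_prime_ideal Q \<and> \<iota> ` Q \<noteq> a \<and> \<iota> ` Q \<noteq> b}"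
      for a b by blast
    then show ?thesis unfolding sub.Spec_eq z[symmetric] X[symmetric] .
  qed
  have "Idl\<^bsub>qplane q\<^esub> ({g} \<union> \<iota> ` Q) = pr -` Q" if "Q \<in> ?T" for Q
    using that by (intro Idl is_prime_idealD(1)) simp
  then have "(\<lambda>\<qq>. Idl\<^bsub>qplane q\<^esub> ({g} \<union> \<qq>)) ` (`) \<iota> ` ?T = (\<lambda>Q. pr -` Q) ` ?T"
    unfolding image_image by (rule image_cong[OF refl])
  then show ?thesis unfolding T[symmetric] by (simp only: Setcompr_eq_image) blast
qed

definition family :: "'a poly poly set set" where
  "family = {pr -` Q | Q. is_prime_ideal Q \<and> Q \<noteq> {0} \<and> Q \<noteq> {r. [:0, 1:] dvd r}}"

lemma family_Spec: "P \<in> family \<Longrightarrow> P \<in> Spec (qplane q)"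
  using vimage_in_Spec_iff is_prime_idealD(1) by (auto simp: family_def)

lemma family_maximal: "P \<in> family \<Longrightarrow> P \<in> Max_Spec (qplane q)"
  using maximal_vimage is_prime_ideal_field_poly by (auto simp: family_def)

lemma family_g: "P \<in> family \<Longrightarrow> g \<in> P"
  using is_idealD(1) is_prime_idealD(1) by (auto simp: family_def pr_g)

text \<open>Otherwise \<open>Q\<close> would contain the maximal ideal \<open>(X)\<close> and hence
  equal it, which is excluded.\<close>

lemma family_g':
  assumes "P \<in> family"
  shows "g' \<notin> P"
proof
  assume g': "g' \<in> P"
  obtain Q where Q: "P = pr -` Q" "is_prime_ideal Q" "Q \<noteq> {r. [:0, 1:] dvd r}"
    using assms unfolding family_def by blast
  have "[:0, 1:] \<in> Q" using g' Q(1) pr_g' by simp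
  then have "[:0, 1:] * k \<in> Q" for k by (rule is_idealD(4)[OF is_prime_idealD(1)[OF Q(2)]])
  then have "{r. [:0, 1:] dvd r} \<subseteq> Q" unfolding dvd_def by blast
  then show False
    using is_prime_ideal_field_poly[OF prime_X] Q is_prime_idealD(1,2)[OF Q(2)]
    unfolding is_maximal_ideal_def by blast
qed

lemma family_strict: "P \<in> family \<Longrightarrow> Idl\<^bsub>qplane q\<^esub> {g} \<subset> P"
proof -
  assume "P \<in> family"
  then obtain Q where Q: "P = pr -` Q" "is_prime_ideal Q" "Q \<noteq> {0}" unfolding family_def by blast
  then have "{0} \<subseteq> Q" using is_idealD(1)[OF is_prime_idealD(1)] by simp
  then show ?thesis unfolding Idl_g psubset_eq Q(1) vimage_subset_iff vimage_eq_iff using Q(3) by simp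
qed

lemma Idl_g_props:
  "Idl\<^bsub>qplane q\<^esub> {g} \<in> Spec (qplane q)" "g \<in> Idl\<^bsub>qplane q\<^esub> {g}" "g' \<notin> Idl\<^bsub>qplane q\<^esub> {g}"
  "Idl\<^bsub>qplane q\<^esub> {g} \<notin> family"
proof -
  show "Idl\<^bsub>qplane q\<^esub> {g} \<in> Spec (qplane q)" "g \<in> Idl\<^bsub>qplane q\<^esub> {g}" "g' \<notin> Idl\<^bsub>qplane q\<^esub> {g}"
    unfolding Idl_g using vimage_in_Spec_iff[OF is_ideal_0] is_prime_ideal_zero
    by (auto simp: pr_g pr_g')
  show "Idl\<^bsub>qplane q\<^esub> {g} \<notin> family" using family_strict by blast
qed

lemma Idl_g_g'_props:
  "Idl\<^bsub>qplane q\<^esub> {g, g'} \<in> Max_Spec (qplane q)" "{g, g'} \<subseteq> Idl\<^bsub>qplane q\<^esub> {g, g'}"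
  "Idl\<^bsub>qplane q\<^esub> {g} \<subset> Idl\<^bsub>qplane q\<^esub> {g, g'}"
proof -
  show "Idl\<^bsub>qplane q\<^esub> {g, g'} \<in> Max_Spec (qplane q)"
    unfolding Idl_g_g' by (intro maximal_vimage is_prime_ideal_field_poly prime_X)
  show "{g, g'} \<subseteq> Idl\<^bsub>qplane q\<^esub> {g, g'}" by (rule A.genideal_self) simp
  show "Idl\<^bsub>qplane q\<^esub> {g} \<subset> Idl\<^bsub>qplane q\<^esub> {g, g'}"
    unfolding Idl_g Idl_g_g' psubset_eq vimage_subset_iff vimage_eq_iff using prime_X(2) by simp
qed

lemma Spec_containing_cases:
  assumes "P \<in> Spec (qplane q)" "g \<in> P"
  shows "P = Idl\<^bsub>qplane q\<^esub> {g} \<or> P = Idl\<^bsub>qplane q\<^esub> {g, g'} \<or> P \<in> family"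
proof -
  obtain Q where Q: "is_prime_ideal Q" "P = pr -` Q" using Spec_containing[OF assms] .
  show ?thesis
    unfolding Idl_g Idl_g_g' family_def Q(2) vimage_eq_iff using Q(1) by blast
qed

end

context quantum_plane_at_root
begin

lemma projection_x: "qplane_projection q n (\<lambda>f. coeff f 0) (\<lambda>p. [:p:]) gen_x gen_h"
proof (intro qplane_projection.intro qplane_projection_axioms.intro quantum_plane_at_root_axioms)
  show "type_ring_iso (subalg q {gen_h}) (\<lambda>p. [:p:])" by (rule subalg_h_iso)
  fix a :: "'k poly poly" assume "coeff a 0 = 0"
  then obtain b where "a = pCons 0 b" by (cases a) auto
  then have "a = b \<star> gen_x" unfolding qmult_gen_x by (simp add: gen_x_def)
  moreover have "ideal (Idl\<^bsub>qplane q\<^esub> {gen_x}) (qplane q)" "gen_x \<in> Idl\<^bsub>qplane q\<^esub> {gen_x}"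
    by (simp_all add: A.genideal_ideal A.genideal_self')
  ultimately show "a \<in> Idl\<^bsub>qplane q\<^esub> {gen_x}" using idealD(3) by metis
qed (simp_all add: coeff_qmult gen_x_def gen_h_def)

text \<open>Setting \<open>h = 0\<close> is multiplicative because the twist fixes constant terms;
  the kernel consists of the multiples of \<open>h\<close>.\<close>

lemma projection_h:
  "qplane_projection q n (map_poly (\<lambda>p. coeff p 0)) (map_poly (\<lambda>c. [:c:])) gen_h gen_x"
proof (intro qplane_projection.intro qplane_projection_axioms.intro quantum_plane_at_root_axioms)
  show "type_ring_iso (subalg q {gen_x}) (map_poly (\<lambda>c. [:c:]))" by (rule subalg_x_iso)
  fix a b :: "'k poly poly"
  have sum: "coeff (\<Sum>i\<in>S. u i) 0 = (\<Sum>i\<in>S. coeff (u i) 0)" for u :: "nat \<Rightarrow> 'k poly" and S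
    by (simp add: coeff_sum)
  show "map_poly (\<lambda>p. coeff p 0) (a \<star> b) = map_poly (\<lambda>p. coeff p 0) a * map_poly (\<lambda>p. coeff p 0) b"
    by (rule poly_eqI) (simp add: coeff_map_poly coeff_qmult coeff_mult sum poly_0_coeff_0)
  show "map_poly (\<lambda>p. coeff p 0) (a + b) = map_poly (\<lambda>p. coeff p 0) a + map_poly (\<lambda>p. coeff p 0) b"
    by (rule poly_eqI) (simp add: coeff_map_poly)
  assume "map_poly (\<lambda>p. coeff p 0) a = 0"
  then have "coeff (coeff a i) 0 = 0" for i
    by (metis coeff_0 coeff_map_poly)
  then have "[:[:0, 1:]:] dvd a"
    by (simp add: const_poly_dvd_iff poly_0_coeff_0 flip: poly_eq_0_iff_dvd[of _ 0, simplified])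
  then obtain b where "a = gen_h * b" unfolding gen_h_def by (elim dvdE)
  then have "a = gen_h \<star> b" by simp
  moreover have "ideal (Idl\<^bsub>qplane q\<^esub> {gen_h}) (qplane q)" "gen_h \<in> Idl\<^bsub>qplane q\<^esub> {gen_h}"
    by (simp_all add: A.genideal_ideal A.genideal_self')
  ultimately show "a \<in> Idl\<^bsub>qplane q\<^esub> {gen_h}" using idealD(4) by metis
qed (auto simp: poly_eq_iff coeff_map_poly gen_x_def gen_h_def coeff_pCons split: nat.splits)

section \<open>The families \<open>M\<close> and \<open>N\<close>\<close>

abbreviation S :: "'k poly poly" where "S \<equiv> [:[:0, 1:]:]"
abbreviation T :: "'k poly poly" where "T \<equiv> [:0, 1:]"

lemma set_M_eq: "set_M q n = lift_ideal ` {p. is_maximal_ideal p \<and> S \<notin> p \<and> T \<notin> p}"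
proof -
  have prod: "ideal_prod (qplane q) (carrier (qplane q)) (E ` p) = lift_ideal p" if "is_maximal_ideal p" for p
    using lift_ideal_eq_prod that by (simp add: is_maximal_ideal_def)
  have eq: "{\<mm>. \<mm> \<in> Max_Spec (Z_ring q) \<and> elt_s q n \<notin> \<mm> \<and> elt_t q n \<notin> \<mm>} =
      (`) E ` {p. is_maximal_ideal p \<and> S \<notin> p \<and> T \<notin> p}"
    unfolding Z.Max_Spec_eq elt_s_eq elt_t_eq using Z.f_mem by blast
  have "set_M q n = ideal_prod (qplane q) (carrier (qplane q)) `
    {\<mm>. \<mm> \<in> Max_Spec (Z_ring q) \<and> elt_s q n \<notin> \<mm> \<and> elt_t q n \<notin> \<mm>}"
    unfolding set_M_def by blast
  also have "\<dots> = (\<lambda>p. ideal_prod (qplane q) (carrier (qplane q)) (E ` p)) ` {p. is_maximal_ideal p \<and> S \<notin> p \<and> T \<notin> p}"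
    unfolding eq image_image ..
  also have "\<dots> = lift_ideal ` {p. is_maximal_ideal p \<and> S \<notin> p \<and> T \<notin> p}"
    by (rule image_cong[OF refl]) (simp only: mem_Collect_eq prod)
  finally show ?thesis .
qed

lemma height_one_S: "is_height_one {r. S dvd r}"
proof (rule is_height_one_const)
  show "prime_elem [:0, 1 :: 'k:]"
    using prime_elem_field_poly[of "[:0, 1 :: 'k:]"] is_height_one_linear[of "0 :: 'k"]
    by (simp add: is_height_one_def)
qed

lemma height_one_T: "is_height_one {r. T dvd r}"
  by (rule is_height_one_linear)

text \<open>Turns the exclusion of \<open>(s)\<close> and \<open>(t)\<close> in \<open>set_N\<close>
  into \<open>S\<close> and \<open>T\<close> not being members, the form already used for
  \<open>set_M\<close>.\<close>

lemma height_one_eq: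
  assumes p: "is_height_one p" and g: "is_height_one {r. g dvd r}"
  shows "g \<in> p \<longleftrightarrow> p = {r. g dvd r}"
proof
  assume gp: "g \<in> p"
  have "is_ideal p" using p by (simp add: is_height_one_def is_prime_ideal_def)
  then have "g * k \<in> p" for k using is_idealD(4) gp by blast
  then have "{r. g dvd r} \<subseteq> p" unfolding dvd_def by blast
  moreover have "is_prime_ideal {r. g dvd r}" "{r. g dvd r} \<noteq> {0}"
    using g unfolding is_height_one_def by blast+
  ultimately show "p = {r. g dvd r}" using p unfolding is_height_one_def by metis
qed simp

lemma set_N_eq: "set_N q n = lift_ideal ` {p. is_height_one p \<and> S \<notin> p \<and> T \<notin> p}"
proof -
  have prod: "ideal_prod (qplane q) (carrier (qplane q)) (E ` p) = lift_ideal p" if "is_height_one p" for p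
    using lift_ideal_eq_prod that by (simp add: is_height_one_def is_prime_ideal_def)
  have eq: "{\<nn>. \<nn> \<in> Spec (Z_ring q) \<and> ht (Z_ring q) \<nn> = 1 \<and>
      \<nn> \<noteq> Idl\<^bsub>Z_ring q\<^esub> {elt_t q n} \<and> \<nn> \<noteq> Idl\<^bsub>Z_ring q\<^esub> {elt_s q n}} =
      (`) E ` {p. is_height_one p \<and> S \<notin> p \<and> T \<notin> p}"
  proof -
    have iff: "(E ` p \<in> Spec (Z_ring q) \<and> ht (Z_ring q) (E ` p) = 1 \<and>
        E ` p \<noteq> Idl\<^bsub>Z_ring q\<^esub> {elt_t q n} \<and> E ` p \<noteq> Idl\<^bsub>Z_ring q\<^esub> {elt_s q n}) \<longleftrightarrow>
        is_height_one p \<and> S \<notin> p \<and> T \<notin> p" for p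
    proof -
      have ht: "E ` p \<in> Spec (Z_ring q) \<and> ht (Z_ring q) (E ` p) = 1 \<longleftrightarrow> is_height_one p"
        using Z.Spec_image_iff Z.ht_image[OF is_prime_ideal_zero] is_height_one_def by metis
      have Idl: "E ` p = Idl\<^bsub>Z_ring q\<^esub> {E g} \<longleftrightarrow> p = {r. g dvd r}" for g
        unfolding Z.Idl_image inj_image_eq_iff[OF Z.inj] ..
      show ?thesis
      proof (cases "is_height_one p")
        case True
        then show ?thesis
          using ht height_one_eq[OF True height_one_S] height_one_eq[OF True height_one_T]
          unfolding elt_s_eq elt_t_eq Idl by (simp add: conj_commute)
      next
        case False
        then show ?thesis using ht by blast
      qed
    qed
    have ex: "\<exists>p. \<nn> = E ` p" if "\<nn> \<in> Spec (Z_ring q)" for \<nn>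
      using that unfolding Z.Spec_eq by blast
    have "{\<nn>. \<nn> \<in> Spec (Z_ring q) \<and> R \<nn>} = (`) E ` {p. E ` p \<in> Spec (Z_ring q) \<and> R (E ` p)}" for R
    proof (intro Set.set_eqI iffI)
      fix \<nn> assume n: "\<nn> \<in> {\<nn>. \<nn> \<in> Spec (Z_ring q) \<and> R \<nn>}"
      then obtain p where "\<nn> = E ` p" using ex by blast
      then show "\<nn> \<in> (`) E ` {p. E ` p \<in> Spec (Z_ring q) \<and> R (E ` p)}" using n by simp
    qed auto
    from this[of "\<lambda>\<nn>. ht (Z_ring q) \<nn> = 1 \<and> \<nn> \<noteq> Idl\<^bsub>Z_ring q\<^esub> {elt_t q n} \<and>
        \<nn> \<noteq> Idl\<^bsub>Z_ring q\<^esub> {elt_s q n}"]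
    show ?thesis unfolding iff .
  qed
  have "set_N q n = ideal_prod (qplane q) (carrier (qplane q)) `
    {\<nn>. \<nn> \<in> Spec (Z_ring q) \<and> ht (Z_ring q) \<nn> = 1 \<and>
      \<nn> \<noteq> Idl\<^bsub>Z_ring q\<^esub> {elt_t q n} \<and> \<nn> \<noteq> Idl\<^bsub>Z_ring q\<^esub> {elt_s q n}}"
    unfolding set_N_def by blast
  also have "\<dots> = (\<lambda>p. ideal_prod (qplane q) (carrier (qplane q)) (E ` p)) ` {p. is_height_one p \<and> S \<notin> p \<and> T \<notin> p}"
    unfolding eq image_image ..
  also have "\<dots> = lift_ideal ` {p. is_height_one p \<and> S \<notin> p \<and> T \<notin> p}"
    by (rule image_cong[OF refl]) (simp only: mem_Collect_eq prod)
  finally show ?thesis .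
qed

lemma lift_ideal_0: "lift_ideal {0} = {0}"
proof
  show "lift_ideal {0} \<subseteq> {0}"
  proof
    fix a assume "a \<in> lift_ideal {0}"
    then have "(\<Sum>i<n. \<Sum>j<n. E (component n i j a) * monom (monom 1 j) i) = 0"
      by (simp add: lift_ideal_def n0)
    then show "a \<in> {0}" by (simp add: sum_components n0)
  qed
qed (simp add: lift_ideal_def n0)

lemma lift_ideal_eq_iff:
  assumes "is_ideal p" "is_ideal p'"
  shows "lift_ideal p = lift_ideal p' \<longleftrightarrow> p = p'"
  using lift_ideal_mono_iff[OF assms] lift_ideal_mono_iff[OF assms(2,1)] by auto

lemma lift_ideal_subset:
  assumes P: "ideal P (qplane q)" and p: "\<And>f. f \<in> p \<Longrightarrow> E f \<in> P"
  shows "lift_ideal p \<subseteq> P"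
proof
  fix a assume "a \<in> lift_ideal p"
  then have "E (component n i j a) * b \<in> P" if "i < n" "j < n" for i j b
    using that by (intro idealD(7)[OF P] p) (simp add: lift_ideal_def)
  then have "(\<Sum>i<n. \<Sum>j<n. E (component n i j a) * monom (monom 1 j) i) \<in> P"
    by (intro ideal_sum[OF P]) simp
  then show "a \<in> P" by (simp add: sum_components n0)
qed

lemma Spec_without_h_x:
  assumes P: "P \<in> Spec (qplane q)" "gen_h \<notin> P" "gen_x \<notin> P"
  shows "P = {0} \<or> P \<in> set_M q n \<or> P \<in> set_N q n"
proof -
  define p where "p = E -` P"
  note L = Spec_eq_lift_ideal[OF P, folded p_def]
  consider "p = {0}" | "is_height_one p" | "p \<noteq> {0}" "\<not> is_height_one p" by blast
  then show ?thesis
  proof cases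
    case 1
    then show ?thesis using L(1) lift_ideal_0 by simp
  next
    case 2
    then show ?thesis using L unfolding set_N_eq by blast
  next
    case 3
    then obtain I where "is_prime_ideal I" "I \<noteq> {0}" "I \<subset> p"
      using L(2) unfolding is_height_one_def by blast
    then have "is_maximal_ideal p" using is_maximal_ideal_if_height_two L(2) by blast
    then show ?thesis using L unfolding set_M_eq by blast
  qed
qed

lemma lift_ideal_not_gens:
  assumes "is_prime_ideal p"
  shows "gen_h \<notin> lift_ideal p" "gen_x \<notin> lift_ideal p"
  using gens_notin_lift_ideal is_prime_idealD[OF assms] by blast+

lemma M_props:
  assumes "P \<in> set_M q n"
  shows "P \<in> Max_Spec (qplane q)" "gen_h \<notin> P" "gen_x \<notin> P" "P \<noteq> {0}" "P \<notin> set_N q n"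
proof -
  obtain m where m: "P = lift_ideal m" "is_maximal_ideal m" "S \<notin> m" "T \<notin> m"
    using assms unfolding set_M_eq by blast
  have pm: "is_prime_ideal m" by (rule is_maximal_imp_prime[OF m(2)])
  have id: "is_ideal m" by (rule is_prime_idealD(1)[OF pm])
  show "gen_h \<notin> P" "gen_x \<notin> P" unfolding m(1) by (rule lift_ideal_not_gens[OF pm])+
  have "m \<noteq> {0}"
    using contraction_maximal_nonzero[OF m(2)] by (auto simp: contraction_def)
  moreover have "is_ideal {0 :: 'k poly poly}" by (simp add: is_ideal_def)
  ultimately show "P \<noteq> {0}" using lift_ideal_eq_iff[OF id] lift_ideal_0 m(1) by metis
  show "P \<notin> set_N q n"
  proof
    assume "P \<in> set_N q n"
    then obtain p where p: "P = lift_ideal p" "is_height_one p" unfolding set_N_eq by blast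
    then have "is_ideal p" by (simp add: is_height_one_def is_prime_ideal_def)
    then have "m = p" using p m(1) lift_ideal_eq_iff id by metis
    then show False using is_maximal_imp_not_height_one m(2) p(2) by blast
  qed
  show "P \<in> Max_Spec (qplane q)"
    unfolding Max_Spec_def mem_Collect_eq A.maximalideal_iff
  proof (intro conjI allI impI)
    show "ideal P (qplane q)" unfolding m(1) by (rule ideal_lift_ideal[OF id])
    show "\<one>\<^bsub>qplane q\<^esub> \<notin> P" using gens_notin_lift_ideal(1)[OF id] m by (simp add: is_maximal_ideal_def)
    fix J assume J: "ideal J (qplane q)" "P \<subseteq> J" "\<one>\<^bsub>qplane q\<^esub> \<notin> J"
    have mJ: "E f \<in> J" if "f \<in> m" for f
      using J(2) m(1) that E_in_lift_ideal_iff[OF id] by blast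
    \<comment> \<open>A central element outside \<open>m\<close> is invertible modulo
      \<open>m\<close>, hence regular modulo \<open>J\<close>. So \<open>J\<close> is lifted from a
      proper ideal containing \<open>m\<close>, which must be \<open>m\<close>.\<close>
    have reg: "a \<in> J" if a: "E f * a \<in> J" and f: "f \<notin> m" for a f
    proof -
      obtain r where r: "1 - r * f \<in> m" using is_maximal_ideal_inverse[OF m(2) f] .
      have "E (1 - r * f) * a + E r * (E f * a) \<in> J"
        using idealD(2)[OF J(1) idealD(7)[OF J(1) mJ[OF r]] idealD(5)[OF J(1) a]] .
      also have "E (1 - r * f) * a + E r * (E f * a) = (E (1 - r * f) + E (r * f)) * a"
        by (simp only: stretch2_simps[OF n0] distrib_right mult.assoc)
      also have "\<dots> = E 1 * a" by (simp only: stretch2_simps(3)[OF n0, symmetric]) simp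
      finally show ?thesis by (simp add: n0)
    qed
    note eq = regular_ideal_eq_lift_ideal[OF J(1) reg[OF _ m(3)] reg[OF _ m(4)]]
    have "m \<subseteq> E -` J" using mJ by blast
    moreover have "1 \<notin> E -` J" using J(3) by (simp add: n0)
    ultimately have "E -` J = m" using m(2) eq(2) by (simp add: is_maximal_ideal_def)
    then show "J = P" using eq(1) m(1) by simp
  qed
qed

text \<open>The last two parts exclude inclusions of members of \<open>set_N\<close> in
  \<open>(x)\<close> and \<open>(h)\<close>: they would put \<open>p\<close> inside
  \<open>(T)\<close> or \<open>(S)\<close>, and height one would force equality.\<close>

lemma N_props:
  assumes "P \<in> set_N q n"
  shows "P \<in> Spec (qplane q)" "P \<notin> Max_Spec (qplane q)" "gen_h \<notin> P" "gen_x \<notin> P" "P \<noteq> {0}"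
    "Q \<in> set_N q n \<Longrightarrow> \<not> P \<subset> Q" "P \<subseteq> ideal_x q \<Longrightarrow> False" "P \<subseteq> ideal_h q \<Longrightarrow> False"
proof -
  obtain p where p: "P = lift_ideal p" "is_height_one p" "S \<notin> p" "T \<notin> p"
    using assms unfolding set_N_eq by blast
  have pp: "is_prime_ideal p" and p0: "p \<noteq> {0}" using p(2) by (simp_all add: is_height_one_def)
  have id: "is_ideal p" by (rule is_prime_idealD(1)[OF pp])
  show "gen_h \<notin> P" "gen_x \<notin> P" unfolding p(1) by (rule lift_ideal_not_gens[OF pp])+
  have "is_ideal {0 :: 'k poly poly}" by (simp add: is_ideal_def)
  then show "P \<noteq> {0}" using lift_ideal_eq_iff[OF id] lift_ideal_0 p(1) p0 by metis
  show "P \<in> Spec (qplane q)" unfolding p(1) by (rule lift_ideal_in_Spec[OF pp p(3,4)])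
  show "P \<notin> Max_Spec (qplane q)"
  proof
    assume P: "P \<in> Max_Spec (qplane q)"
    \<comment> \<open>A larger proper ideal of the centre lifts to a larger proper ideal of the
      algebra.\<close>
    have "\<not> is_maximal_ideal p" using is_maximal_imp_not_height_one p(2) by blast
    then obtain J where J: "is_ideal J" "p \<subseteq> J" "1 \<notin> J" "J \<noteq> p"
      using id is_prime_idealD(2)[OF pp] unfolding is_maximal_ideal_def by blast
    have "lift_ideal J = P"
      using P ideal_lift_ideal[OF J(1)] gens_notin_lift_ideal(1)[OF J(1,3)]
        lift_ideal_mono_iff[OF id J(1)] J(2) p(1)
      unfolding Max_Spec_def mem_Collect_eq A.maximalideal_iff by simp
    then show False using lift_ideal_eq_iff[OF J(1) id] p(1) J(4) by simp
  qed
  show "\<not> P \<subset> Q" if Q: "Q \<in> set_N q n"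
  proof
    assume PQ: "P \<subset> Q"
    obtain p' where p': "Q = lift_ideal p'" "is_height_one p'" using Q unfolding set_N_eq by blast
    have id': "is_ideal p'" using p'(2) by (simp add: is_height_one_def is_prime_ideal_def)
    have "p \<subseteq> p'" using PQ lift_ideal_mono_iff[OF id id'] p(1) p'(1) by blast
    then have "p = p'" using p'(2) pp p0 unfolding is_height_one_def by blast
    then show False using PQ p(1) p'(1) by blast
  qed
  have Ef: "E f \<in> P" if "f \<in> p" for f using that E_in_lift_ideal_iff[OF id] p(1) by simp
  show False if "P \<subseteq> ideal_x q"
  proof -
    interpret px: qplane_projection q n "\<lambda>f. coeff f 0" "\<lambda>p. [:p:]" gen_x gen_h
      by (rule projection_x)
    have "T dvd f" if f: "f \<in> p" for f
    proof -
      have "E f \<in> ideal_x q" using Ef[OF f] \<open>P \<subseteq> ideal_x q\<close> by blast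
      then have "coeff (E f) 0 = 0" unfolding ideal_x_def px.Idl_g by simp
      then have "stretch n (coeff f 0) = 0"
        by (simp add: stretch2_def coeff_stretch n0 coeff_map_poly)
      then have "coeff (stretch n (coeff f 0)) (n * k) = 0" for k by simp
      then have "coeff f 0 = 0" by (intro poly_eqI) (simp add: coeff_stretch n0)
      then show ?thesis by (simp add: poly_0_coeff_0 flip: poly_eq_0_iff_dvd[of _ 0, simplified])
    qed
    then have "p \<subseteq> {r. T dvd r}" by blast
    then have "p = {r. T dvd r}" using height_one_T pp p0 unfolding is_height_one_def by blast
    then show False using p(4) by simp
  qed
  show False if "P \<subseteq> ideal_h q"
  proof -
    interpret ph: qplane_projection q n "map_poly (\<lambda>p. coeff p 0)" "map_poly (\<lambda>c. [:c:])" gen_h gen_x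
      by (rule projection_h)
    have "S dvd f" if f: "f \<in> p" for f
    proof -
      have "E f \<in> ideal_h q" using Ef[OF f] \<open>P \<subseteq> ideal_h q\<close> by blast
      then have "map_poly (\<lambda>p. coeff p 0) (E f) = 0" unfolding ideal_h_def ph.Idl_g by simp
      then have "coeff (map_poly (\<lambda>p. coeff p 0) (E f)) (n * k) = 0" for k by simp
      then have "coeff (coeff f k) 0 = 0" for k
        by (simp add: coeff_map_poly coeff_stretch2 n0)
      then show ?thesis
        by (simp add: const_poly_dvd_iff poly_0_coeff_0 flip: poly_eq_0_iff_dvd[of _ 0, simplified])
    qed
    then have "p \<subseteq> {r. S dvd r}" by blast
    then have "p = {r. S dvd r}" using height_one_S pp p0 unfolding is_height_one_def by blast
    then show False using p(3) by simp
  qed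
qed

text \<open>The vanishing ideal of the line \<open>t = s + a\<close>; these ideals give the elements of \<open>N\<close> below the maximal ideals.\<close>

definition line :: "'k \<Rightarrow> 'k poly poly set" where
  "line a = {r. [:- [:a, 1:], 1:] dvd r}"

lemma line_iff: "r \<in> line a \<longleftrightarrow> poly r [:a, 1:] = 0"
  unfolding line_def poly_eq_0_iff_dvd by simp

text \<open>On the line, \<open>S\<close> and \<open>T\<close> restrict to the nonzero polynomials
  \<open>S\<close> and \<open>S + a\<close>.\<close>

lemma lift_line_in_N: "lift_ideal (line a) \<in> set_N q n"
proof -
  have "is_height_one (line a)" unfolding line_def by (rule is_height_one_linear)
  moreover have "S \<notin> line a" "T \<notin> line a" by (simp_all add: line_iff)
  ultimately show ?thesis unfolding set_N_eq by blast
qed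

text \<open>The hypothesis \<open>gen\<close> says that \<open>P\<close> contains t - s - a, the
  image of the generator of \<open>line a\<close>.\<close>

lemma lift_line_subset:
  assumes P: "ideal P (qplane q)" and gen: "monom 1 n - [:monom 1 n + [:a:]:] \<in> P"
  shows "lift_ideal (line a) \<subseteq> P"
proof (rule lift_ideal_subset[OF P])
  fix f assume "f \<in> line a"
  then obtain k where k: "f = [:- [:a, 1:], 1:] * k" unfolding line_def by (auto elim: dvdE)
  have "[:- [:a, 1:], 1:] = T + [:- [:a, 1:]:]" by simp
  moreover have "E T = monom 1 n" "E [:- [:a, 1:]:] = - [:monom 1 n + [:a:]:]"
    by (simp_all add: stretch2_def stretch_pCons map_poly_pCons n0)
  ultimately have "E [:- [:a, 1:], 1:] = monom 1 n - [:monom 1 n + [:a:]:]"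
    using stretch2_simps(3)[OF n0, of T "[:- [:a, 1:]:]"] by simp
  then have "E [:- [:a, 1:], 1:] \<in> P" using gen by simp
  then show "E f \<in> P" unfolding k stretch2_simps(4)[OF n0] by (rule idealD(7)[OF P])
qed

text \<open>The point (1, 1) lies on t = s and off both axes over every field. Its vanishing ideal
  is maximal because it strictly contains a nonzero prime.\<close>

lemma line_0_below_M: "\<exists>Q\<in>set_M q n. lift_ideal (line 0) \<subset> Q"
proof -
  define m where "m = {f :: 'k poly poly. poly (poly f 1) 1 = 0}"
  have m: "is_prime_ideal m"
    by (auto simp: is_prime_ideal_def is_ideal_def m_def)
  have l: "is_height_one (line 0)" unfolding line_def by (rule is_height_one_linear)
  have lp: "is_prime_ideal (line 0)" "line 0 \<noteq> {0}" using l by (simp_all add: is_height_one_def)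
  have sub: "line 0 \<subseteq> m"
  proof
    fix f assume "f \<in> line 0"
    then obtain k where "f = [:- [:0, 1:], 1:] * k" unfolding line_def by (auto elim: dvdE)
    then show "f \<in> m" by (simp add: m_def)
  qed
  \<comment> \<open>\<open>S - 1\<close> vanishes at the point but not on the whole line.\<close>
  have "[:[:-1, 1:]:] \<in> m" "[:[:-1, 1:]:] \<notin> line 0" by (simp_all add: m_def line_iff)
  then have ss: "line 0 \<subset> m" using sub by blast
  have "is_maximal_ideal m" by (rule is_maximal_ideal_if_height_two[OF lp m ss])
  moreover have "S \<notin> m" "T \<notin> m" by (simp_all add: m_def)
  ultimately have "lift_ideal m \<in> set_M q n" unfolding set_M_eq by blast
  moreover have "lift_ideal (line 0) \<subset> lift_ideal m"
    unfolding psubset_eq lift_ideal_mono_iff[OF is_prime_idealD(1)[OF lp(1)] is_prime_idealD(1)[OF m]]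
      lift_ideal_eq_iff[OF is_prime_idealD(1)[OF lp(1)] is_prime_idealD(1)[OF m]]
    using ss by blast
  ultimately show ?thesis by blast
qed

end

section \<open>Assembly of the spectrum and of the diagram\<close>

lemma (in qplane_projection) linear_family:
  assumes "c \<noteq> 0"
  shows "pr -` {r. poly r c = 0} \<in> family"
proof -
  have "is_prime_ideal {r. poly r c = 0}" by (auto simp: is_prime_ideal_def is_ideal_def)
  moreover have "[:- c, 1:] \<in> {r. poly r c = 0}" by simp
  moreover have "[:- c, 1:] \<notin> {r. [:0, 1:] dvd r}"
    using assms poly_eq_0_iff_dvd[of "[:- c, 1:]" 0] by simp
  moreover have "[:- c, 1:] \<noteq> 0" by simp
  ultimately show ?thesis unfolding family_def by blast
qed

theorem theorem4p5:
  fixes q :: "'k::field" and n :: nat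
  assumes "n \<ge> 2"
    and "q ^ n = 1" and "\<forall>k. 0 < k \<and> k < n \<longrightarrow> q ^ k \<noteq> 1"
  shows
    "(\<comment> \<open>1: the prime spectrum and the centre\<close>
      distinct [{0}, ideal_x q, ideal_h q, ideal_xh q] \<and>
      is_disjoint_union (Spec (qplane q))
        [{{0}, ideal_x q, ideal_h q, ideal_xh q}, set_X q, set_M q n, set_H q, set_N q n] \<and>
      Z_ring q = subalg q {elt_s q n, elt_t q n} \<and>
      eval_st q n \<in> ring_iso (ring_of_type_algebra :: 'k poly poly ring) (Z_ring q)) \<and>
     (\<comment> \<open>1: the solid lines\<close>
      {0} \<subset> ideal_x q \<and> {0} \<subset> ideal_h q \<and> (\<forall>P\<in>set_N q n. {0} \<subset> P) \<and>
      (\<forall>Q\<in>set_X q. ideal_x q \<subset> Q) \<and> ideal_x q \<subset> ideal_xh q \<and>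
      (\<forall>Q\<in>set_H q. ideal_h q \<subset> Q) \<and> ideal_h q \<subset> ideal_xh q) \<and>
     (\<comment> \<open>1: the dotted lines; the last one is needed because of \<open>A (s - t)\<close>\<close>
      (\<exists>P\<in>set_N q n. \<exists>Q\<in>set_X q. P \<subset> Q) \<and>
      (\<exists>P\<in>set_N q n. \<exists>Q\<in>set_M q n. P \<subset> Q) \<and>
      (\<exists>P\<in>set_N q n. \<exists>Q\<in>set_H q. P \<subset> Q) \<and>
      (\<exists>P\<in>set_N q n. P \<subset> ideal_xh q)) \<and>
     (\<comment> \<open>1: every strict inclusion comes from the lines and transitivity\<close>
      \<forall>P\<in>Spec (qplane q). \<forall>Q\<in>Spec (qplane q). P \<subset> Q \<longrightarrow>
        P = {0} \<or>
        P = ideal_x q \<and> Q \<in> set_X q \<union> {ideal_xh q} \<or>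
        P = ideal_h q \<and> Q \<in> set_H q \<union> {ideal_xh q} \<or>
        P \<in> set_N q n \<and> Q \<in> set_X q \<union> set_M q n \<union> set_H q \<union> {ideal_xh q}) \<and>
     (\<comment> \<open>2\<close>
      \<forall>I. ideal I (qplane q) \<and> I \<noteq> {0} \<longrightarrow> I \<inter> centre (qplane q) \<noteq> {0}) \<and>
     (\<comment> \<open>3\<close>
      is_disjoint_union (Max_Spec (qplane q)) [set_X q, {ideal_xh q}, set_M q n, set_H q])"
proof -
  interpret quantum_plane_at_root q n
    using assms by unfold_locales auto
  interpret px: qplane_projection q n "\<lambda>f. coeff f 0" "\<lambda>p. [:p:]" gen_x gen_h
    by (rule projection_x)
  interpret ph: qplane_projection q n "map_poly (\<lambda>p. coeff p 0)" "map_poly (\<lambda>c. [:c:])" gen_h gen_x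
    by (rule projection_h)
  let ?A = "qplane q"
  let ?x = "ideal_x q" and ?h = "ideal_h q" and ?xh = "ideal_xh q"
  let ?X = "set_X q" and ?H = "set_H q" and ?M = "set_M q n" and ?N = "set_N q n"
  have X: "?X = px.family"
    unfolding set_X_def px.family_def px.family_eq[symmetric] ..
  have H: "?H = ph.family"
    unfolding set_H_def ph.family_def ph.family_eq[symmetric] ..
  have xh: "?xh = Idl\<^bsub>?A\<^esub> {gen_x, gen_h}" "?xh = Idl\<^bsub>?A\<^esub> {gen_h, gen_x}"
    unfolding ideal_xh_def by (simp_all add: insert_commute)
  note x_props = px.Idl_g_props[folded ideal_x_def X]
  note h_props = ph.Idl_g_props[folded ideal_h_def H]
  note x_xh = px.Idl_g_g'_props[folded xh(1) ideal_x_def]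
  note h_xh = ph.Idl_g_g'_props[folded xh(2) ideal_h_def]
  have X_props: "P \<in> Max_Spec ?A" "P \<in> Spec ?A" "gen_x \<in> P" "gen_h \<notin> P" "?x \<subset> P" if "P \<in> ?X" for P
    using that px.family_maximal px.family_Spec px.family_g px.family_g' px.family_strict
    unfolding X ideal_x_def by blast+
  have H_props: "P \<in> Max_Spec ?A" "P \<in> Spec ?A" "gen_h \<in> P" "gen_x \<notin> P" "?h \<subset> P" if "P \<in> ?H" for P
    using that ph.family_maximal ph.family_Spec ph.family_g ph.family_g' ph.family_strict
    unfolding H ideal_h_def by blast+
  have zero: "{0} \<in> Spec ?A"
    using lift_ideal_in_Spec[OF is_prime_ideal_zero] lift_ideal_0 by simp
  have gens: "gen_x \<noteq> (0 :: 'k poly poly)" "gen_h \<noteq> (0 :: 'k poly poly)"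
    by (simp_all add: gen_x_def gen_h_def)
  have id: "ideal P ?A" if "P \<in> Spec ?A" for P using that by (simp add: Spec_def)
  have Max: "P \<in> Spec ?A" if "P \<in> Max_Spec ?A" for P using that A.Max_Spec_subset_Spec by blast
  have maxD: "False" if "P \<in> Max_Spec ?A" "Q \<in> Spec ?A" "P \<subset> Q" for P Q
    using that unfolding Max_Spec_def mem_Collect_eq A.maximalideal_iff Spec_iff' qplane_simps
    by blast
  have bot: "0 \<in> P" if "P \<in> Spec ?A" for P using idealD(1)[OF id[OF that]] .
  have cases: "P = {0} \<or> P = ?x \<or> P = ?h \<or> P = ?xh \<or> P \<in> ?X \<or> P \<in> ?M \<or> P \<in> ?H \<or> P \<in> ?N"
    if P: "P \<in> Spec ?A" for P
  proof -
    consider "gen_x \<in> P" | "gen_h \<in> P" | "gen_h \<notin> P" "gen_x \<notin> P" by blast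
    then show ?thesis
    proof cases
      case 1
      show ?thesis
        using px.Spec_containing_cases[OF P 1] unfolding ideal_x_def xh(1) X by blast
    next
      case 2
      show ?thesis
        using ph.Spec_containing_cases[OF P 2] unfolding ideal_h_def xh(2) H by blast
    next
      case 3
      show ?thesis using Spec_without_h_x[OF P 3] by blast
    qed
  qed
  have distinct: "distinct [{0}, ?x, ?h, ?xh]"
    using x_props(2,3) h_props(2,3) x_xh(2) gens by auto
  have disj: "disjnt {{0}, ?x, ?h, ?xh} ?X" "disjnt {{0}, ?x, ?h, ?xh} ?M"
    "disjnt {{0}, ?x, ?h, ?xh} ?H" "disjnt {{0}, ?x, ?h, ?xh} ?N"
    "disjnt ?X ?M" "disjnt ?X ?H" "disjnt ?X ?N" "disjnt ?M ?H" "disjnt ?M ?N" "disjnt ?H ?N"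
    "disjnt {?xh} ?X" "disjnt {?xh} ?M" "disjnt {?xh} ?H"
  proof -
    have x0: "gen_x \<notin> {0 :: 'k poly poly}" and h0: "gen_h \<notin> {0 :: 'k poly poly}" using gens by simp_all
    have X: "{0} \<notin> ?X" "?x \<notin> ?X" "?h \<notin> ?X" "?xh \<notin> ?X"
      using X_props(3) X_props(4) x0 x_props(4) h_props(3) x_xh(2) by blast+
    have H: "{0} \<notin> ?H" "?x \<notin> ?H" "?h \<notin> ?H" "?xh \<notin> ?H"
      using H_props(3) H_props(4) h0 h_props(4) x_props(3) x_xh(2) by blast+
    have M: "{0} \<notin> ?M" "?x \<notin> ?M" "?h \<notin> ?M" "?xh \<notin> ?M"
      using M_props(2-4) x_props(2) h_props(2) x_xh(2) by blast+
    have N: "{0} \<notin> ?N" "?x \<notin> ?N" "?h \<notin> ?N" "?xh \<notin> ?N"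
      using N_props(3-5) x_props(2) h_props(2) x_xh(2) by blast+
    show "disjnt {{0}, ?x, ?h, ?xh} ?X" "disjnt {{0}, ?x, ?h, ?xh} ?M"
      "disjnt {{0}, ?x, ?h, ?xh} ?H" "disjnt {{0}, ?x, ?h, ?xh} ?N"
      "disjnt {?xh} ?X" "disjnt {?xh} ?M" "disjnt {?xh} ?H"
      using X H M N by simp_all
    show "disjnt ?X ?M" "disjnt ?X ?H" "disjnt ?X ?N" "disjnt ?M ?H" "disjnt ?M ?N" "disjnt ?H ?N"
      unfolding disjnt_iff
      using X_props(3) H_props(3) H_props(4) M_props(2,3,5) N_props(3,4) by blast+
  qed
  have spec: "is_disjoint_union (Spec ?A) [{{0}, ?x, ?h, ?xh}, ?X, ?M, ?H, ?N]"
    unfolding is_disjoint_union_def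
  proof (intro conjI equalityI subsetI)
    fix P assume "P \<in> Spec ?A"
    then show "P \<in> \<Union>(set [{{0}, ?x, ?h, ?xh}, ?X, ?M, ?H, ?N])" using cases by simp
  next
    fix P assume "P \<in> \<Union>(set [{{0}, ?x, ?h, ?xh}, ?X, ?M, ?H, ?N])"
    then have "P = {0} \<or> P = ?x \<or> P = ?h \<or> P = ?xh \<or> P \<in> ?X \<or> P \<in> ?M \<or> P \<in> ?H \<or> P \<in> ?N"
      by auto
    then show "P \<in> Spec ?A"
      using zero x_props(1) h_props(1) Max x_xh(1) X_props(1) M_props(1) H_props(1) N_props(1) by blast
  qed (use disj in \<open>simp add: disjnt_sym\<close>)
  have max: "is_disjoint_union (Max_Spec ?A) [?X, {?xh}, ?M, ?H]"
    unfolding is_disjoint_union_def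
  proof (intro conjI equalityI subsetI)
    fix P assume P: "P \<in> Max_Spec ?A"
    have "{0} \<subset> ?x" using bot[OF x_props(1)] x_props(2) gens by blast
    then have "P \<noteq> {0}" "P \<noteq> ?x" "P \<noteq> ?h"
      using maxD[OF P] x_props(1) x_xh(3) h_xh(3) Max[OF x_xh(1)] by blast+
    moreover have "P \<notin> ?N" using P N_props(2) by blast
    ultimately show "P \<in> \<Union>(set [?X, {?xh}, ?M, ?H])" using cases[OF Max[OF P]] by simp
  next
    fix P assume "P \<in> \<Union>(set [?X, {?xh}, ?M, ?H])"
    then show "P \<in> Max_Spec ?A" using X_props(1) x_xh(1) M_props(1) H_props(1) by auto
  qed (use disj in \<open>simp add: disjnt_sym\<close>)
  have iso: "eval_st q n \<in> ring_iso (ring_of_type_algebra :: 'k poly poly ring) (Z_ring q)"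
    using Z.iso by (simp only: eval_st_eq)
  have lines: "{0} \<subset> ?x \<and> {0} \<subset> ?h \<and> (\<forall>P\<in>?N. {0} \<subset> P) \<and> (\<forall>Q\<in>?X. ?x \<subset> Q) \<and> ?x \<subset> ?xh \<and>
      (\<forall>Q\<in>?H. ?h \<subset> Q) \<and> ?h \<subset> ?xh"
  proof -
    have strict: "{0} \<subset> P" if "P \<in> Spec ?A" "P \<noteq> {0}" for P using bot[OF that(1)] that(2) by blast
    have "?x \<noteq> {0}" "?h \<noteq> {0}" using distinct by auto
    then have "{0} \<subset> ?x" "{0} \<subset> ?h" using strict x_props(1) h_props(1) by blast+
    moreover have "\<forall>P\<in>?N. {0} \<subset> P" using strict N_props(1) N_props(5) by blast
    moreover have "\<forall>Q\<in>?X. ?x \<subset> Q" "\<forall>Q\<in>?H. ?h \<subset> Q" using X_props(5) H_props(5) by blast+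
    ultimately show ?thesis using x_xh(3) h_xh(3) by simp
  qed
  \<comment> \<open>Strictness comes from \<open>x\<close> and \<open>h\<close>: members of
    \<open>set_N\<close> contain neither, while \<open>Q\<close> contains one of them.\<close>
  have below: "\<exists>P\<in>?N. P \<subset> Q"
    if "Q \<in> Spec ?A" "gen_x \<in> Q \<or> gen_h \<in> Q" "monom 1 n - [:monom 1 n + [:a:]:] \<in> Q" for Q a
  proof (intro bexI psubsetI)
    show N: "lift_ideal (line a) \<in> ?N" by (rule lift_line_in_N)
    show "lift_ideal (line a) \<subseteq> Q" by (rule lift_line_subset[OF id[OF that(1)] that(3)])
    show "lift_ideal (line a) \<noteq> Q" using N_props(3,4)[OF N] that(2) by blast
  qed
  have dotted: "(\<exists>P\<in>?N. \<exists>Q\<in>?X. P \<subset> Q) \<and> (\<exists>P\<in>?N. \<exists>Q\<in>?M. P \<subset> Q) \<and> (\<exists>P\<in>?N. \<exists>Q\<in>?H. P \<subset> Q) \<and>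
      (\<exists>P\<in>?N. P \<subset> ?xh)"
  proof (intro conjI)
    \<comment> \<open>The point h = 1, x = 0, that is s = 1, t = 0, lies on t = s - 1; hence
      \<open>a = - 1\<close>.\<close>
    define QX where "QX = (\<lambda>f. coeff f 0) -` {r :: 'k poly. poly r 1 = 0}"
    have QX: "QX \<in> ?X" unfolding X QX_def by (rule px.linear_family) simp
    have "monom 1 n - [:monom 1 n + [:- 1:]:] \<in> QX"
      using n0 by (simp add: QX_def poly_monom)
    then show "\<exists>P\<in>?N. \<exists>Q\<in>?X. P \<subset> Q"
      using below[OF X_props(2)[OF QX]] X_props(3)[OF QX] QX by blast
    \<comment> \<open>The point h = 0, x = 1, that is s = 0, t = 1, lies on t = s + 1.\<close>
    define QH where "QH = map_poly (\<lambda>p. coeff p 0) -` {r :: 'k poly. poly r 1 = 0}"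
    have QH: "QH \<in> ?H" unfolding H QH_def by (rule ph.linear_family) simp
    have "map_poly (\<lambda>p. coeff p 0) (monom 1 n - [:monom 1 n + [:1 :: 'k:]:]) = monom 1 n - [:1:]"
      by (rule poly_eqI) (use n0 in \<open>simp add: coeff_map_poly coeff_pCons coeff_monom split: nat.splits\<close>)
    then have "monom 1 n - [:monom 1 n + [:1:]:] \<in> QH"
      by (simp add: QH_def poly_monom)
    then show "\<exists>P\<in>?N. \<exists>Q\<in>?H. P \<subset> Q"
      using below[OF H_props(2)[OF QH]] H_props(3)[OF QH] QH by blast
    \<comment> \<open>The origin lies on t = s: modulo \<open>x\<close> the element t - s becomes
      \<open>- h^n\<close>, a multiple of \<open>h\<close>.\<close>
    have "[:0, 1:] dvd - monom (1 :: 'k) n"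
      using n0 poly_eq_0_iff_dvd[of "- monom (1 :: 'k) n" 0] by (simp add: poly_monom power_0_left)
    then have "monom 1 n - [:monom 1 n + [:0:]:] \<in> ?xh"
      unfolding xh(1) px.Idl_g_g' using n0 by simp
    then show "\<exists>P\<in>?N. P \<subset> ?xh"
      using below[OF Max[OF x_xh(1)]] x_xh(2) by blast
    show "\<exists>P\<in>?N. \<exists>Q\<in>?M. P \<subset> Q"
      using line_0_below_M lift_line_in_N by blast
  qed
  have all: "\<forall>P\<in>Spec ?A. \<forall>Q\<in>Spec ?A. P \<subset> Q \<longrightarrow>
        P = {0} \<or>
        P = ?x \<and> Q \<in> ?X \<union> {?xh} \<or>
        P = ?h \<and> Q \<in> ?H \<union> {?xh} \<or>
        P \<in> ?N \<and> Q \<in> ?X \<union> ?M \<union> ?H \<union> {?xh}"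
  proof (intro ballI impI)
    fix P Q assume P: "P \<in> Spec ?A" and Q: "Q \<in> Spec ?A" and PQ: "P \<subset> Q"
    \<comment> \<open>The lower prime of a strict inclusion is not maximal, which leaves four kinds
      for \<open>P\<close>.\<close>
    have nmax: "P \<notin> Max_Spec ?A" using maxD[OF _ Q PQ] by blast
    have Q0: "Q \<noteq> {0}" using PQ bot[OF P] by auto
    consider "P = {0}" | "P = ?x" | "P = ?h" | "P \<in> ?N"
      using cases[OF P] nmax x_xh(1) X_props(1) M_props(1) H_props(1) by blast
    then show "P = {0} \<or> P = ?x \<and> Q \<in> ?X \<union> {?xh} \<or> P = ?h \<and> Q \<in> ?H \<union> {?xh} \<or>
        P \<in> ?N \<and> Q \<in> ?X \<union> ?M \<union> ?H \<union> {?xh}"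
    proof cases
      case 2
      then have "gen_x \<in> Q" using PQ x_props(2) by blast
      then have "Q = ?x \<or> Q = ?xh \<or> Q \<in> ?X"
        using px.Spec_containing_cases[OF Q] unfolding ideal_x_def xh(1) X by blast
      then show ?thesis using 2 PQ by blast
    next
      case 3
      then have "gen_h \<in> Q" using PQ h_props(2) by blast
      then have "Q = ?h \<or> Q = ?xh \<or> Q \<in> ?H"
        using ph.Spec_containing_cases[OF Q] unfolding ideal_h_def xh(2) H by blast
      then show ?thesis using 3 PQ by blast
    next
      case 4
      then have "Q \<noteq> ?x" "Q \<noteq> ?h" "Q \<notin> ?N" using PQ N_props(6-8)[OF 4] by blast+
      then show ?thesis using cases[OF Q] Q0 4 by blast
    qed simp
  qed
  have centre: "\<forall>I. ideal I ?A \<and> I \<noteq> {0} \<longrightarrow> I \<inter> centre ?A \<noteq> {0}"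
    using nonzero_ideal_meets_centre by simp
  show ?thesis
    by (rule conjI[OF conjI[OF distinct conjI[OF spec conjI[OF centre_iso(2) iso]]]
          conjI[OF lines conjI[OF dotted conjI[OF all conjI[OF centre max]]]]])
qed

end
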